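(* The set $\mathcal D_P$ is a proper subset of the set $\mathcal D$ of all Dixmier traces.
   Context: $L_\infty=L_\infty(0,\infty)$ is the space of real-valued bounded Lebesgue measurable functions on $(0,\infty)$ with the essential supremum norm. A generalized limit is a positive linear functional $\omega$ on $L_\infty$, normalized ($\omega(1)=1$), which equals the ordinary limit on functions convergent at $+\infty$. It is dilation invariant if $\omega(x(\beta\,\cdot))=\omega(x)$ for all $x\in L_\infty$ and $\beta>0$, and exponentiation invariant if $\omega(P^ax)=\omega(x)$ for all $x\in L_\infty$ and $a>0$, where $(P^ax)(t)=x(t^a)$. $H$ is a separable infinite-dimensional (complex) Hilbert space, $B(H)$ the algebra of bounded linear operators on $H$, $\mathrm{Tr}$ the standard trace. For $T\in B(H)$, $\mu(t,T)=\inf\{\|Tp\| : p\in B(H)\text{ a projection with }\mathrm{Tr}(1-p)\le t\}$. The Dixmier ideal is $$\mathcal M_{1,\infty}=\left\{T\in B(H):\ \sup_{t>0}\frac1{\log(1+t)}\int_0^t\mu(s,T)\,ds<\infty\right\}.$$ For a dilation invariant or an exponentiation invariant generalized limit $\omega$, the formula $$\mathrm{Tr}_\omega(T)=\omega\left(\frac{1}{\log(1+t)}\int_0^t\mu(s,T)\,ds\right),\qquad 0\le T\in\mathcal M_{1,\infty},$$ is additive on the positive cone, and $\mathrm{Tr}_\omega$ denotes its linear extension to $\mathcal M_{1,\infty}$. $\mathcal D$ (the set of all Dixmier traces) is the set of all functionals $\mathrm{Tr}_\omega$ on $\mathcal M_{1,\infty}$ with $\omega$ dilation invariant; $\mathcal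 D_P$ is the set of all functionals $\mathrm{Tr}_\omega$ on $\mathcal M_{1,\infty}$ with $\omega$ exponentiation invariant. *)

theory Defs
  imports "HOL-Analysis.Analysis" "HOL-Library.Nonpos_Ints"
begin

section \<open>Complex Hilbert spaces\<close>

class scaleC =
  fixes scaleC :: "complex \<Rightarrow> 'a \<Rightarrow> 'a"  (infixr \<open>*\<^sub>C\<close> 75)

text \<open>The inner product is linear in its first argument. The last axiom says both that the norm is
  the one induced by the inner product and that the inner product is positive definite.\<close>

class complex_inner = real_normed_vector + scaleC +
  fixes cinner :: "'a \<Rightarrow> 'a \<Rightarrow> complex"
  assumes scaleC_add_right: "c *\<^sub>C (x + y) = c *\<^sub>C x + c *\<^sub>C y"
    and scaleC_add_left: "(c + d) *\<^sub>C x = c *\<^sub>C x + d *\<^sub>C x"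
    and scaleC_scaleC: "c *\<^sub>C (d *\<^sub>C x) = (c * d) *\<^sub>C x"
    and scaleC_of_real: "complex_of_real r *\<^sub>C x = r *\<^sub>R x"
    and cinner_commute: "cinner x y = cnj (cinner y x)"
    and cinner_add_left: "cinner (x + y) z = cinner x z + cinner y z"
    and cinner_scaleC_left: "cinner (c *\<^sub>C x) y = c * cinner x y"
    and cinner_norm: "cinner x x = complex_of_real ((norm x)\<^sup>2)"

class complex_hilbert = complex_inner + complete_space

lemma vector_space_scaleC: "vector_space ((*\<^sub>C) :: complex \<Rightarrow> 'a \<Rightarrow> 'a::complex_inner)"
proof
  show "1 *\<^sub>C x = x" for x :: 'a
    using scaleC_of_real[of 1 x] by simp
qed (simp_all add: scaleC_add_right scaleC_add_left scaleC_scaleC)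

global_interpretation complex_vector:
  vector_space "(*\<^sub>C) :: complex \<Rightarrow> 'a \<Rightarrow> 'a::complex_inner"
  by (rule vector_space_scaleC)

lemma norm_scaleC: "norm (c *\<^sub>C x) = cmod c * norm (x :: 'a::complex_inner)"
proof -
  have "complex_of_real ((norm (c *\<^sub>C x))\<^sup>2) = c * cnj (c * cinner x x)"
    by (metis cinner_norm cinner_scaleC_left cinner_commute)
  also have "\<dots> = (c * cnj c) * complex_of_real ((norm x)\<^sup>2)"
    by (simp add: cinner_norm)
  also have "\<dots> = complex_of_real ((cmod c * norm x)\<^sup>2)"
    by (simp add: complex_norm_square[symmetric] power_mult_distrib)
  finally have "(norm (c *\<^sub>C x))\<^sup>2 = (cmod c * norm x)\<^sup>2"
    by (simp only: of_real_eq_iff)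
  then show ?thesis
    by (simp add: power2_eq_iff_nonneg)
qed

definition infinite_dimensional :: "'a::complex_inner itself \<Rightarrow> bool" where
  "infinite_dimensional _ \<longleftrightarrow> (\<nexists>B :: 'a set. finite B \<and> complex_vector.span B = UNIV)"

definition is_orthonormal_basis :: "'a::complex_inner set \<Rightarrow> bool" where
  "is_orthonormal_basis E \<longleftrightarrow>
     (\<forall>x\<in>E. \<forall>y\<in>E. cinner x y = (if x = y then 1 else 0)) \<and>
     closure (complex_vector.span E) = UNIV"


section \<open>Operators\<close>

text \<open>The type \<^typ>\<open>'a \<Rightarrow>\<^sub>L 'a\<close> only provides real-linear operators.\<close>

definition bounded_operators :: "('a::complex_inner \<Rightarrow>\<^sub>L 'a) set" where
  "bounded_operators = {T. \<forall>c x. blinfun_apply T (c *\<^sub>C x) = c *\<^sub>C blinfun_apply T x}"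

definition op_scaleC :: "complex \<Rightarrow> ('a::complex_inner \<Rightarrow>\<^sub>L 'a) \<Rightarrow> ('a \<Rightarrow>\<^sub>L 'a)" where
  "op_scaleC c T = Blinfun (\<lambda>x. c *\<^sub>C blinfun_apply T x)"

lemma op_scaleC_apply: "blinfun_apply (op_scaleC c T) x = c *\<^sub>C blinfun_apply T x"
proof -
  have "bounded_linear (\<lambda>x. c *\<^sub>C x :: 'a)"
  proof (rule bounded_linear_intro)
    show "c *\<^sub>C (r *\<^sub>R x) = r *\<^sub>R (c *\<^sub>C x)" for r and x :: 'a
      by (simp flip: scaleC_of_real add: scaleC_scaleC mult.commute)
    show "norm (c *\<^sub>C x) \<le> norm x * cmod c" for x :: 'a
      by (simp add: norm_scaleC mult.commute)
  qed (simp add: scaleC_add_right)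
  then have "bounded_linear (\<lambda>x. c *\<^sub>C blinfun_apply T x)"
    by (rule bounded_linear_compose[OF _ blinfun.bounded_linear_right])
  then show ?thesis
    by (simp add: op_scaleC_def bounded_linear_Blinfun_apply)
qed

definition positive_operator :: "('a::complex_inner \<Rightarrow>\<^sub>L 'a) \<Rightarrow> bool" where
  "positive_operator T \<longleftrightarrow>
     T \<in> bounded_operators \<and> (\<forall>x. cinner (blinfun_apply T x) x \<in> \<real>\<^sub>\<ge>\<^sub>0)"

definition is_projection :: "('a::complex_inner \<Rightarrow>\<^sub>L 'a) \<Rightarrow> bool" where
  "is_projection p \<longleftrightarrow> p \<in> bounded_operators \<and> p o\<^sub>L p = p \<and>
     (\<forall>x y. cinner (blinfun_apply p x) y = cinner x (blinfun_apply p y))"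

text \<open>The standard trace, with values in \<open>[0, \<infinity>]\<close>. It is meant for positive operators, where the
  value does not depend on the choice of the orthonormal basis.\<close>

definition op_trace :: "('a::complex_hilbert \<Rightarrow>\<^sub>L 'a) \<Rightarrow> ennreal" where
  "op_trace T = (\<Sum>\<^sub>\<infinity>e\<in>(SOME E. is_orthonormal_basis E). ennreal (Re (cinner (blinfun_apply T e) e)))"

definition singular_value :: "real \<Rightarrow> ('a::complex_hilbert \<Rightarrow>\<^sub>L 'a) \<Rightarrow> real" where
  "singular_value t T =
     Inf {norm (T o\<^sub>L p) | p. is_projection p \<and> op_trace (id_blinfun - p) \<le> ennreal t}"

definition log_mean :: "('a::complex_hilbert \<Rightarrow>\<^sub>L 'a) \<Rightarrow> real \<Rightarrow> real" where
  "log_mean T t = 1 / ln (1 + t) * integral {0..t} (\<lambda>s. singular_value s T)"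

definition dixmier_ideal :: "('a::complex_hilbert \<Rightarrow>\<^sub>L 'a) set" where
  "dixmier_ideal = {T \<in> bounded_operators. bdd_above (log_mean T ` {0<..})}"


section \<open>Generalized limits\<close>

text \<open>Elements of \<open>L\<^sub>\<infinity>(0, \<infinity>)\<close> are represented by functions on \<^typ>\<open>real\<close>, whose values outside
  \<open>(0, \<infinity>)\<close> play no role. A functional on \<open>L\<^sub>\<infinity>(0, \<infinity>)\<close> is a functional on these representatives; positivity
  with respect to almost everywhere inequality, together with additivity, forces it to respect almost
  everywhere equality.\<close>

definition Linfty :: "(real \<Rightarrow> real) set" where
  "Linfty = {x \<in> borel_measurable (lebesgue_on {0<..}).
               \<exists>C. AE t in lebesgue_on {0<..}. \<bar>x t\<bar> \<le> C}"

definition generalized_limit :: "((real \<Rightarrow> real) \<Rightarrow> real) \<Rightarrow> bool" where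
  "generalized_limit \<omega> \<longleftrightarrow>
     (\<forall>x\<in>Linfty. \<forall>y\<in>Linfty. \<omega> (\<lambda>t. x t + y t) = \<omega> x + \<omega> y) \<and>
     (\<forall>c. \<forall>x\<in>Linfty. \<omega> (\<lambda>t. c * x t) = c * \<omega> x) \<and>
     (\<forall>x\<in>Linfty. (AE t in lebesgue_on {0<..}. 0 \<le> x t) \<longrightarrow> 0 \<le> \<omega> x) \<and>
     \<omega> (\<lambda>t. 1) = 1 \<and>
     (\<forall>x\<in>Linfty. \<forall>l. (x \<longlongrightarrow> l) at_top \<longrightarrow> \<omega> x = l)"

definition dilation_invariant :: "((real \<Rightarrow> real) \<Rightarrow> real) \<Rightarrow> bool" where
  "dilation_invariant \<omega> \<longleftrightarrow> (\<forall>x\<in>Linfty. \<forall>\<beta>>0. \<omega> (\<lambda>t. x (\<beta> * t)) = \<omega> x)"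

definition exponentiation_invariant :: "((real \<Rightarrow> real) \<Rightarrow> real) \<Rightarrow> bool" where
  "exponentiation_invariant \<omega> \<longleftrightarrow> (\<forall>x\<in>Linfty. \<forall>a>0. \<omega> (\<lambda>t. x (t powr a)) = \<omega> x)"


section \<open>Dixmier traces\<close>

text \<open>A functional on the ideal is a function that is \<^const>\<open>undefined\<close> outside of it.\<close>

definition linear_functional_on_ideal :: "(('a::complex_hilbert \<Rightarrow>\<^sub>L 'a) \<Rightarrow> complex) \<Rightarrow> bool" where
  "linear_functional_on_ideal \<phi> \<longleftrightarrow>
     \<phi> \<in> extensional dixmier_ideal \<and>
     (\<forall>S\<in>dixmier_ideal. \<forall>T\<in>dixmier_ideal. \<phi> (S + T) = \<phi> S + \<phi> T) \<and>
     (\<forall>c. \<forall>T\<in>dixmier_ideal. \<phi> (op_scaleC c T) = c * \<phi> T)"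

text \<open>The linear extension from the positive cone of the ideal to the whole ideal.\<close>

definition Tr_lim :: "((real \<Rightarrow> real) \<Rightarrow> real) \<Rightarrow> ('a::complex_hilbert \<Rightarrow>\<^sub>L 'a) \<Rightarrow> complex" where
  "Tr_lim \<omega> = (THE \<phi>. linear_functional_on_ideal \<phi> \<and>
     (\<forall>T\<in>dixmier_ideal. positive_operator T \<longrightarrow> \<phi> T = complex_of_real (\<omega> (log_mean T))))"

definition dixmier_traces :: "(('a::complex_hilbert \<Rightarrow>\<^sub>L 'a) \<Rightarrow> complex) set" where
  "dixmier_traces = {Tr_lim \<omega> | \<omega>. generalized_limit \<omega> \<and> dilation_invariant \<omega>}"

definition exponentiation_dixmier_traces :: "(('a::complex_hilbert \<Rightarrow>\<^sub>L 'a) \<Rightarrow> complex) set" where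
  "exponentiation_dixmier_traces =
     {Tr_lim \<omega> | \<omega>. generalized_limit \<omega> \<and> exponentiation_invariant \<omega>}"

end

theory Submission
  imports Defs "HOL-Real_Asymp.Real_Asymp"
begin

text \<open>Write \<open>x\<^sub>T\<close> for the logarithmic mean \<^term>\<open>log_mean T\<close> and \<open>F\<^sub>T t\<close> for its numerator, the
  integral of the singular values over \<open>[0, t]\<close>.

  Inclusion. If \<open>\<omega>\<close> is a generalized limit, then so is \<open>x \<mapsto> \<omega> (A x)\<close>, where \<open>A x t\<close> is the mean of
  \<open>x\<close> over \<open>[t, t\<^sup>2]\<close> with respect to \<open>ds / s\<close>; and it is dilation invariant, because a dilation moves
  the window by a bounded amount on the logarithmic scale (\<open>log_average_generalized_limit\<close>). On the
  other hand \<open>A x t\<close> is the mean of \<open>x (t powr w)\<close> over \<open>w \<in> [1, 2]\<close>. Since \<open>F\<^sub>T\<close> is increasing, this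
  mean is controlled by Riemann sums, and so \<open>\<omega> (A x\<^sub>T) = \<omega> x\<^sub>T\<close> for an exponentiation invariant
  \<open>\<omega>\<close> (\<open>exponentiation_invariant_log_mean\<close>). Thus \<open>\<omega>\<close> and \<open>\<omega> \<circ> A\<close> determine the same trace.

  Properness. There is a positive diagonal operator \<open>T\<close> with \<open>x\<^sub>T t - h t \<longlonglongrightarrow> 0\<close>, where
  \<open>h t = 1 + sin (ln (ln t)) / 4\<close>. Replacing \<open>t\<close> by \<open>t powr exp pi\<close> changes the sign of the
  oscillating term, so every exponentiation invariant \<open>\<omega>\<close> has the value 1 at \<open>x\<^sub>T\<close>. But \<open>A h\<close> still
  oscillates, and a cluster point of the functionals \<open>x \<mapsto> A x (t n)\<close> along a suitable sequence is a
  dilation invariant generalized limit with a value greater than 1 at \<open>x\<^sub>T\<close>.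

  To separate the traces, the value of \<^term>\<open>Tr_lim \<omega> T\<close> must really be \<open>\<omega> x\<^sub>T\<close>, which is
  \<open>Tr_lim_positive_cone\<close>: the description that defines \<^const>\<open>Tr_lim\<close> has a unique solution. This is
  the part that needs operator theory. The singular values are identified with Gelfand numbers, which
  leads to a Schmidt decomposition of the operators in the ideal, without adjoints or a spectral
  theorem. The decomposition gives Ky Fan's inequalities
  \<open>F\<^sub>S\<^sub>+\<^sub>T t \<le> F\<^sub>S t + F\<^sub>T t \<le> F\<^sub>S\<^sub>+\<^sub>T (2 t)\<close> for positive \<open>S\<close>, \<open>T\<close> (up to constants), hence additivity
  on the positive cone for dilation invariant \<open>\<omega>\<close>; and, by polarization, it writes every operator in
  the ideal as a combination of four positive ones.\<close>

section \<open>Complex inner product spaces\<close>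

lemma cinner_add_right: "cinner x (y + z) = cinner x y + cinner x z"
  by (metis cinner_commute cinner_add_left complex_cnj_add)

lemma cinner_scaleC_right: "cinner x (c *\<^sub>C y) = cnj c * cinner x y"
  by (metis cinner_commute cinner_scaleC_left complex_cnj_mult)

lemma cinner_zero_left [simp]: "cinner 0 (x :: 'a::complex_inner) = 0"
  using cinner_scaleC_left[of 0 "0 :: 'a" x] by simp

lemma cinner_zero_right [simp]: "cinner (x :: 'a::complex_inner) 0 = 0"
  by (metis cinner_commute cinner_zero_left complex_cnj_zero)

lemma uminus_scaleC: "- (x :: 'a::complex_inner) = (- 1) *\<^sub>C x"
  by simp

lemma cinner_minus_left: "cinner (- x) y = - cinner x y"
  by (subst uminus_scaleC, subst cinner_scaleC_left) simp

lemma cinner_minus_right: "cinner x (- y) = - cinner x y"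
  by (subst uminus_scaleC, subst cinner_scaleC_right) simp

lemma cinner_diff_left: "cinner (x - y) z = cinner x z - cinner y z"
  using cinner_add_left[of x "- y" z] by (simp add: cinner_minus_left)

lemma cinner_diff_right: "cinner x (y - z) = cinner x y - cinner x z"
  using cinner_add_right[of x y "- z"] by (simp add: cinner_minus_right)

lemma cinner_sum_left: "cinner (\<Sum>i\<in>I. f i) y = (\<Sum>i\<in>I. cinner (f i) y)"
  by (induction I rule: infinite_finite_induct) (auto simp: cinner_add_left)

lemma cinner_sum_right: "cinner y (\<Sum>i\<in>I. f i) = (\<Sum>i\<in>I. cinner y (f i))"
  by (induction I rule: infinite_finite_induct) (auto simp: cinner_add_right)

lemma cinner_eq_0_commute: "cinner x y = 0 \<longleftrightarrow> cinner y x = 0"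
  by (metis cinner_commute complex_cnj_zero)

lemma Re_cinner_self: "Re (cinner x x) = (norm x)\<^sup>2"
  by (simp add: cinner_norm)

lemma cinner_self_eq_0 [simp]: "cinner x x = 0 \<longleftrightarrow> x = 0"
  by (simp add: cinner_norm)

lemma cinner_ext:
  assumes "\<And>z. cinner x z = cinner y z"
  shows "x = y"
proof -
  have "cinner (x - y) (x - y) = 0"
    by (simp add: cinner_diff_left assms)
  then show ?thesis by simp
qed

lemma Re_cinner_commute: "Re (cinner x y) = Re (cinner y x)"
  by (subst cinner_commute) simp

lemma norm_add_square: "(norm (x + y))\<^sup>2 = (norm x)\<^sup>2 + (norm y)\<^sup>2 + 2 * Re (cinner x y)"
proof -
  have "(norm (x + y))\<^sup>2 = Re (cinner (x + y) (x + y))"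
    by (simp only: Re_cinner_self)
  also have "\<dots> = (norm x)\<^sup>2 + (norm y)\<^sup>2 + (Re (cinner x y) + Re (cinner y x))"
    by (simp add: cinner_add_left cinner_add_right Re_cinner_self)
  finally show ?thesis
    using Re_cinner_commute[of x y] by simp
qed

lemma norm_diff_square: "(norm (x - y))\<^sup>2 = (norm x)\<^sup>2 + (norm y)\<^sup>2 - 2 * Re (cinner x y)"
  using norm_add_square[of x "- y"] by (simp add: cinner_minus_right)

lemma parallelogram_law: "(norm (x + y))\<^sup>2 + (norm (x - y))\<^sup>2 = 2 * (norm x)\<^sup>2 + 2 * (norm y)\<^sup>2"
  for x y :: "'a::complex_inner"
  by (simp add: norm_add_square norm_diff_square)

lemma norm_add_square_orthogonal:
  assumes "cinner x y = 0"
  shows "(norm (x + y))\<^sup>2 = (norm x)\<^sup>2 + (norm y)\<^sup>2"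
  using assms by (simp add: norm_add_square)

text \<open>Polarization: a sesquilinear form whose quadratic form vanishes is zero.\<close>

lemma sesquilinear_eq_0:
  fixes B :: "'a::complex_inner \<Rightarrow> 'a \<Rightarrow> complex"
  assumes "\<And>x y z. B (x + y) z = B x z + B y z" "\<And>x y z. B x (y + z) = B x y + B x z"
    and "\<And>c x y. B (c *\<^sub>C x) y = c * B x y" "\<And>c x y. B x (c *\<^sub>C y) = cnj c * B x y"
    and "\<And>x. B x x = 0"
  shows "B x y = 0"
proof -
  have "B x y + B y x = 0"
    using assms(5)[of "x + y"] assms(5)[of x] assms(5)[of y]
    by (simp add: assms(1,2) add.commute)
  moreover have "B (\<i> *\<^sub>C x) y + B y (\<i> *\<^sub>C x) = 0"
    using assms(5)[of "\<i> *\<^sub>C x + y"] assms(5)[of "\<i> *\<^sub>C x"] assms(5)[of y]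
    by (simp add: assms(1,2) add.commute)
  then have "\<i> * (B x y - B y x) = 0"
    by (simp add: assms(3,4) algebra_simps)
  ultimately show ?thesis
    by simp
qed


section \<open>Orthogonal families\<close>

text \<open>Families of pairwise orthogonal vectors of norm at most one. Allowing the norm to drop below
  one makes room for the left singular vectors that belong to the singular value zero.\<close>

definition suborthonormal :: "'i set \<Rightarrow> ('i \<Rightarrow> 'a::complex_inner) \<Rightarrow> bool" where
  "suborthonormal I v \<longleftrightarrow>
     (\<forall>i\<in>I. norm (v i) \<le> 1) \<and> (\<forall>i\<in>I. \<forall>j\<in>I. i \<noteq> j \<longrightarrow> cinner (v i) (v j) = 0)"

text \<open>Orthonormal families. A set \<open>F\<close> of vectors is orthonormal if the identity family on it is, that is,
  \<open>orthonormal F (\<lambda>x. x)\<close>.\<close>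

definition orthonormal :: "'i set \<Rightarrow> ('i \<Rightarrow> 'a::complex_inner) \<Rightarrow> bool" where
  "orthonormal I v \<longleftrightarrow> (\<forall>i\<in>I. \<forall>j\<in>I. cinner (v i) (v j) = (if i = j then 1 else 0))"

text \<open>For an orthonormal family this is the orthogonal projection onto its span.\<close>

definition expansion :: "'i set \<Rightarrow> ('i \<Rightarrow> 'a::complex_inner) \<Rightarrow> 'a \<Rightarrow> 'a" where
  "expansion I v x = (\<Sum>i\<in>I. cinner x (v i) *\<^sub>C v i)"

lemma orthonormal_norm: "orthonormal I v \<Longrightarrow> i \<in> I \<Longrightarrow> norm (v i) = 1"
  unfolding orthonormal_def using Re_cinner_self[of "v i"] by (simp add: power2_eq_1_iff) 
     (smt (verit) norm_ge_zero)

lemma orthonormal_imp_suborthonormal: "orthonormal I v \<Longrightarrow> suborthonormal I v"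
  using orthonormal_norm[of I v] by (auto simp: suborthonormal_def orthonormal_def)

lemma suborthonormal_subset: "suborthonormal I v \<Longrightarrow> J \<subseteq> I \<Longrightarrow> suborthonormal J v"
  by (auto simp: suborthonormal_def)

lemma orthonormal_subset: "orthonormal I v \<Longrightarrow> J \<subseteq> I \<Longrightarrow> orthonormal J v"
  unfolding orthonormal_def by blast

lemma norm_sum_orthogonal:
  assumes "finite I" "\<And>i j. i \<in> I \<Longrightarrow> j \<in> I \<Longrightarrow> i \<noteq> j \<Longrightarrow> cinner (v i) (v j) = 0"
  shows "(norm (\<Sum>i\<in>I. c i *\<^sub>C v i))\<^sup>2 = (\<Sum>i\<in>I. (cmod (c i))\<^sup>2 * (norm (v i))\<^sup>2)"
  using assms
proof (induction I rule: finite_induct)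
  case (insert i I)
  have "cinner (c i *\<^sub>C v i) (\<Sum>j\<in>I. c j *\<^sub>C v j) = 0"
    unfolding cinner_sum_right
    by (rule sum.neutral) (use insert in \<open>auto simp: cinner_scaleC_left cinner_scaleC_right\<close>)
  then have "(norm (\<Sum>j\<in>insert i I. c j *\<^sub>C v j))\<^sup>2 =
      (norm (c i *\<^sub>C v i))\<^sup>2 + (norm (\<Sum>j\<in>I. c j *\<^sub>C v j))\<^sup>2"
    using insert(1,2) by (simp add: norm_add_square_orthogonal)
  then show ?case
    using insert by (simp add: norm_scaleC power_mult_distrib)
qed simp

lemma cinner_expansion:
  "cinner x (expansion I v x) = complex_of_real (\<Sum>i\<in>I. (cmod (cinner x (v i)))\<^sup>2)"
  unfolding expansion_def cinner_sum_right of_real_sum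
  by (rule sum.cong) (simp_all add: cinner_scaleC_right complex_norm_square[symmetric] mult.commute
    del: of_real_power)

lemma norm_diff_expansion:
  assumes "finite I" "suborthonormal I v"
  shows "(norm (x - expansion I v x))\<^sup>2 =
    (norm x)\<^sup>2 - (\<Sum>i\<in>I. (2 - (norm (v i))\<^sup>2) * (cmod (cinner x (v i)))\<^sup>2)"
proof -
  have "(norm (expansion I v x))\<^sup>2 = (\<Sum>i\<in>I. (cmod (cinner x (v i)))\<^sup>2 * (norm (v i))\<^sup>2)"
    unfolding expansion_def
    by (rule norm_sum_orthogonal) (use assms in \<open>auto simp: suborthonormal_def\<close>)
  then show ?thesis
    by (simp add: norm_diff_square cinner_expansion left_diff_distrib sum_subtractf
        sum_distrib_left mult.commute[of "(norm (v _))\<^sup>2"])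
qed

lemma Bessel_inequality:
  assumes "finite I" "suborthonormal I v"
  shows "(\<Sum>i\<in>I. (cmod (cinner x (v i)))\<^sup>2) \<le> (norm x)\<^sup>2"
proof -
  have "(\<Sum>i\<in>I. (cmod (cinner x (v i)))\<^sup>2) \<le> (\<Sum>i\<in>I. (2 - (norm (v i))\<^sup>2) * (cmod (cinner x (v i)))\<^sup>2)"
  proof (rule sum_mono)
    fix i assume "i \<in> I"
    then have "(norm (v i))\<^sup>2 \<le> 1"
      using assms by (simp add: suborthonormal_def power_le_one)
    then show "(cmod (cinner x (v i)))\<^sup>2 \<le> (2 - (norm (v i))\<^sup>2) * (cmod (cinner x (v i)))\<^sup>2"
      using mult_right_mono[of 1 "2 - (norm (v i))\<^sup>2" "(cmod (cinner x (v i)))\<^sup>2"] by simp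
  qed
  also have "\<dots> \<le> (norm x)\<^sup>2"
    using norm_diff_expansion[OF assms, of x] by (smt (verit) zero_le_power2)
  finally show ?thesis .
qed

lemma norm_diff_expansion_orthonormal:
  assumes "finite I" "orthonormal I v"
  shows "(norm (x - expansion I v x))\<^sup>2 = (norm x)\<^sup>2 - (\<Sum>i\<in>I. (cmod (cinner x (v i)))\<^sup>2)"
  by (subst norm_diff_expansion[OF assms(1) orthonormal_imp_suborthonormal[OF assms(2)]])
    (use orthonormal_norm[OF assms(2)] in simp)

lemma cinner_expansion_orthonormal:
  assumes "finite I" "orthonormal I v" "i \<in> I"
  shows "cinner (expansion I v x) (v i) = cinner x (v i)"
proof -
  have "cinner (expansion I v x) (v i) = (\<Sum>j\<in>I. if j = i then cinner x (v i) else 0)"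
    unfolding expansion_def cinner_sum_left
    by (rule sum.cong) (use assms in \<open>auto simp: cinner_scaleC_left orthonormal_def\<close>)
  then show ?thesis
    using assms by simp
qed

lemma orthogonal_diff_expansion:
  assumes "finite I" "orthonormal I v" "i \<in> I"
  shows "cinner (x - expansion I v x) (v i) = 0"
  by (simp add: cinner_diff_left cinner_expansion_orthonormal[OF assms])

lemma norm_diff_expansion_le: "finite I \<Longrightarrow> orthonormal I v \<Longrightarrow> norm (x - expansion I v x) \<le> norm x"
  by (rule power2_le_imp_le) (auto simp: norm_diff_expansion_orthonormal sum_nonneg)

text \<open>The Cauchy--Schwarz inequality is Bessel's inequality for a single vector.\<close>

lemma cinner_Cauchy_Schwarz: "cmod (cinner x y) \<le> norm x * norm y"
proof (cases "y = 0")
  case False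
  define v where "v = complex_of_real (1 / norm y) *\<^sub>C y"
  have "norm v = 1"
    using False by (simp add: v_def norm_scaleC norm_divide)
  then have "(cmod (cinner x v))\<^sup>2 \<le> (norm x)\<^sup>2"
    using Bessel_inequality[of "{()}" "\<lambda>_. v" x] by (simp add: suborthonormal_def)
  then have "cmod (cinner x v) \<le> norm x"
    by (rule power2_le_imp_le) simp
  moreover have "cmod (cinner x v) = cmod (cinner x y) / norm y"
    using False by (simp add: v_def cinner_scaleC_right norm_mult norm_divide)
  ultimately show ?thesis
    using False by (simp add: field_simps)
qed simp

lemma bounded_bilinear_cinner: "bounded_bilinear (cinner :: 'a::complex_inner \<Rightarrow> 'a \<Rightarrow> complex)"
proof
  show "\<exists>K. \<forall>a b :: 'a. norm (cinner a b) \<le> norm a * norm b * K"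
    by (rule exI[of _ 1]) (simp add: cinner_Cauchy_Schwarz)
qed (auto simp: cinner_add_left cinner_add_right cinner_scaleC_left cinner_scaleC_right
    scaleR_conv_of_real simp flip: scaleC_of_real)

lemmas tendsto_cinner = bounded_bilinear.tendsto[OF bounded_bilinear_cinner]

lemma tendsto_scaleC: "(f \<longlongrightarrow> l) F \<Longrightarrow> ((\<lambda>x. c *\<^sub>C f x) \<longlongrightarrow> c *\<^sub>C l) F"
  for l :: "'a::complex_inner"
proof -
  have "bounded_linear (\<lambda>x :: 'a. c *\<^sub>C x)"
    by (rule bounded_linear_intro[of _ "cmod c"])
      (simp_all add: scaleC_add_right scaleC_scaleC norm_scaleC mult.commute flip: scaleC_of_real)
  then show "(f \<longlongrightarrow> l) F \<Longrightarrow> ((\<lambda>x. c *\<^sub>C f x) \<longlongrightarrow> c *\<^sub>C l) F"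
    by (rule bounded_linear.tendsto)
qed

subsection \<open>Gram--Schmidt orthonormalization\<close>

text \<open>The unit vector in the direction of \<open>x\<close>; the zero vector is left unchanged because
  \<open>1 / 0 = 0\<close>.\<close>

definition normalize_vector :: "'a::complex_inner \<Rightarrow> 'a" where
  "normalize_vector x = complex_of_real (1 / norm x) *\<^sub>C x"

lemma norm_normalize_vector: "x \<noteq> 0 \<Longrightarrow> norm (normalize_vector x) = 1"
  by (simp add: normalize_vector_def norm_scaleC norm_divide)

lemma normalize_vector_in_span: "x \<in> complex_vector.span S \<Longrightarrow> normalize_vector x \<in> complex_vector.span S"
  unfolding normalize_vector_def by (rule complex_vector.span_scale)

lemma scaleC_normalize_vector: "complex_of_real (norm x) *\<^sub>C normalize_vector x = x"
  by (cases "x = 0") (simp_all add: normalize_vector_def scaleC_scaleC)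

lemma cinner_normalize_vector_eq_0: "cinner x y = 0 \<Longrightarrow> cinner (normalize_vector x) y = 0"
  by (simp add: normalize_vector_def cinner_scaleC_left)

lemma expansion_in_span: "expansion I v x \<in> complex_vector.span (v ` I)"
  unfolding expansion_def
  by (intro complex_vector.span_sum complex_vector.span_scale complex_vector.span_base) auto

lemma orthonormal_insert:
  assumes "orthonormal F (\<lambda>x. x)" "norm y = 1" "\<And>x. x \<in> F \<Longrightarrow> cinner y x = 0"
  shows "orthonormal (insert y F) (\<lambda>x. x)"
  using assms cinner_norm[of y] cinner_eq_0_commute[of y]
  by (auto simp: orthonormal_def)

text \<open>Adds to the orthonormal set \<open>F\<close> the normalized component of \<open>x\<close> orthogonal to \<open>F\<close>, unless
  \<open>x\<close> already lies in the span of \<open>F\<close>.\<close>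

definition gram_schmidt_step :: "'a::complex_inner set \<Rightarrow> 'a \<Rightarrow> 'a set" where
  "gram_schmidt_step F x = (let r = x - expansion F (\<lambda>v. v) x in
     if r = 0 then F else insert (normalize_vector r) F)"

lemma gram_schmidt_step:
  assumes "finite F" "orthonormal F (\<lambda>x. x)"
  shows "finite (gram_schmidt_step F x)" "orthonormal (gram_schmidt_step F x) (\<lambda>x. x)"
    "F \<subseteq> gram_schmidt_step F x" "x \<in> complex_vector.span (gram_schmidt_step F x)"
    "card (gram_schmidt_step F x) \<le> Suc (card F)"
    "gram_schmidt_step F x \<subseteq> complex_vector.span (insert x F)"
proof -
  define r where "r = x - expansion F (\<lambda>v. v) x"
  have e: "expansion F (\<lambda>v. v) x \<in> complex_vector.span F"
    using expansion_in_span[of F "\<lambda>v. v" x] by simp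
  have eq: "gram_schmidt_step F x = (if r = 0 then F else insert (normalize_vector r) F)"
    by (simp add: gram_schmidt_step_def r_def Let_def)
  show "finite (gram_schmidt_step F x)" "F \<subseteq> gram_schmidt_step F x"
    using assms by (auto simp: eq)
  show "card (gram_schmidt_step F x) \<le> Suc (card F)"
    using assms by (simp add: eq card_insert_if)
  show "orthonormal (gram_schmidt_step F x) (\<lambda>x. x)"
    using assms orthogonal_diff_expansion[OF assms, of _ x]
    by (auto simp: eq r_def norm_normalize_vector cinner_normalize_vector_eq_0
        intro!: orthonormal_insert)
  show "x \<in> complex_vector.span (gram_schmidt_step F x)"
  proof -
    have "r \<in> complex_vector.span (gram_schmidt_step F x)"
    proof (cases "r = 0")
      case False
      then have "normalize_vector r \<in> complex_vector.span (gram_schmidt_step F x)"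
        by (intro complex_vector.span_base) (simp add: eq)
      then show ?thesis
        using complex_vector.span_scale[of "normalize_vector r" _ "complex_of_real (norm r)"]
        by (simp only: scaleC_normalize_vector)
    qed (simp add: complex_vector.span_zero)
    moreover have "expansion F (\<lambda>v. v) x \<in> complex_vector.span (gram_schmidt_step F x)"
      using e complex_vector.span_mono[of F "gram_schmidt_step F x"] \<open>F \<subseteq> gram_schmidt_step F x\<close> by auto
    ultimately have "r + expansion F (\<lambda>v. v) x \<in> complex_vector.span (gram_schmidt_step F x)"
      by (rule complex_vector.span_add)
    then show ?thesis
      by (simp add: r_def)
  qed
  show "gram_schmidt_step F x \<subseteq> complex_vector.span (insert x F)"
  proof -
    have "r \<in> complex_vector.span (insert x F)"
      unfolding r_def using e complex_vector.span_mono[of F "insert x F"]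
      by (intro complex_vector.span_diff) (auto intro: complex_vector.span_base)
    then show ?thesis
      by (auto simp: eq intro: complex_vector.span_base normalize_vector_in_span)
  qed
qed

lemma finite_orthonormalization:
  assumes "finite S"
  shows "\<exists>F. finite F \<and> card F \<le> card S \<and> orthonormal F (\<lambda>x. x) \<and> S \<subseteq> complex_vector.span F
    \<and> F \<subseteq> complex_vector.span S"
  using assms
proof (induction S rule: finite_induct)
  case empty
  show ?case
    by (rule exI[of _ "{}"]) (simp add: orthonormal_def)
next
  case (insert x S)
  then obtain F where F: "finite F" "card F \<le> card S" "orthonormal F (\<lambda>x. x)"
    "S \<subseteq> complex_vector.span F" "F \<subseteq> complex_vector.span S" by blast
  note step = gram_schmidt_step[OF F(1,3), of x]
  have "S \<subseteq> complex_vector.span (gram_schmidt_step F x)"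
    using F(4) complex_vector.span_mono[OF step(3)] by blast
  moreover have "complex_vector.span (insert x F) \<subseteq> complex_vector.span (insert x S)"
    using F(5) complex_vector.span_mono[of S "insert x S"]
    by (intro complex_vector.span_minimal) (auto intro: complex_vector.span_base)
  ultimately show ?case
    using step F(2) insert(1,2)
    by (intro exI[of _ "gram_schmidt_step F x"]) auto
qed

subsection \<open>Best approximation and underdetermined systems\<close>

lemma orthogonal_span:
  assumes "\<And>v. v \<in> V \<Longrightarrow> cinner x v = 0" "y \<in> complex_vector.span V"
  shows "cinner x y = 0"
  using assms(2)
  by (induction rule: complex_vector.span_induct_alt)
    (simp_all add: cinner_add_right cinner_scaleC_right assms(1))

lemma expansion_best_approximation:
  assumes "finite I" "orthonormal I v" "y \<in> complex_vector.span (v ` I)"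
  shows "norm (x - expansion I v x) \<le> norm (x - y)"
proof (rule power2_le_imp_le)
  have "cinner (x - expansion I v x) (expansion I v x - y) = 0"
    by (rule orthogonal_span[of "v ` I"])
      (auto intro!: complex_vector.span_diff expansion_in_span assms(3)
        simp: orthogonal_diff_expansion[OF assms(1,2)])
  from norm_add_square_orthogonal[OF this]
  show "(norm (x - expansion I v x))\<^sup>2 \<le> (norm (x - y))\<^sup>2"
    by simp
qed simp

lemma expansion_eq_self:
  assumes "finite I" "orthonormal I v" "x \<in> complex_vector.span (v ` I)"
  shows "expansion I v x = x"
  using expansion_best_approximation[OF assms(1,2,3), of x] by simp

text \<open>A homogeneous linear system with fewer equations than unknowns has a nontrivial solution.\<close>

lemma exists_nontrivial_solution:
  fixes a :: "'j \<Rightarrow> 'i \<Rightarrow> complex"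
  assumes "finite J" "finite I" "card J < card I"
  shows "\<exists>c. (\<exists>i\<in>I. c i \<noteq> 0) \<and> (\<forall>j\<in>J. (\<Sum>i\<in>I. c i * a j i) = 0)"
  using assms
proof (induction J arbitrary: I a rule: finite_induct)
  case empty
  then obtain i where "i \<in> I"
    by fastforce
  then show ?case
    by (intro exI[of _ "\<lambda>_. 1"]) auto
next
  case (insert k J)
  show ?case
  proof (cases "\<forall>i\<in>I. a k i = 0")
    case True
    have "card J < card I"
      using insert by simp
    from insert.IH[OF insert.prems(1) this, of a] True show ?thesis
      by auto
  next
    case False
    then obtain p where p: "p \<in> I" "a k p \<noteq> 0"
      by blast
    \<comment> \<open>Gaussian elimination: the equation \<open>k\<close> is used to eliminate the unknown \<open>p\<close>.\<close>
    define b where "b j i = a j i - a k i * a j p / a k p" for j i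
    have "card J < card (I - {p})"
      using insert p by simp
    with insert.IH[of "I - {p}" b] insert.prems obtain c where
      c: "\<exists>i\<in>I - {p}. c i \<noteq> 0" "\<And>j. j \<in> J \<Longrightarrow> (\<Sum>i\<in>I - {p}. c i * b j i) = 0"
      by auto
    define d where "d i = (if i = p then - (\<Sum>i\<in>I - {p}. c i * a k i) / a k p else c i)" for i
    have sum_d: "(\<Sum>i\<in>I. d i * a j i) = d p * a j p + (\<Sum>i\<in>I - {p}. c i * a j i)" for j
      unfolding sum.remove[OF insert.prems(1) p(1), of "\<lambda>i. d i * a j i"]
      by (intro arg_cong2[where f = "(+)"] refl sum.cong) (auto simp: d_def)
    show ?thesis
    proof (intro exI[of _ d] conjI ballI)
      show "\<exists>i\<in>I. d i \<noteq> 0"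
        using c(1) by (auto simp: d_def)
      fix j assume "j \<in> insert k J"
      then consider "j = k" | "j \<in> J" by blast
      then show "(\<Sum>i\<in>I. d i * a j i) = 0"
      proof cases
        case 1
        then show ?thesis
          unfolding sum_d using p by (simp add: d_def)
      next
        case 2
        have "(\<Sum>i\<in>I - {p}. c i * b j i) =
            (\<Sum>i\<in>I - {p}. c i * a j i) - (\<Sum>i\<in>I - {p}. c i * a k i) * a j p / a k p"
          by (simp add: b_def algebra_simps sum_subtractf sum_distrib_left sum_divide_distrib)
        then show ?thesis
          unfolding sum_d using c(2)[OF 2] by (simp add: d_def)
      qed
    qed
  qed
qed

text \<open>In the span of more than \<open>n\<close> orthonormal vectors there is a unit vector orthogonal to \<open>n\<close>
  given vectors.\<close>

lemma exists_unit_orthogonal: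
  assumes "finite V" "finite I" "card V < card I" "orthonormal I g"
  shows "\<exists>c. norm (\<Sum>i\<in>I. c i *\<^sub>C g i) = 1 \<and> (\<Sum>i\<in>I. (cmod (c i))\<^sup>2) = 1 \<and>
    (\<forall>v\<in>V. cinner (\<Sum>i\<in>I. c i *\<^sub>C g i) v = 0)"
proof -
  from exists_nontrivial_solution[OF assms(1-3), of "\<lambda>v i. cinner (g i) v"]
  obtain c where c: "\<exists>i\<in>I. c i \<noteq> 0" "\<forall>v\<in>V. (\<Sum>i\<in>I. c i * cinner (g i) v) = 0"
    by blast
  have sq: "(norm (\<Sum>i\<in>I. b i *\<^sub>C g i))\<^sup>2 = (\<Sum>i\<in>I. (cmod (b i))\<^sup>2)" for b
    by (subst norm_sum_orthogonal)
      (use assms orthonormal_norm[OF assms(4)] in \<open>auto simp: orthonormal_def\<close>)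
  define x where "x = (\<Sum>i\<in>I. c i *\<^sub>C g i)"
  have "(norm x)\<^sup>2 > 0"
    unfolding x_def sq using c(1) assms(2) by (auto intro!: sum_pos2)
  then have "x \<noteq> 0" by auto
  define d where "d i = complex_of_real (1 / norm x) * c i" for i
  have d: "(\<Sum>i\<in>I. d i *\<^sub>C g i) = normalize_vector x"
    by (simp add: d_def x_def normalize_vector_def complex_vector.scale_sum_right scaleC_scaleC)
  have 1: "norm (\<Sum>i\<in>I. d i *\<^sub>C g i) = 1"
    using \<open>x \<noteq> 0\<close> by (simp add: d norm_normalize_vector)
  moreover have "(\<Sum>i\<in>I. (cmod (d i))\<^sup>2) = 1"
    using sq[of d] 1 by simp
  moreover have "cinner x v = 0" if "v \<in> V" for v
    using c(2) that by (simp add: x_def cinner_sum_left cinner_scaleC_left)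
  ultimately show ?thesis
    by (intro exI[of _ d]) (auto simp: d cinner_normalize_vector_eq_0)
qed


section \<open>The trace of a projection\<close>

lemma complex_linear_Blinfun:
  assumes "\<And>x y. f (x + y) = f x + f y" "\<And>c x. f (c *\<^sub>C x) = c *\<^sub>C f x"
    "\<And>x :: 'a::complex_inner. norm (f x :: 'a) \<le> norm x * K"
  shows "blinfun_apply (Blinfun f) x = f x" "Blinfun f \<in> bounded_operators"
proof -
  have "bounded_linear f"
    by (rule bounded_linear_intro[OF _ _ assms(3)]) (simp_all add: assms flip: scaleC_of_real)
  then have "blinfun_apply (Blinfun f) = f"
    by (rule bounded_linear_Blinfun_apply)
  then show "blinfun_apply (Blinfun f) x = f x" "Blinfun f \<in> bounded_operators"
    by (auto simp: bounded_operators_def assms)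
qed

text \<open>The Gram--Schmidt process applied to a dense sequence. This is what gives a meaning to the
  choice of a basis in \<^const>\<open>op_trace\<close>.\<close>

lemma separable_imp_orthonormal_basis:
  assumes "separable_space (euclidean :: 'a::complex_inner topology)"
  shows "\<exists>E :: 'a set. is_orthonormal_basis E"
proof -
  from assms obtain D :: "'a set" where D: "countable D" "closure D = UNIV"
    by (auto simp: separable_space_def)
  then have "D \<noteq> {}" by auto
  define d where "d = from_nat_into D"
  have ran: "range d = D"
    unfolding d_def using \<open>D \<noteq> {}\<close> D(1) by (rule range_from_nat_into)
  define F where "F = rec_nat {} (\<lambda>n F. gram_schmidt_step F (d n))"
  have F0: "F 0 = {}" and FS: "F (Suc n) = gram_schmidt_step (F n) (d n)" for n
    by (auto simp: F_def)
  have F: "finite (F n) \<and> orthonormal (F n) (\<lambda>x. x)" for n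
    by (induction n) (auto simp: F0 FS gram_schmidt_step, simp add: orthonormal_def)
  have "F n \<subseteq> F (Suc n)" for n
    using F gram_schmidt_step(3) by (auto simp: FS)
  then have mono: "m \<le> n \<Longrightarrow> F m \<subseteq> F n" for m n
    by (rule lift_Suc_mono_le)
  have "orthonormal (\<Union>n. F n) (\<lambda>x. x)"
    unfolding orthonormal_def
  proof (intro ballI)
    fix x y assume "x \<in> (\<Union>n. F n)" "y \<in> (\<Union>n. F n)"
    then obtain m n where "x \<in> F m" "y \<in> F n" by blast
    then have "x \<in> F (max m n)" "y \<in> F (max m n)"
      using mono[of m "max m n"] mono[of n "max m n"] by auto
    then show "cinner x y = (if x = y then 1 else 0)"
      using F[of "max m n"] by (auto simp: orthonormal_def)
  qed
  moreover have "D \<subseteq> complex_vector.span (\<Union>n. F n)"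
  proof
    fix x assume "x \<in> D"
    then obtain n where "x = d n" using ran by blast
    then have "x \<in> complex_vector.span (F (Suc n))"
      using F by (simp add: FS gram_schmidt_step)
    then show "x \<in> complex_vector.span (\<Union>n. F n)"
      using complex_vector.span_mono[of "F (Suc n)" "\<Union>n. F n"] by blast
  qed
  then have "closure (complex_vector.span (\<Union>n. F n)) = UNIV"
    using D(2) closure_mono[of D "complex_vector.span (\<Union>n. F n)"] by auto
  ultimately show ?thesis
    unfolding is_orthonormal_basis_def orthonormal_def by blast
qed

lemma Parseval:
  assumes "is_orthonormal_basis E"
  shows "(\<Sum>\<^sub>\<infinity>e\<in>E. ennreal ((cmod (cinner x e))\<^sup>2)) = ennreal ((norm x)\<^sup>2)"
proof (rule antisym)
  have on: "orthonormal E (\<lambda>x. x)"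
    using assms by (simp add: is_orthonormal_basis_def orthonormal_def)
  have sup: "(\<Sum>\<^sub>\<infinity>e\<in>E. ennreal ((cmod (cinner x e))\<^sup>2)) =
      (SUP F\<in>{F. finite F \<and> F \<subseteq> E}. \<Sum>e\<in>F. ennreal ((cmod (cinner x e))\<^sup>2))"
    by (rule nonneg_infsum_complete) simp
  show "(\<Sum>\<^sub>\<infinity>e\<in>E. ennreal ((cmod (cinner x e))\<^sup>2)) \<le> ennreal ((norm x)\<^sup>2)"
    unfolding sup
  proof (rule SUP_least)
    fix F assume "F \<in> {F. finite F \<and> F \<subseteq> E}"
    then have "finite F" "orthonormal F (\<lambda>x. x)"
      using orthonormal_subset[OF on] by auto
    then have "(\<Sum>e\<in>F. (cmod (cinner x e))\<^sup>2) \<le> (norm x)\<^sup>2"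
      by (intro Bessel_inequality orthonormal_imp_suborthonormal)
    then show "(\<Sum>e\<in>F. ennreal ((cmod (cinner x e))\<^sup>2)) \<le> ennreal ((norm x)\<^sup>2)"
      by (simp add: sum_ennreal ennreal_leI)
  qed
  show "ennreal ((norm x)\<^sup>2) \<le> (\<Sum>\<^sub>\<infinity>e\<in>E. ennreal ((cmod (cinner x e))\<^sup>2))"
  proof (rule ennreal_le_epsilon)
    fix \<epsilon> :: real assume "\<epsilon> > 0"
    have "x \<in> closure (complex_vector.span E)"
      using assms by (simp add: is_orthonormal_basis_def)
    then obtain y where y: "y \<in> complex_vector.span E" "dist y x < sqrt \<epsilon>"
      using \<open>\<epsilon> > 0\<close> unfolding closure_approachable by (meson real_sqrt_gt_zero)
    then obtain F r where F: "finite F" "F \<subseteq> E" "y = (\<Sum>a\<in>F. r a *\<^sub>C a)"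
      by (auto simp: complex_vector.span_explicit)
    \<comment> \<open>The expansion over the finite set \<open>F\<close> approximates \<open>x\<close> at least as well as \<open>y\<close> does.\<close>
    have onF: "orthonormal F (\<lambda>x. x)"
      using orthonormal_subset[OF on F(2)] .
    have "y \<in> complex_vector.span ((\<lambda>x. x) ` F)"
      unfolding F(3)
      by (intro complex_vector.span_sum complex_vector.span_scale complex_vector.span_base) auto
    then have "norm (x - expansion F (\<lambda>x. x) x) \<le> norm (x - y)"
      by (rule expansion_best_approximation[OF F(1) onF])
    then have "(norm (x - expansion F (\<lambda>x. x) x))\<^sup>2 \<le> (sqrt \<epsilon>)\<^sup>2"
      using y(2) by (intro power_mono) (auto simp: dist_norm norm_minus_commute)
    then have "(norm x)\<^sup>2 \<le> (\<Sum>e\<in>F. (cmod (cinner x e))\<^sup>2) + \<epsilon>"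
      using \<open>\<epsilon> > 0\<close> by (simp add: norm_diff_expansion_orthonormal[OF F(1) onF])
    then have "ennreal ((norm x)\<^sup>2) \<le> ennreal ((\<Sum>e\<in>F. (cmod (cinner x e))\<^sup>2) + \<epsilon>)"
      by (rule ennreal_leI)
    also have "\<dots> = (\<Sum>e\<in>F. ennreal ((cmod (cinner x e))\<^sup>2)) + ennreal \<epsilon>"
      using \<open>\<epsilon> > 0\<close> by (simp add: ennreal_plus sum_nonneg sum_ennreal)
    also have "(\<Sum>e\<in>F. ennreal ((cmod (cinner x e))\<^sup>2)) \<le> (\<Sum>\<^sub>\<infinity>e\<in>E. ennreal ((cmod (cinner x e))\<^sup>2))"
      unfolding sup by (rule SUP_upper) (use F in auto)
    finally show "ennreal ((norm x)\<^sup>2) \<le> (\<Sum>\<^sub>\<infinity>e\<in>E. ennreal ((cmod (cinner x e))\<^sup>2)) + ennreal \<epsilon>"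
      by (simp add: add_right_mono)
  qed
qed

lemma infsum_expansion:
  assumes "is_orthonormal_basis E" "finite F" "orthonormal F (\<lambda>x. x)"
  shows "(\<Sum>\<^sub>\<infinity>e\<in>E. ennreal (\<Sum>f\<in>F. (cmod (cinner e f))\<^sup>2)) = ennreal (real (card F))"
  using assms(2,3)
proof (induction F rule: finite_induct)
  case (insert f F)
  have f: "norm f = 1"
    using orthonormal_norm[OF insert.prems, of f] by simp
  have "(\<Sum>\<^sub>\<infinity>e\<in>E. ennreal (\<Sum>f\<in>insert f F. (cmod (cinner e f))\<^sup>2)) =
      (\<Sum>\<^sub>\<infinity>e\<in>E. ennreal ((cmod (cinner e f))\<^sup>2) + ennreal (\<Sum>f\<in>F. (cmod (cinner e f))\<^sup>2))"
    using insert by (simp add: ennreal_plus sum_nonneg)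
  also have "\<dots> = (\<Sum>\<^sub>\<infinity>e\<in>E. ennreal ((cmod (cinner e f))\<^sup>2)) + (\<Sum>\<^sub>\<infinity>e\<in>E. ennreal (\<Sum>f\<in>F. (cmod (cinner e f))\<^sup>2))"
    by (rule infsum_add) (auto intro: nonneg_summable_on_complete)
  also have "(\<Sum>\<^sub>\<infinity>e\<in>E. ennreal ((cmod (cinner e f))\<^sup>2)) = (\<Sum>\<^sub>\<infinity>e\<in>E. ennreal ((cmod (cinner f e))\<^sup>2))"
    by (rule infsum_cong) (metis cinner_commute complex_mod_cnj)
  also have "\<dots> = 1"
    by (simp add: Parseval[OF assms(1)] f)
  also have "(\<Sum>\<^sub>\<infinity>e\<in>E. ennreal (\<Sum>f\<in>F. (cmod (cinner e f))\<^sup>2)) = ennreal (real (card F))"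
    using insert.IH orthonormal_subset[OF insert.prems, of F] by blast
  finally show ?case
    using insert by (simp add: ennreal_plus)
qed simp

text \<open>The projection onto the span of a finite orthonormal set.\<close>

definition finite_projection :: "'a::complex_inner set \<Rightarrow> ('a \<Rightarrow>\<^sub>L 'a)" where
  "finite_projection F = Blinfun (expansion F (\<lambda>x. x))"

lemma expansion_add: "expansion I v (x + y) = expansion I v x + expansion I v y"
  by (simp add: expansion_def cinner_add_left scaleC_add_left sum.distrib)

lemma expansion_scaleC: "expansion I v (c *\<^sub>C x) = c *\<^sub>C expansion I v x"
  by (simp add: expansion_def cinner_scaleC_left complex_vector.scale_sum_right scaleC_scaleC)

lemma cinner_expansion_left: "cinner (expansion I v x) y = (\<Sum>i\<in>I. cinner x (v i) * cinner (v i) y)"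
  by (simp add: expansion_def cinner_sum_left cinner_scaleC_left)

lemma cinner_expansion_right: "cinner x (expansion I v y) = (\<Sum>i\<in>I. cinner x (v i) * cinner (v i) y)"
  unfolding expansion_def cinner_sum_right cinner_scaleC_right
  by (rule sum.cong) (auto simp: mult.commute, metis cinner_commute)

lemma norm_expansion_le:
  assumes "finite I" "orthonormal I v"
  shows "norm (expansion I v x) \<le> norm x"
proof (rule power2_le_imp_le)
  have "(norm (expansion I v x))\<^sup>2 = (\<Sum>i\<in>I. (cmod (cinner x (v i)))\<^sup>2)"
    unfolding expansion_def
    by (subst norm_sum_orthogonal)
      (use assms orthonormal_norm[OF assms(2)] in \<open>auto simp: orthonormal_def\<close>)
  then show "(norm (expansion I v x))\<^sup>2 \<le> (norm x)\<^sup>2"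
    using Bessel_inequality[OF assms(1) orthonormal_imp_suborthonormal[OF assms(2)], of x] by simp
qed simp

lemma finite_projection:
  assumes "finite F" "orthonormal F (\<lambda>x. x)"
  shows "blinfun_apply (finite_projection F) x = expansion F (\<lambda>x. x) x"
    and "finite_projection F \<in> bounded_operators"
    and "is_projection (id_blinfun - finite_projection F)"
proof -
  show app: "blinfun_apply (finite_projection F) x = expansion F (\<lambda>x. x) x" for x
    unfolding finite_projection_def
    by (rule complex_linear_Blinfun[of _ 1])
      (simp_all add: expansion_add expansion_scaleC norm_expansion_le[OF assms])
  show mem: "finite_projection F \<in> bounded_operators"
    unfolding finite_projection_def
    by (rule complex_linear_Blinfun[of _ 1])
      (simp_all add: expansion_add expansion_scaleC norm_expansion_le[OF assms])
  have idem: "expansion F (\<lambda>x. x) (expansion F (\<lambda>x. x) x) = expansion F (\<lambda>x. x) x" for x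
    by (rule expansion_eq_self[OF assms expansion_in_span])
  show "is_projection (id_blinfun - finite_projection F)"
    unfolding is_projection_def
  proof (intro conjI allI)
    show "id_blinfun - finite_projection F \<in> bounded_operators"
      using mem by (simp add: bounded_operators_def blinfun.diff_left complex_vector.scale_right_diff_distrib)
    show "(id_blinfun - finite_projection F) o\<^sub>L (id_blinfun - finite_projection F) =
        id_blinfun - finite_projection F"
      by (rule blinfun_eqI)
        (simp add: blinfun.diff_left blinfun.diff_right app idem)
    show "cinner (blinfun_apply (id_blinfun - finite_projection F) x) y =
        cinner x (blinfun_apply (id_blinfun - finite_projection F) y)" for x y
      by (simp add: blinfun.diff_left app cinner_diff_left cinner_diff_right
          cinner_expansion_left cinner_expansion_right)
  qed
qed

lemma op_trace_finite_projection:
  assumes "separable_space (euclidean :: 'a::complex_hilbert topology)"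
    and "finite F" "orthonormal F (\<lambda>x :: 'a. x)"
  shows "op_trace (finite_projection F) = ennreal (real (card F))"
proof -
  define E :: "'a set" where "E = (SOME E. is_orthonormal_basis E)"
  have E: "is_orthonormal_basis E"
    unfolding E_def using separable_imp_orthonormal_basis[OF assms(1)] by (rule someI_ex)
  have "op_trace (finite_projection F) = (\<Sum>\<^sub>\<infinity>e\<in>E. ennreal (\<Sum>f\<in>F. (cmod (cinner e f))\<^sup>2))"
    unfolding op_trace_def E_def[symmetric]
    by (rule infsum_cong)
      (simp add: finite_projection(1)[OF assms(2,3)] Re_cinner_commute[of "expansion _ _ _"] cinner_expansion)
  then show ?thesis
    by (simp add: infsum_expansion[OF E assms(2,3)])
qed

text \<open>The trace of a projection bounds the size of the orthonormal sets in its range.\<close>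

lemma op_trace_projection_ge:
  assumes "separable_space (euclidean :: 'a::complex_hilbert topology)"
    and "is_projection q" "finite F" "orthonormal F (\<lambda>x :: 'a. x)"
    and "\<And>f. f \<in> F \<Longrightarrow> blinfun_apply q f = f"
  shows "ennreal (real (card F)) \<le> op_trace q"
proof -
  define E :: "'a set" where "E = (SOME E. is_orthonormal_basis E)"
  have E: "is_orthonormal_basis E"
    unfolding E_def using separable_imp_orthonormal_basis[OF assms(1)] by (rule someI_ex)
  have "ennreal (\<Sum>f\<in>F. (cmod (cinner e f))\<^sup>2) \<le> ennreal (Re (cinner (blinfun_apply q e) e))" for e
  proof (rule ennreal_leI)
    have "(\<Sum>f\<in>F. (cmod (cinner e f))\<^sup>2) = (\<Sum>f\<in>F. (cmod (cinner (blinfun_apply q e) f))\<^sup>2)"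
      using assms(2,5) by (intro sum.cong) (auto simp: is_projection_def)
    also have "\<dots> \<le> (norm (blinfun_apply q e))\<^sup>2"
      by (rule Bessel_inequality[OF assms(3) orthonormal_imp_suborthonormal[OF assms(4)]])
    also have "\<dots> = Re (cinner (blinfun_apply (q o\<^sub>L q) e) e)"
    proof -
      have "cinner (blinfun_apply q (blinfun_apply q e)) e = cinner (blinfun_apply q e) (blinfun_apply q e)"
        using assms(2) unfolding is_projection_def by blast
      then show ?thesis
        by (simp add: Re_cinner_self)
    qed
    also have "q o\<^sub>L q = q"
      using assms(2) by (simp add: is_projection_def)
    finally show "(\<Sum>f\<in>F. (cmod (cinner e f))\<^sup>2) \<le> Re (cinner (blinfun_apply q e) e)" .
  qed
  then have "(\<Sum>\<^sub>\<infinity>e\<in>E. ennreal (\<Sum>f\<in>F. (cmod (cinner e f))\<^sup>2)) \<le> op_trace q"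
    unfolding op_trace_def E_def[symmetric]
    by (intro infsum_mono) (auto intro: nonneg_summable_on_complete)
  then show ?thesis
    by (simp add: infsum_expansion[OF E assms(3,4)])
qed


section \<open>Singular values as Gelfand numbers\<close>

text \<open>\<open>gelfand_bound n T c\<close> says that \<open>T\<close> is bounded by \<open>c\<close> on the orthogonal complement of at most
  \<open>n\<close> vectors, and the Gelfand number is the infimum of these bounds. In contrast with the definition
  of \<^const>\<open>singular_value\<close> there is no trace and no projection, which makes the usual inequalities
  immediate.\<close>

definition gelfand_bound :: "nat \<Rightarrow> ('a::complex_inner \<Rightarrow>\<^sub>L 'a) \<Rightarrow> real \<Rightarrow> bool" where
  "gelfand_bound n T c \<longleftrightarrow> 0 \<le> c \<and>
     (\<exists>V. finite V \<and> card V \<le> n \<and>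
       (\<forall>x. (\<forall>v\<in>V. cinner x v = 0) \<longrightarrow> norm (blinfun_apply T x) \<le> c * norm x))"

definition gelfand_number :: "nat \<Rightarrow> ('a::complex_inner \<Rightarrow>\<^sub>L 'a) \<Rightarrow> real" where
  "gelfand_number n T = Inf {c. gelfand_bound n T c}"

lemma gelfand_bound_norm: "gelfand_bound n T (norm T)"
  unfolding gelfand_bound_def by (auto intro!: exI[of _ "{}"] norm_blinfun)

lemma bdd_below_gelfand_bound: "bdd_below {c. gelfand_bound n T c}"
  by (rule bdd_belowI[of _ 0]) (auto simp: gelfand_bound_def)

lemma gelfand_number_le: "gelfand_bound n T c \<Longrightarrow> gelfand_number n T \<le> c"
  unfolding gelfand_number_def by (rule cInf_lower[OF _ bdd_below_gelfand_bound]) simp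

lemma gelfand_number_ge: "(\<And>c. gelfand_bound n T c \<Longrightarrow> b \<le> c) \<Longrightarrow> b \<le> gelfand_number n T"
  unfolding gelfand_number_def
  by (rule cInf_greatest) (use gelfand_bound_norm in auto)

lemma gelfand_number_nonneg: "0 \<le> gelfand_number n T"
  by (rule gelfand_number_ge) (simp add: gelfand_bound_def)

lemma gelfand_bound_mono: "gelfand_bound m T c \<Longrightarrow> m \<le> n \<Longrightarrow> gelfand_bound n T c"
  by (auto simp: gelfand_bound_def intro: order_trans)

lemma gelfand_number_antimono: "m \<le> n \<Longrightarrow> gelfand_number n T \<le> gelfand_number m T"
  by (rule gelfand_number_ge, rule gelfand_number_le) (rule gelfand_bound_mono)

lemma gelfand_bound_approx:
  assumes "gelfand_number n T < d"
  shows "\<exists>c<d. gelfand_bound n T c"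
proof (rule ccontr)
  assume "\<nexists>c. c < d \<and> gelfand_bound n T c"
  then have "d \<le> gelfand_number n T"
    by (intro gelfand_number_ge) (auto simp: not_less)
  with assms show False by simp
qed

lemma gelfand_number_add:
  "gelfand_number (m + n) (S + T) \<le> gelfand_number m S + gelfand_number n T"
proof (rule field_le_epsilon)
  fix \<epsilon> :: real assume "\<epsilon> > 0"
  then obtain c d where c: "c < gelfand_number m S + \<epsilon> / 2" "gelfand_bound m S c"
    and d: "d < gelfand_number n T + \<epsilon> / 2" "gelfand_bound n T d"
    using gelfand_bound_approx[of m S "gelfand_number m S + \<epsilon> / 2"]
      gelfand_bound_approx[of n T "gelfand_number n T + \<epsilon> / 2"] by auto
  have "gelfand_bound (m + n) (S + T) (c + d)"
  proof -
    obtain V W where V: "finite V" "card V \<le> m"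
        "\<And>x. (\<forall>v\<in>V. cinner x v = 0) \<Longrightarrow> norm (blinfun_apply S x) \<le> c * norm x"
      and W: "finite W" "card W \<le> n"
        "\<And>x. (\<forall>v\<in>W. cinner x v = 0) \<Longrightarrow> norm (blinfun_apply T x) \<le> d * norm x"
      using c(2) d(2) unfolding gelfand_bound_def by metis
    have "card (V \<union> W) \<le> m + n"
      using V(2) W(2) card_Un_le[of V W] by simp
    moreover have "norm (blinfun_apply (S + T) x) \<le> (c + d) * norm x" if "\<forall>v\<in>V \<union> W. cinner x v = 0" for x
      using norm_triangle_ineq[of "blinfun_apply S x" "blinfun_apply T x"] V(3)[of x] W(3)[of x] that
      by (simp add: blinfun.add_left distrib_right)
    ultimately show ?thesis
      using V(1) W(1) c(2) d(2) unfolding gelfand_bound_def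
      by (auto intro!: exI[of _ "V \<union> W"])
  qed
  then show "gelfand_number (m + n) (S + T) \<le> gelfand_number m S + gelfand_number n T + \<epsilon>"
    using gelfand_number_le[of "m + n" "S + T" "c + d"] c(1) d(1) by simp
qed

lemma gelfand_number_scaleC_le:
  "gelfand_number n (op_scaleC a T) \<le> cmod a * gelfand_number n T"
proof (cases "a = 0")
  case True
  then have "gelfand_bound n (op_scaleC a T) 0"
    by (auto simp: gelfand_bound_def op_scaleC_apply intro: exI[of _ "{}"])
  then show ?thesis
    using gelfand_number_le True by fastforce
next
  case False
  have "gelfand_number n (op_scaleC a T) / cmod a \<le> gelfand_number n T"
  proof (rule gelfand_number_ge)
    fix c assume "gelfand_bound n T c"
    then have "gelfand_bound n (op_scaleC a T) (cmod a * c)"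
      unfolding gelfand_bound_def op_scaleC_apply norm_scaleC
      by (auto simp: mult.assoc intro!: mult_left_mono)
    then show "gelfand_number n (op_scaleC a T) / cmod a \<le> c"
      using gelfand_number_le False by (simp add: divide_le_eq mult.commute)
  qed
  then show ?thesis
    using False by (simp add: divide_le_eq mult.commute)
qed

lemma op_scaleC_op_scaleC: "op_scaleC a (op_scaleC b T) = op_scaleC (a * b) T"
  by (rule blinfun_eqI) (simp add: op_scaleC_apply scaleC_scaleC)

lemma op_scaleC_one: "op_scaleC 1 T = T"
  by (rule blinfun_eqI) (simp add: op_scaleC_apply)

lemma gelfand_number_scaleC:
  "gelfand_number n (op_scaleC a T) = cmod a * gelfand_number n T"
proof (cases "a = 0")
  case True
  then show ?thesis
    using gelfand_number_scaleC_le[of n a T] gelfand_number_nonneg[of n "op_scaleC a T"] by simp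
next
  case False
  then have "gelfand_number n T \<le> cmod (inverse a) * gelfand_number n (op_scaleC a T)"
    using gelfand_number_scaleC_le[of n "inverse a" "op_scaleC a T"]
    by (simp add: op_scaleC_op_scaleC op_scaleC_one)
  then have "cmod a * gelfand_number n T \<le> gelfand_number n (op_scaleC a T)"
    using False by (simp add: norm_divide field_simps)
  then show ?thesis
    using gelfand_number_scaleC_le[of n a T] by simp
qed

text \<open>A projection of finite trace has finite rank, and the rank is at most the trace.\<close>

lemma gelfand_bound_of_projection:
  assumes "separable_space (euclidean :: 'a::complex_hilbert topology)"
    and "is_projection p" "op_trace (id_blinfun - p) \<le> ennreal t" "0 \<le> t"
  shows "gelfand_bound (nat \<lfloor>t\<rfloor>) (T :: 'a \<Rightarrow>\<^sub>L 'a) (norm (T o\<^sub>L p))"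
proof -
  define q where "q = id_blinfun - p"
  have p: "p \<in> bounded_operators" "blinfun_apply p (blinfun_apply p x) = blinfun_apply p x"
    "cinner (blinfun_apply p x) y = cinner x (blinfun_apply p y)" for x y
    using assms(2) by (auto simp: is_projection_def dest: arg_cong[of _ _ "\<lambda>q. blinfun_apply q x"])
  have q_apply: "blinfun_apply q x = x - blinfun_apply p x" for x
    by (simp add: q_def blinfun.diff_left)
  have qq: "blinfun_apply q (blinfun_apply q x) = blinfun_apply q x" for x
    by (simp add: q_apply blinfun.diff_right p)
  have q: "is_projection q"
    unfolding is_projection_def
  proof (intro conjI allI)
    show "q \<in> bounded_operators"
      using p(1) by (simp add: bounded_operators_def q_apply complex_vector.scale_right_diff_distrib)
    show "q o\<^sub>L q = q"
      by (rule blinfun_eqI) (simp add: qq)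
    show "cinner (blinfun_apply q x) y = cinner x (blinfun_apply q y)" for x y
      by (simp add: q_apply cinner_diff_left cinner_diff_right p)
  qed
  \<comment> \<open>An orthonormal set of maximal size in the range of \<open>q\<close> spans this range.\<close>
  define P where "P F \<longleftrightarrow> finite F \<and> orthonormal F (\<lambda>x. x) \<and> (\<forall>f\<in>F. blinfun_apply q f = f)" for F
  have card: "card F \<le> nat \<lfloor>t\<rfloor>" if "P F" for F
  proof -
    have "ennreal (real (card F)) \<le> ennreal t"
      using op_trace_projection_ge[OF assms(1) q, of F] that assms(3)
      by (auto simp: P_def q_def intro: order_trans)
    then show ?thesis
      using assms(4) by (simp add: le_nat_floor)
  qed
  have "P {}"
    by (simp add: P_def orthonormal_def)
  then obtain F where F: "P F" "\<And>G. P G \<Longrightarrow> card G \<le> card F"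
    using card ex_has_greatest_nat[of P "{}" card "Suc (nat \<lfloor>t\<rfloor>)"] by (metis le_imp_less_Suc)
  have q0: "blinfun_apply q x = 0" if x: "\<forall>f\<in>F. cinner x f = 0" for x
  proof (rule ccontr)
    assume nz: "blinfun_apply q x \<noteq> 0"
    define y where "y = normalize_vector (blinfun_apply q x)"
    have y: "norm y = 1"
      using nz by (simp add: y_def norm_normalize_vector)
    have orth: "cinner y f = 0" if "f \<in> F" for f
      unfolding y_def using F(1) q x that
      by (intro cinner_normalize_vector_eq_0) (auto simp: is_projection_def P_def)
    then have "y \<notin> F"
      using y by (metis cinner_self_eq_0 norm_zero zero_neq_one)
    have "blinfun_apply q y = y"
      using q by (simp add: y_def normalize_vector_def is_projection_def bounded_operators_def qq)
    then have "P (insert y F)"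
      using F(1) orthonormal_insert[of F y] y orth by (auto simp: P_def)
    then have "card (insert y F) \<le> card F"
      by (rule F(2))
    with \<open>y \<notin> F\<close> F(1) show False
      by (simp add: P_def)
  qed
  have "norm (blinfun_apply T x) \<le> norm (T o\<^sub>L p) * norm x" if "\<forall>f\<in>F. cinner x f = 0" for x
  proof -
    have "blinfun_apply p x = x"
      using q0[OF that] by (simp add: q_apply)
    then show ?thesis
      using norm_blinfun[of "T o\<^sub>L p" x] by simp
  qed
  then show ?thesis
    unfolding gelfand_bound_def using F(1) card[OF F(1)] by (auto simp: P_def)
qed

lemma projection_of_gelfand_bound:
  assumes "separable_space (euclidean :: 'a::complex_hilbert topology)"
    and "gelfand_bound (nat \<lfloor>t\<rfloor>) (T :: 'a \<Rightarrow>\<^sub>L 'a) c" "0 \<le> t"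
  shows "\<exists>p. is_projection p \<and> op_trace (id_blinfun - p) \<le> ennreal t \<and> norm (T o\<^sub>L p) \<le> c"
proof -
  from assms(2) obtain V where V: "0 \<le> c" "finite V" "card V \<le> nat \<lfloor>t\<rfloor>"
    "\<And>x. (\<forall>v\<in>V. cinner x v = 0) \<Longrightarrow> norm (blinfun_apply T x) \<le> c * norm x"
    unfolding gelfand_bound_def by blast
  obtain F where F: "finite F" "card F \<le> card V" "orthonormal F (\<lambda>x. x)" "V \<subseteq> complex_vector.span F"
    using finite_orthonormalization[OF V(2)] by blast
  define p where "p = id_blinfun - finite_projection F"
  have "real (card F) \<le> t"
    using F(2) V(3) assms(3) by linarith
  then have "op_trace (id_blinfun - p) \<le> ennreal t"
    by (simp add: p_def op_trace_finite_projection[OF assms(1) F(1,3)] ennreal_leI)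
  moreover have "norm (T o\<^sub>L p) \<le> c"
  proof (rule norm_blinfun_bound[OF V(1)])
    fix x
    have px: "blinfun_apply p x = x - expansion F (\<lambda>x. x) x"
      by (simp add: p_def blinfun.diff_left finite_projection(1)[OF F(1,3)])
    have "cinner (blinfun_apply p x) v = 0" if "v \<in> V" for v
      by (rule orthogonal_span[of F])
        (use that F(4) orthogonal_diff_expansion[OF F(1,3)] in \<open>auto simp: px\<close>)
    then have "norm (blinfun_apply T (blinfun_apply p x)) \<le> c * norm (blinfun_apply p x)"
      by (intro V(4)) auto
    also have "\<dots> \<le> c * norm x"
      using V(1) norm_diff_expansion_le[OF F(1,3)] by (simp add: px mult_left_mono)
    finally show "norm (blinfun_apply (T o\<^sub>L p) x) \<le> c * norm x"
      by simp
  qed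
  ultimately show ?thesis
    using finite_projection(3)[OF F(1,3)] by (auto simp: p_def)
qed

theorem singular_value_eq_gelfand_number:
  assumes "separable_space (euclidean :: 'a::complex_hilbert topology)" "0 \<le> t"
  shows "singular_value t (T :: 'a \<Rightarrow>\<^sub>L 'a) = gelfand_number (nat \<lfloor>t\<rfloor>) T"
proof -
  let ?A = "{norm (T o\<^sub>L p) | p. is_projection p \<and> op_trace (id_blinfun - p) \<le> ennreal t}"
  let ?B = "{c. gelfand_bound (nat \<lfloor>t\<rfloor>) T c}"
  have sub: "?A \<subseteq> ?B"
    using gelfand_bound_of_projection[OF assms(1) _ _ assms(2)] by auto
  have ex: "\<exists>a\<in>?A. a \<le> c" if "c \<in> ?B" for c
    using projection_of_gelfand_bound[OF assms(1) _ assms(2), of T c] that by auto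
  have "norm T \<in> ?B"
    by (simp add: gelfand_bound_norm)
  then have ne: "?B \<noteq> {}" "?A \<noteq> {}"
    using ex by auto
  have "bdd_below ?A"
    using bdd_below_gelfand_bound sub by (rule bdd_below_mono)
  then have "Inf ?A \<le> Inf ?B"
    using ne ex by (intro cInf_mono) auto
  moreover have "Inf ?B \<le> Inf ?A"
    by (rule cInf_superset_mono[OF ne(2) bdd_below_gelfand_bound sub])
  ultimately show ?thesis
    by (simp add: singular_value_def gelfand_number_def)
qed

section \<open>The Schmidt decomposition of a compact operator\<close>

lemma bounded_operators_scaleC:
  "T \<in> bounded_operators \<Longrightarrow> blinfun_apply T (c *\<^sub>C x) = c *\<^sub>C blinfun_apply T x"
  by (simp add: bounded_operators_def)

lemma exists_unit_orthogonal_finite: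
  assumes "infinite_dimensional TYPE('a::complex_inner)" "finite (V :: 'a set)"
  shows "\<exists>u. norm u = 1 \<and> (\<forall>v\<in>V. cinner u v = 0)"
proof -
  obtain F where F: "finite F" "orthonormal F (\<lambda>x. x)" "V \<subseteq> complex_vector.span F"
    using finite_orthonormalization[OF assms(2)] by blast
  obtain x where x: "x \<notin> complex_vector.span F"
    using assms(1) F(1) unfolding infinite_dimensional_def by blast
  define r where "r = x - expansion F (\<lambda>v. v) x"
  have "r \<noteq> 0"
    using x expansion_in_span[of F "\<lambda>v. v" x] by (auto simp: r_def)
  moreover have "cinner r v = 0" if "v \<in> V" for v
    by (rule orthogonal_span[of F]) (use orthogonal_diff_expansion[OF F(1,2)] that F(3) in \<open>auto simp: r_def\<close>)
  ultimately show ?thesis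
    by (intro exI[of _ "normalize_vector r"])
      (simp add: norm_normalize_vector cinner_normalize_vector_eq_0)
qed

lemma convergent_subsequence_finite:
  fixes f :: "'i \<Rightarrow> nat \<Rightarrow> complex"
  assumes "finite I" "\<And>i. i \<in> I \<Longrightarrow> bounded (range (f i))"
  shows "\<exists>r :: nat \<Rightarrow> nat. strict_mono r \<and> (\<forall>i\<in>I. convergent (f i \<circ> r))"
  using assms
proof (induction I rule: finite_induct)
  case empty
  show ?case by (rule exI[of _ id]) (simp add: strict_mono_def)
next
  case (insert i I)
  then obtain r :: "nat \<Rightarrow> nat" where r: "strict_mono r" "\<forall>i\<in>I. convergent (f i \<circ> r)"
    by (metis insertCI)
  have "range (f i \<circ> r) \<subseteq> range (f i)" by auto
  then have "bounded (range (f i \<circ> r))"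
    using insert.prems[of i] bounded_subset by blast
  then obtain l r' where r': "strict_mono r'" "((f i \<circ> r) \<circ> r') \<longlonglongrightarrow> l"
    using bounded_imp_convergent_subsequence by blast
  have "convergent (f j \<circ> (r \<circ> r'))" if "j \<in> I" for j
    using r(2) r'(1) that convergent_subseq_convergent[of "f j \<circ> r" r'] by (simp add: o_assoc)
  moreover have "convergent (f i \<circ> (r \<circ> r'))"
    using r'(2) by (auto simp: convergent_def o_assoc)
  ultimately show ?case
    using r(1) r'(1) strict_mono_o by blast
qed

text \<open>An operator whose Gelfand numbers tend to zero attains its norm on the orthogonal complement
  \<open>W\<close> of \<open>V\<close>, provided that \<open>W\<close> is not zero. Let \<open>s\<close> be the norm on \<open>W\<close>; only
  \<open>s > 0\<close> is of interest. Up to a finite-dimensional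
  part \<open>T \<circ> P\<close>, the operator is bounded by some \<open>c < s\<close>. Comparing the parallelogram laws for \<open>u\<close>
  and \<open>T u\<close> shows that a maximizing sequence \<open>u\<close> is Cauchy as soon as its images under \<open>P\<close> are, and
  this holds along a subsequence.\<close>

lemma norm_attained:
  fixes T :: "'a::complex_hilbert \<Rightarrow>\<^sub>L 'a" and V :: "'a set"
  assumes T: "T \<in> bounded_operators" and lim: "(\<lambda>n. gelfand_number n T) \<longlonglongrightarrow> 0"
    and ne: "\<exists>u. norm u = 1 \<and> (\<forall>v\<in>V. cinner u v = 0)"
  shows "\<exists>u. norm u = 1 \<and> (\<forall>v\<in>V. cinner u v = 0) \<and>
    (\<forall>x. (\<forall>v\<in>V. cinner x v = 0) \<longrightarrow> norm (blinfun_apply T x) \<le> norm (blinfun_apply T u) * norm x)"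
proof -
  define W where "W = {x. \<forall>v\<in>V. cinner x v = 0}"
  define A where "A = {norm (blinfun_apply T u) | u. norm u = 1 \<and> u \<in> W}"
  have bdd: "bdd_above A"
  proof (rule bdd_aboveI[of _ "norm T"])
    show "a \<le> norm T" if "a \<in> A" for a
      using that norm_blinfun[of T] by (auto simp: A_def) (metis mult.right_neutral)
  qed
  have Ane: "A \<noteq> {}"
    using ne by (auto simp: A_def W_def)
  define s where "s = Sup A"
  have sA: "norm (blinfun_apply T u) \<le> s" if "norm u = 1" "u \<in> W" for u
    unfolding s_def by (rule cSup_upper[OF _ bdd]) (use that in \<open>auto simp: A_def\<close>)
  have sW: "norm (blinfun_apply T x) \<le> s * norm x" if "x \<in> W" for x
  proof (cases "x = 0")
    case False
    have "norm (blinfun_apply T (normalize_vector x)) \<le> s"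
      by (rule sA) (use that False in \<open>auto simp: W_def norm_normalize_vector cinner_normalize_vector_eq_0\<close>)
    then show ?thesis
      using False by (simp add: normalize_vector_def bounded_operators_scaleC[OF T] norm_scaleC
          norm_divide field_simps)
  qed simp
  have s0: "0 \<le> s"
    using ne sA norm_ge_zero unfolding W_def by (smt (verit) mem_Collect_eq)
  have "\<exists>u. norm u = 1 \<and> u \<in> W \<and> s \<le> norm (blinfun_apply T u)"
  proof (cases "s = 0")
    case True
    then show ?thesis using ne by (auto simp: W_def)
  next
    case False
    with s0 have "0 < s" by simp
    from order_tendstoD(2)[OF lim this] obtain N where "gelfand_number N T < s"
      by (auto simp: eventually_sequentially)
    then obtain c where c: "c < s" "gelfand_bound N T c"
      using gelfand_bound_approx by blast
    then obtain V' where V': "0 \<le> c" "finite V'"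
      "\<And>x. (\<forall>v\<in>V'. cinner x v = 0) \<Longrightarrow> norm (blinfun_apply T x) \<le> c * norm x"
      unfolding gelfand_bound_def by blast
    obtain F where F: "finite F" "orthonormal F (\<lambda>x. x)" "V' \<subseteq> complex_vector.span F"
      using finite_orthonormalization[OF V'(2)] by blast
    define P where "P = expansion F (\<lambda>x. x)"
    have TP: "norm (blinfun_apply T (x - P x)) \<le> c * norm x" for x
    proof -
      have "cinner (x - P x) v = 0" if "v \<in> V'" for v
        by (rule orthogonal_span[of F])
          (use orthogonal_diff_expansion[OF F(1,2)] that F(3) in \<open>auto simp: P_def\<close>)
      then have "norm (blinfun_apply T (x - P x)) \<le> c * norm (x - P x)"
        using V'(3) by blast
      also have "\<dots> \<le> c * norm x"
        using V'(1) norm_diff_expansion_le[OF F(1,2)] by (simp add: P_def mult_left_mono)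
      finally show ?thesis .
    qed
    have "\<forall>n. \<exists>u. norm u = 1 \<and> u \<in> W \<and> s - 1 / Suc n < norm (blinfun_apply T u)"
    proof
      fix n
      have "s - 1 / Suc n < Sup A" by (simp add: s_def)
      then show "\<exists>u. norm u = 1 \<and> u \<in> W \<and> s - 1 / Suc n < norm (blinfun_apply T u)"
        using less_cSup_iff[OF Ane bdd] by (auto simp: A_def)
    qed
    then obtain u where u: "\<And>n. norm (u n) = 1" "\<And>n. u n \<in> W"
      "\<And>n. s - 1 / Suc n < norm (blinfun_apply T (u n))" by metis
    have "bounded (range (\<lambda>n. cinner (u n) f))" for f
    proof (rule boundedI)
      fix z assume "z \<in> range (\<lambda>n. cinner (u n) f)"
      then show "norm z \<le> norm f"
        using cinner_Cauchy_Schwarz u(1) by (metis (no_types, lifting) imageE mult_1)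
    qed
    then obtain r :: "nat \<Rightarrow> nat" where
      r: "strict_mono r" "\<forall>f\<in>F. convergent ((\<lambda>n. cinner (u n) f) \<circ> r)"
      using convergent_subsequence_finite[OF F(1), of "\<lambda>f n. cinner (u n) f"] by blast
    define y where "y n = u (r n)" for n
    have y: "norm (y n) = 1" "y n \<in> W" for n
      using u by (auto simp: y_def)
    have "(\<lambda>n. s - 1 / Suc n) \<longlonglongrightarrow> s - 0"
      by (intro tendsto_diff tendsto_const LIMSEQ_Suc[OF lim_1_over_n])
    then have lower: "(\<lambda>n. s - 1 / Suc n) \<longlonglongrightarrow> s" by simp
    have "(\<lambda>n. norm (blinfun_apply T (u n))) \<longlonglongrightarrow> s"
    proof (rule tendsto_sandwich[OF _ _ lower tendsto_const])
      show "\<forall>\<^sub>F n in sequentially. s - 1 / Suc n \<le> norm (blinfun_apply T (u n))"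
        using u(3) by (intro always_eventually allI less_imp_le)
      show "\<forall>\<^sub>F n in sequentially. norm (blinfun_apply T (u n)) \<le> s"
        using u(1,2) by (intro always_eventually allI sA)
    qed
    from LIMSEQ_subseq_LIMSEQ[OF this r(1)] have Ty: "(\<lambda>n. norm (blinfun_apply T (y n))) \<longlonglongrightarrow> s"
      by (simp add: y_def o_def)
    from r(2) obtain l where l: "\<And>f. f \<in> F \<Longrightarrow> (\<lambda>n. cinner (y n) f) \<longlonglongrightarrow> l f"
      unfolding convergent_def o_def y_def by metis
    define z where "z = (\<Sum>f\<in>F. l f *\<^sub>C f)"
    have Py: "(\<lambda>n. P (y n)) \<longlonglongrightarrow> z"
      unfolding P_def expansion_def z_def
    proof (rule tendsto_sum)
      fix f assume f: "f \<in> F"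
      have "norm (cinner (y n) f *\<^sub>C f - l f *\<^sub>C f) = cmod (cinner (y n) f - l f) * norm f" for n
        by (simp add: norm_scaleC flip: complex_vector.scale_left_diff_distrib)
      moreover have "(\<lambda>n. cmod (cinner (y n) f - l f) * norm f) \<longlonglongrightarrow> 0"
        using l[OF f] by (intro tendsto_mult_left_zero) (simp add: LIM_zero tendsto_norm_zero)
      ultimately show "(\<lambda>n. cinner (y n) f *\<^sub>C f) \<longlonglongrightarrow> l f *\<^sub>C f"
        by (subst LIM_zero_iff[symmetric], subst tendsto_norm_zero_iff[symmetric]) simp
    qed
    define K where "K = (2 * norm T + 4 * c) * norm T"
    define q where "q n = 2 * (s\<^sup>2 - (norm (blinfun_apply T (y n)))\<^sup>2) + K * norm (P (y n) - z)" for n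
    have "q \<longlonglongrightarrow> 2 * (s\<^sup>2 - s\<^sup>2) + K * 0"
      unfolding q_def using Py
      by (intro tendsto_intros Ty) (simp add: LIM_zero tendsto_norm_zero)
    then have q: "q \<longlonglongrightarrow> 0" by simp
    have K0: "0 \<le> K" using V'(1) by (simp add: K_def)
    have key: "(s\<^sup>2 - c\<^sup>2) * (norm (y m - y n))\<^sup>2 \<le> q m + q n" for m n
    proof -
      define d where "d = norm (y m - y n)"
      define \<eta> where "\<eta> = norm T * norm (P (y m) - P (y n))"
      have d2: "d \<le> 2"
        unfolding d_def using norm_triangle_ineq4[of "y m" "y n"] by (simp add: y)
      have \<eta>0: "0 \<le> \<eta>" by (simp add: \<eta>_def)
      have "norm (P (y m) - P (y n)) \<le> norm (P (y m)) + norm (P (y n))"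
        by (rule norm_triangle_ineq4)
      also have "\<dots> \<le> 2"
        using norm_expansion_le[OF F(1,2), of "y m"] norm_expansion_le[OF F(1,2), of "y n"]
        by (simp add: P_def y)
      finally have \<eta>2: "\<eta> \<le> 2 * norm T"
        unfolding \<eta>_def by (subst mult.commute[of 2]) (rule mult_left_mono, simp_all)
      have "norm (P (y m) - P (y n)) \<le> norm (P (y m) - z) + norm (P (y n) - z)"
        using norm_triangle_ineq4[of "P (y m) - z" "P (y n) - z"] by simp
      then have \<eta>3: "\<eta> \<le> norm T * (norm (P (y m) - z) + norm (P (y n) - z))"
        unfolding \<eta>_def by (intro mult_left_mono) auto
      have Pdiff: "P (y m) - P (y n) = P (y m - y n)"
        by (simp add: P_def expansion_def cinner_diff_left complex_vector.scale_left_diff_distrib sum_subtractf)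
      have "blinfun_apply T (y m - y n) = blinfun_apply T ((y m - y n) - P (y m - y n)) + blinfun_apply T (P (y m - y n))"
        by (simp flip: blinfun.add_right)
      then have "norm (blinfun_apply T (y m - y n)) \<le>
          norm (blinfun_apply T ((y m - y n) - P (y m - y n))) + norm (blinfun_apply T (P (y m - y n)))"
        using norm_triangle_ineq by metis
      also have "\<dots> \<le> c * d + \<eta>"
        unfolding d_def \<eta>_def Pdiff by (intro add_mono TP norm_blinfun)
      finally have "(norm (blinfun_apply T (y m - y n)))\<^sup>2 \<le> (c * d + \<eta>)\<^sup>2"
        by (intro power_mono) auto
      moreover have "(c * d + \<eta>)\<^sup>2 \<le> c\<^sup>2 * d\<^sup>2 + (2 * norm T + 4 * c) * \<eta>"
      proof -
        have "c * d * \<eta> \<le> c * 2 * \<eta>"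
          using d2 V'(1) \<eta>0 by (intro mult_mono) (auto simp: d_def)
        moreover have "\<eta> * \<eta> \<le> 2 * norm T * \<eta>"
          using \<eta>2 \<eta>0 by (intro mult_right_mono) auto
        ultimately show ?thesis
          by (simp add: power2_eq_square algebra_simps)
      qed
      moreover have "(2 * norm T + 4 * c) * \<eta> \<le> K * norm (P (y m) - z) + K * norm (P (y n) - z)"
        using mult_left_mono[OF \<eta>3, of "2 * norm T + 4 * c"] V'(1) by (simp add: K_def algebra_simps)
      moreover have "(norm (blinfun_apply T (y m + y n)))\<^sup>2 \<le> s\<^sup>2 * (4 - d\<^sup>2)"
      proof -
        have "y m + y n \<in> W"
          using y(2) by (simp add: W_def cinner_add_left)
        then have "(norm (blinfun_apply T (y m + y n)))\<^sup>2 \<le> (s * norm (y m + y n))\<^sup>2"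
          by (intro power_mono sW) auto
        moreover have "(norm (y m + y n))\<^sup>2 = 4 - d\<^sup>2"
          using parallelogram_law[of "y m" "y n"] by (simp add: y d_def)
        ultimately show ?thesis
          by (simp add: power_mult_distrib)
      qed
      moreover have "(norm (blinfun_apply T (y m + y n)))\<^sup>2 + (norm (blinfun_apply T (y m - y n)))\<^sup>2 =
          2 * (norm (blinfun_apply T (y m)))\<^sup>2 + 2 * (norm (blinfun_apply T (y n)))\<^sup>2"
        unfolding blinfun.add_right blinfun.diff_right by (rule parallelogram_law)
      ultimately show ?thesis
        unfolding q_def d_def[symmetric] by (simp add: algebra_simps)
    qed
    have sc: "s\<^sup>2 - c\<^sup>2 > 0"
      using c(1) V'(1) by (simp add: power_strict_mono)
    have "Cauchy y"
    proof (rule CauchyI)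
      fix e :: real assume "e > 0"
      then have "0 < e\<^sup>2 * (s\<^sup>2 - c\<^sup>2) / 2" using sc by simp
      from order_tendstoD(2)[OF q this] obtain M where M: "\<And>n. n \<ge> M \<Longrightarrow> q n < e\<^sup>2 * (s\<^sup>2 - c\<^sup>2) / 2"
        by (auto simp: eventually_sequentially)
      have "norm (y m - y n) < e" if "m \<ge> M" "n \<ge> M" for m n
      proof -
        have "(s\<^sup>2 - c\<^sup>2) * (norm (y m - y n))\<^sup>2 < (s\<^sup>2 - c\<^sup>2) * e\<^sup>2"
          using key[of m n] M[OF that(1)] M[OF that(2)] by (simp add: algebra_simps)
        then have "(norm (y m - y n))\<^sup>2 < e\<^sup>2"
          using sc by (simp add: mult_less_cancel_left_pos)
        then show ?thesis
          using \<open>e > 0\<close> by (simp add: power2_less_imp_less)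
      qed
      then show "\<exists>M. \<forall>m\<ge>M. \<forall>n\<ge>M. norm (y m - y n) < e" by blast
    qed
    then obtain x where x: "y \<longlonglongrightarrow> x"
      using Cauchy_convergent_iff convergent_def by blast
    have "norm x = 1"
      using tendsto_norm[OF x] by (simp add: y LIMSEQ_const_iff)
    moreover have "x \<in> W"
      unfolding W_def
    proof safe
      fix v assume v: "v \<in> V"
      have "(\<lambda>n. cinner (y n) v) \<longlonglongrightarrow> cinner x v"
        by (intro tendsto_cinner x tendsto_const)
      moreover have "cinner (y n) v = 0" for n
        using y(2)[of n] v by (simp add: W_def)
      ultimately show "cinner x v = 0"
        by (simp add: LIMSEQ_const_iff)
    qed
    moreover have "norm (blinfun_apply T x) = s"
    proof (rule LIMSEQ_unique[OF _ Ty])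
      show "(\<lambda>n. norm (blinfun_apply T (y n))) \<longlonglongrightarrow> norm (blinfun_apply T x)"
        by (intro tendsto_norm blinfun.tendsto tendsto_const x)
    qed
    ultimately show ?thesis by auto
  qed
  then obtain u where u: "norm u = 1" "u \<in> W" "s \<le> norm (blinfun_apply T u)" by blast
  have "norm (blinfun_apply T x) \<le> norm (blinfun_apply T u) * norm x" if "x \<in> W" for x
    using sW[OF that] mult_right_mono[OF u(3), of "norm x"] by simp
  then show ?thesis
    using u(1,2) by (intro exI[of _ u]) (auto simp: W_def)
qed

text \<open>First-order condition at a maximizer \<open>u\<close>: the image of a direction \<open>h\<close> orthogonal to \<open>u\<close> is
  orthogonal to the image of \<open>u\<close>.\<close>

lemma norm_attained_orthogonal:
  assumes T: "T \<in> bounded_operators" and "norm u = 1" "cinner h u = 0"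
    and max: "\<And>z. norm (blinfun_apply T (u + z *\<^sub>C h)) \<le> norm (blinfun_apply T u) * norm (u + z *\<^sub>C h)"
  shows "cinner (blinfun_apply T h) (blinfun_apply T u) = 0"
proof (rule ccontr)
  let ?Tu = "blinfun_apply T u" and ?Th = "blinfun_apply T h"
  define \<alpha> where "\<alpha> = cinner ?Tu ?Th"
  define K where "K = (norm ?Tu)\<^sup>2 * (norm h)\<^sup>2"
  define r where "r = 1 / (K + 1)"
  assume "cinner ?Th ?Tu \<noteq> 0"
  then have "\<alpha> \<noteq> 0"
    using cinner_eq_0_commute by (auto simp: \<alpha>_def)
  have K: "K \<ge> 0" by (simp add: K_def)
  then have r: "r > 0" "r * K < 1" by (simp_all add: r_def)
  \<comment> \<open>The phase of \<open>\<alpha>\<close> makes the first-order term positive; \<open>r\<close> is so small that it dominates.\<close>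
  define z where "z = complex_of_real r * \<alpha>"
  have "(norm (blinfun_apply T (u + z *\<^sub>C h)))\<^sup>2 \<le> (norm ?Tu * norm (u + z *\<^sub>C h))\<^sup>2"
    by (intro power_mono max) simp
  also have "\<dots> = (norm ?Tu)\<^sup>2 * (1 + (norm (z *\<^sub>C h))\<^sup>2)"
  proof -
    have "cinner u (z *\<^sub>C h) = 0"
      using assms(3) cinner_eq_0_commute[of h u] by (simp add: cinner_scaleC_right)
    from norm_add_square_orthogonal[OF this] show ?thesis
      using assms(2) by (simp add: power_mult_distrib)
  qed
  also have "\<dots> = (norm ?Tu)\<^sup>2 + r\<^sup>2 * (cmod \<alpha>)\<^sup>2 * K"
    using r by (simp add: z_def norm_scaleC norm_mult power_mult_distrib K_def algebra_simps)
  finally have *: "(norm (blinfun_apply T (u + z *\<^sub>C h)))\<^sup>2 \<le> (norm ?Tu)\<^sup>2 + r\<^sup>2 * (cmod \<alpha>)\<^sup>2 * K" .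
  have "cinner ?Tu (z *\<^sub>C ?Th) = complex_of_real (r * (cmod \<alpha>)\<^sup>2)"
    by (simp add: cinner_scaleC_right z_def \<alpha>_def[symmetric] complex_norm_square mult_ac del: of_real_power)
  then have "(norm ?Tu)\<^sup>2 + 2 * (r * (cmod \<alpha>)\<^sup>2) \<le> (norm (blinfun_apply T (u + z *\<^sub>C h)))\<^sup>2"
    by (simp add: blinfun.add_right bounded_operators_scaleC[OF T] norm_add_square)
  with * have "2 * (r * (cmod \<alpha>)\<^sup>2) \<le> r\<^sup>2 * (cmod \<alpha>)\<^sup>2 * K"
    by linarith
  then have "r * (cmod \<alpha>)\<^sup>2 * 2 \<le> r * (cmod \<alpha>)\<^sup>2 * (r * K)"
    by (simp add: power2_eq_square algebra_simps)
  then have "2 \<le> r * K"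
    using r(1) \<open>\<alpha> \<noteq> 0\<close> by (simp add: mult_le_cancel_left_pos)
  with r(2) show False by simp
qed

text \<open>A lower bound for the Gelfand numbers: among \<open>n + 1\<close> orthonormal vectors with orthogonal images
  of norm at least \<open>s\<close>, some unit combination is orthogonal to any given \<open>n\<close> vectors.\<close>

lemma gelfand_number_ge_orthonormal:
  assumes T: "T \<in> bounded_operators" and g: "orthonormal {..n} g"
    and orth: "\<And>i j. i \<le> n \<Longrightarrow> j \<le> n \<Longrightarrow> i \<noteq> j \<Longrightarrow> cinner (blinfun_apply T (g i)) (blinfun_apply T (g j)) = 0"
    and s: "0 \<le> s" "\<And>i. i \<le> n \<Longrightarrow> s \<le> norm (blinfun_apply T (g i))"
  shows "s \<le> gelfand_number n T"
proof (rule gelfand_number_ge)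
  fix c assume "gelfand_bound n T c"
  then obtain V where V: "0 \<le> c" "finite V" "card V \<le> n"
    "\<And>x. (\<forall>v\<in>V. cinner x v = 0) \<Longrightarrow> norm (blinfun_apply T x) \<le> c * norm x"
    unfolding gelfand_bound_def by blast
  obtain a where a: "norm (\<Sum>i\<le>n. a i *\<^sub>C g i) = 1" "(\<Sum>i\<le>n. (cmod (a i))\<^sup>2) = 1"
    "\<forall>v\<in>V. cinner (\<Sum>i\<le>n. a i *\<^sub>C g i) v = 0"
    using exists_unit_orthogonal[OF V(2) _ _ g] V(3) by auto
  define x where "x = (\<Sum>i\<le>n. a i *\<^sub>C g i)"
  have "blinfun_apply T x = (\<Sum>i\<le>n. a i *\<^sub>C blinfun_apply T (g i))"
    by (simp add: x_def blinfun.sum_right bounded_operators_scaleC[OF T])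
  then have "(norm (blinfun_apply T x))\<^sup>2 = (\<Sum>i\<le>n. (cmod (a i))\<^sup>2 * (norm (blinfun_apply T (g i)))\<^sup>2)"
    by (simp only:) (rule norm_sum_orthogonal, auto intro: orth)
  also have "\<dots> \<ge> (\<Sum>i\<le>n. (cmod (a i))\<^sup>2 * s\<^sup>2)"
    by (intro sum_mono mult_left_mono power_mono s) auto
  also have "(\<Sum>i\<le>n. (cmod (a i))\<^sup>2 * s\<^sup>2) = s\<^sup>2"
    using a(2) by (simp flip: sum_distrib_right)
  finally have "s \<le> norm (blinfun_apply T x)"
    by (rule power2_le_imp_le) simp
  also have "\<dots> \<le> c"
    using V(4)[of x] a by (simp add: x_def)
  finally show "s \<le> c" .
qed

text \<open>The right singular vectors, chosen greedily: \<open>g k\<close> maximizes \<open>norm (T x)\<close> among the unit vectors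
  orthogonal to its predecessors.\<close>

theorem Schmidt_vectors:
  fixes T :: "'a::complex_hilbert \<Rightarrow>\<^sub>L 'a"
  assumes T: "T \<in> bounded_operators" and lim: "(\<lambda>n. gelfand_number n T) \<longlonglongrightarrow> 0"
    and inf: "infinite_dimensional TYPE('a)"
  obtains g :: "nat \<Rightarrow> 'a" where "orthonormal UNIV g"
    and "\<And>k. norm (blinfun_apply T (g k)) = gelfand_number k T"
    and "\<And>k x. (\<And>i. i < k \<Longrightarrow> cinner x (g i) = 0) \<Longrightarrow> norm (blinfun_apply T x) \<le> gelfand_number k T * norm x"
    and "\<And>k h. cinner h (g k) = 0 \<Longrightarrow> cinner (blinfun_apply T h) (blinfun_apply T (g k)) = 0"
proof -
  define P where "P f k u \<longleftrightarrow> norm u = 1 \<and> (\<forall>v\<in>f ` {..<k}. cinner u v = 0) \<and>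
    (\<forall>x. (\<forall>v\<in>f ` {..<k}. cinner x v = 0) \<longrightarrow> norm (blinfun_apply T x) \<le> norm (blinfun_apply T u) * norm x)"
    for f :: "nat \<Rightarrow> 'a" and k :: nat and u
  have "\<exists>g. \<forall>k. P g k (g k)"
  proof (rule dependent_wellorder_choice)
    fix r and f g :: "nat \<Rightarrow> 'a" and k :: nat
    assume "\<And>y. y < k \<Longrightarrow> f y = g y"
    then have "f ` {..<k} = g ` {..<k}" by auto
    then show "P f k r = P g k r" by (simp only: P_def)
  next
    fix f :: "nat \<Rightarrow> 'a" and k :: nat
    show "\<exists>r. P f k r"
      unfolding P_def
      by (rule norm_attained[OF T lim exists_unit_orthogonal_finite[OF inf]]) simp
  qed
  then obtain g where g: "\<And>k. P g k (g k)" by blast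
  have norm_g: "norm (g k) = 1" and orth_less: "i < k \<Longrightarrow> cinner (g k) (g i) = 0" for i k
    using g[of k] by (auto simp: P_def)
  have max: "norm (blinfun_apply T x) \<le> norm (blinfun_apply T (g k)) * norm x"
    if "\<And>i. i < k \<Longrightarrow> cinner x (g i) = 0" for x k
    using g[of k] that by (auto simp: P_def)
  have orth: "cinner (g i) (g j) = 0" if "i \<noteq> j" for i j
    using that orth_less[of i j] orth_less[of j i] cinner_eq_0_commute[of "g i" "g j"]
    by (metis nat_neq_iff)
  have on: "orthonormal UNIV g"
    by (auto simp: orthonormal_def orth cinner_norm norm_g)
  have W: "cinner (blinfun_apply T h) (blinfun_apply T (g k)) = 0"
    if "\<And>i. i < k \<Longrightarrow> cinner h (g i) = 0" "cinner h (g k) = 0" for h k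
    by (rule norm_attained_orthogonal[OF T norm_g that(2) max])
      (simp add: cinner_add_left cinner_scaleC_left orth_less that(1))
  have Torth: "cinner (blinfun_apply T (g i)) (blinfun_apply T (g j)) = 0" if "i \<noteq> j" for i j
  proof (cases "i < j")
    case True
    have "cinner (blinfun_apply T (g j)) (blinfun_apply T (g i)) = 0"
      by (rule W) (use True orth in auto)
    then show ?thesis using cinner_eq_0_commute by blast
  next
    case False
    with that show ?thesis
      by (intro W) (use orth in auto)
  qed
  have dec: "norm (blinfun_apply T (g k)) \<le> norm (blinfun_apply T (g i))" if "i \<le> k" for i k
    using max[of i "g k"] orth_less[of _ k] that norm_g[of k] by simp
  have eq: "norm (blinfun_apply T (g k)) = gelfand_number k T" for k
  proof (rule antisym)
    show "norm (blinfun_apply T (g k)) \<le> gelfand_number k T"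
      by (rule gelfand_number_ge_orthonormal[OF T orthonormal_subset[OF on]])
        (use Torth dec in auto)
    show "gelfand_number k T \<le> norm (blinfun_apply T (g k))"
    proof (rule gelfand_number_le)
      have "card (g ` {..<k}) \<le> k"
        using card_image_le[of "{..<k}" g] by simp
      then show "gelfand_bound k T (norm (blinfun_apply T (g k)))"
        unfolding gelfand_bound_def by (auto intro!: exI[of _ "g ` {..<k}"] max)
    qed
  qed
  show ?thesis
  proof (rule that[OF on eq])
    show "norm (blinfun_apply T x) \<le> gelfand_number k T * norm x"
      if "\<And>i. i < k \<Longrightarrow> cinner x (g i) = 0" for k x
      using max[OF that] by (simp add: eq)
    show "cinner (blinfun_apply T h) (blinfun_apply T (g k)) = 0" if h: "cinner h (g k) = 0" for k h
    \<comment> \<open>The component of \<open>h\<close> in the span of the predecessors of \<open>g k\<close> is treated separately.\<close>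
    proof -
      define e where "e = expansion {..<k} g h"
      have on_k: "orthonormal {..<k} g"
        by (rule orthonormal_subset[OF on]) simp
      have "cinner e (g k) = 0"
        by (auto simp: e_def cinner_expansion_left orth intro!: sum.neutral)
      then have "cinner (blinfun_apply T (h - e)) (blinfun_apply T (g k)) = 0"
        using orthogonal_diff_expansion[OF _ on_k, of _ h] h
        by (intro W) (auto simp: e_def cinner_diff_left)
      moreover have "cinner (blinfun_apply T e) (blinfun_apply T (g k)) = 0"
        by (auto simp: e_def expansion_def blinfun.sum_right bounded_operators_scaleC[OF T]
            cinner_sum_left cinner_scaleC_left Torth intro!: sum.neutral)
      ultimately show ?thesis
        by (simp add: blinfun.diff_right cinner_diff_left)
    qed
  qed
qed

lemma positive_operator_symmetric:
  assumes "positive_operator T"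
  shows "cinner (blinfun_apply T x) y = cinner x (blinfun_apply T y)"
proof -
  have T: "T \<in> bounded_operators" and re: "cinner (blinfun_apply T x) x \<in> \<real>\<^sub>\<ge>\<^sub>0" for x
    using assms by (auto simp: positive_operator_def)
  have "cinner (blinfun_apply T x) y - cinner x (blinfun_apply T y) = 0"
  proof (rule sesquilinear_eq_0[of "\<lambda>x y. cinner (blinfun_apply T x) y - cinner x (blinfun_apply T y)"])
    show "cinner (blinfun_apply T x) x - cinner x (blinfun_apply T x) = 0" for x
      using re[of x] cinner_commute[of x "blinfun_apply T x"]
      by (auto elim!: nonneg_Reals_cases)
  qed (simp_all add: blinfun.add_right cinner_add_left cinner_add_right bounded_operators_scaleC[OF T]
      cinner_scaleC_left cinner_scaleC_right algebra_simps)
  then show ?thesis by simp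
qed

lemma positive_operator_Re: "positive_operator T \<Longrightarrow> 0 \<le> Re (cinner (blinfun_apply T x) x)"
  by (auto simp: positive_operator_def elim!: nonneg_Reals_cases) 
    (metis Re_complex_of_real nonneg_Reals_cases)

text \<open>For a positive operator the right singular vectors are eigenvectors.\<close>

theorem positive_eigenvectors:
  fixes T :: "'a::complex_hilbert \<Rightarrow>\<^sub>L 'a"
  assumes pos: "positive_operator T" and lim: "(\<lambda>n. gelfand_number n T) \<longlonglongrightarrow> 0"
    and inf: "infinite_dimensional TYPE('a)"
  obtains g :: "nat \<Rightarrow> 'a" where "orthonormal UNIV g"
    and "\<And>k. blinfun_apply T (g k) = complex_of_real (gelfand_number k T) *\<^sub>C g k"
    and "\<And>k x. (\<And>i. i < k \<Longrightarrow> cinner x (g i) = 0) \<Longrightarrow> norm (blinfun_apply T x) \<le> gelfand_number k T * norm x"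
proof -
  have T: "T \<in> bounded_operators"
    using pos by (simp add: positive_operator_def)
  from Schmidt_vectors[OF T lim inf] obtain g :: "nat \<Rightarrow> 'a" where g: "orthonormal UNIV g"
    "\<And>k. norm (blinfun_apply T (g k)) = gelfand_number k T"
    "\<And>k x. (\<And>i. i < k \<Longrightarrow> cinner x (g i) = 0) \<Longrightarrow> norm (blinfun_apply T x) \<le> gelfand_number k T * norm x"
    "\<And>k h. cinner h (g k) = 0 \<Longrightarrow> cinner (blinfun_apply T h) (blinfun_apply T (g k)) = 0"
    by blast
  have "blinfun_apply T (g k) = complex_of_real (gelfand_number k T) *\<^sub>C g k" for k
  proof -
    define s where "s = gelfand_number k T"
    define c where "c = complex_of_real s"
    have s0: "0 \<le> s" by (simp add: s_def gelfand_number_nonneg)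
    have gk: "cinner (g k) (g k) = 1" "norm (g k) = 1"
      using g(1) orthonormal_norm[OF g(1)] by (auto simp: orthonormal_def)
    \<comment> \<open>The orthogonality in the Schmidt decomposition says that \<open>g k\<close> is an eigenvector of \<open>T \<circ> T\<close>.\<close>
    have T2: "blinfun_apply T (blinfun_apply T (g k)) = (c * c) *\<^sub>C g k"
    proof (rule cinner_ext)
      fix z
      define h where "h = z - cinner z (g k) *\<^sub>C g k"
      have "cinner h (g k) = 0"
        by (simp add: h_def cinner_diff_left cinner_scaleC_left gk)
      then have "cinner (blinfun_apply T h) (blinfun_apply T (g k)) = 0"
        by (rule g(4))
      then have h0: "cinner (blinfun_apply T (blinfun_apply T (g k))) h = 0"
        using positive_operator_symmetric[OF pos] cinner_eq_0_commute by metis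
      have zz: "z = h + cinner z (g k) *\<^sub>C g k" by (simp add: h_def)
      have "cinner (blinfun_apply T (blinfun_apply T (g k))) (g k) = c * c"
        using g(2)[of k] by (simp add: positive_operator_symmetric[OF pos, of "blinfun_apply T (g k)"]
            cinner_norm c_def s_def power2_eq_square)
      then have "cinner (blinfun_apply T (blinfun_apply T (g k))) z = cnj (cinner z (g k)) * (c * c)"
        by (subst zz) (simp add: cinner_add_right cinner_scaleC_right h0)
      then show "cinner (blinfun_apply T (blinfun_apply T (g k))) z = cinner ((c * c) *\<^sub>C g k) z"
        using cinner_commute[of "g k" z] by (simp add: cinner_scaleC_left mult.commute)
    qed
    \<comment> \<open>If \<open>s > 0\<close>, positivity excludes eigenvectors for \<open>- s\<close>, so that \<open>w = 0\<close>.\<close>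
    define w where "w = blinfun_apply T (g k) - c *\<^sub>C g k"
    have "blinfun_apply T w = - (c *\<^sub>C w)"
      by (simp add: w_def blinfun.diff_right T2 bounded_operators_scaleC[OF T]
          complex_vector.scale_right_diff_distrib scaleC_scaleC)
    then have "cinner (blinfun_apply T w) w = - complex_of_real (s * (norm w)\<^sup>2)"
      by (simp add: cinner_minus_left cinner_scaleC_left cinner_norm c_def)
    then have "0 \<le> - (s * (norm w)\<^sup>2)"
      using positive_operator_Re[OF pos, of w] by simp
    moreover have "0 \<le> s * (norm w)\<^sup>2"
      using s0 by simp
    ultimately have "s = 0 \<or> w = 0"
      by (smt (verit) mult_eq_0_iff power_eq_0_iff norm_eq_zero)
    then have "blinfun_apply T (g k) = c *\<^sub>C g k"
    proof
      assume "s = 0"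
      then have "norm (blinfun_apply T (g k)) = 0"
        using g(2)[of k] by (simp add: s_def)
      then show ?thesis using \<open>s = 0\<close> by (simp add: c_def)
    qed (simp add: w_def)
    then show ?thesis by (simp add: c_def s_def)
  qed
  then show ?thesis
    by (rule that[OF g(1) _ g(3)])
qed

instance complex_hilbert \<subseteq> banach ..

section \<open>Operators given by a Schmidt series\<close>

lemma norm_sum_suborthonormal_le:
  assumes "finite I" "suborthonormal I w"
  shows "(norm (\<Sum>i\<in>I. a i *\<^sub>C w i))\<^sup>2 \<le> (\<Sum>i\<in>I. (cmod (a i))\<^sup>2)"
proof -
  have "(norm (\<Sum>i\<in>I. a i *\<^sub>C w i))\<^sup>2 = (\<Sum>i\<in>I. (cmod (a i))\<^sup>2 * (norm (w i))\<^sup>2)"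
    by (rule norm_sum_orthogonal) (use assms in \<open>auto simp: suborthonormal_def\<close>)
  also have "\<dots> \<le> (\<Sum>i\<in>I. (cmod (a i))\<^sup>2)"
    by (intro sum_mono mult_left_le power_le_one) (use assms in \<open>auto simp: suborthonormal_def\<close>)
  finally show ?thesis .
qed

lemma summable_suborthonormal:
  fixes w :: "nat \<Rightarrow> 'a::complex_hilbert"
  assumes w: "suborthonormal UNIV w" and a: "summable (\<lambda>k. (cmod (a k))\<^sup>2)"
  shows "summable (\<lambda>k. a k *\<^sub>C w k)"
  unfolding summable_Cauchy
proof (intro allI impI)
  fix e :: real assume "e > 0"
  then have "0 < e\<^sup>2" by simp
  with a obtain N where N: "\<And>m n. m \<ge> N \<Longrightarrow> norm (\<Sum>k\<in>{m..<n}. (cmod (a k))\<^sup>2) < e\<^sup>2"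
    unfolding summable_Cauchy by blast
  have "norm (\<Sum>k\<in>{m..<n}. a k *\<^sub>C w k) < e" if "m \<ge> N" for m n
  proof (rule power2_less_imp_less)
    have "(norm (\<Sum>k\<in>{m..<n}. a k *\<^sub>C w k))\<^sup>2 \<le> (\<Sum>k\<in>{m..<n}. (cmod (a k))\<^sup>2)"
      by (rule norm_sum_suborthonormal_le) (use suborthonormal_subset[OF w] in auto)
    also have "\<dots> < e\<^sup>2"
      using N[OF that, of n] by simp
    finally show "(norm (\<Sum>k\<in>{m..<n}. a k *\<^sub>C w k))\<^sup>2 < e\<^sup>2" .
  qed (use \<open>e > 0\<close> in simp)
  then show "\<exists>N. \<forall>m\<ge>N. \<forall>n. norm (\<Sum>k\<in>{m..<n}. a k *\<^sub>C w k) < e" by blast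
qed

lemma summable_Bessel:
  fixes v :: "nat \<Rightarrow> 'a::complex_inner"
  assumes "suborthonormal UNIV v"
  shows "summable (\<lambda>k. (cmod (cinner x (v k)))\<^sup>2)"
  by (rule summableI_nonneg_bounded[of _ "(norm x)\<^sup>2"])
    (use Bessel_inequality suborthonormal_subset[OF assms] in auto)

text \<open>The data of a series \<open>\<Sum>k. s k * \<langle>x, v k\<rangle> w k\<close> with decreasing nonnegative coefficients.\<close>

locale schmidt_series =
  fixes s :: "nat \<Rightarrow> real" and v w :: "nat \<Rightarrow> 'a::complex_hilbert"
  assumes s_nonneg: "0 \<le> s k" and s_antimono: "m \<le> n \<Longrightarrow> s n \<le> s m"
    and v: "suborthonormal UNIV v" and w: "suborthonormal UNIV w"
begin

text \<open>The operator \<open>x \<mapsto> \<Sum>k. s k * \<langle>x, v k\<rangle> w k\<close>.\<close>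

definition series_operator :: "'a \<Rightarrow>\<^sub>L 'a" where
  "series_operator = Blinfun (\<lambda>x. \<Sum>k. (complex_of_real (s k) * cinner x (v k)) *\<^sub>C w k)"

lemma coefficient_le: "(cmod (complex_of_real (s k) * cinner x (v k)))\<^sup>2 \<le> (s 0)\<^sup>2 * (cmod (cinner x (v k)))\<^sup>2"
  using power_mono[OF s_antimono[of 0 k] s_nonneg, of 2]
  by (simp add: norm_mult power_mult_distrib mult_right_mono)

lemma summable_series: "summable (\<lambda>k. (complex_of_real (s k) * cinner x (v k)) *\<^sub>C w k)"
proof (rule summable_suborthonormal[OF w])
  have "summable (\<lambda>k. (s 0)\<^sup>2 * (cmod (cinner x (v k)))\<^sup>2)"
    by (intro summable_mult summable_Bessel v)
  then show "summable (\<lambda>k. (cmod (complex_of_real (s k) * cinner x (v k)))\<^sup>2)"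
    by (rule summable_comparison_test[rotated]) (use coefficient_le in auto)
qed

lemma norm_series_le:
  assumes "\<And>i. i < n \<Longrightarrow> cinner x (v i) = 0"
  shows "norm (\<Sum>k. (complex_of_real (s k) * cinner x (v k)) *\<^sub>C w k) \<le> s n * norm x"
proof (rule Lim_norm_ubound[OF _ summable_LIMSEQ[OF summable_series]])
  have "norm (\<Sum>k<m. (complex_of_real (s k) * cinner x (v k)) *\<^sub>C w k) \<le> s n * norm x" for m
  proof (rule power2_le_imp_le)
    have "(norm (\<Sum>k<m. (complex_of_real (s k) * cinner x (v k)) *\<^sub>C w k))\<^sup>2 \<le>
        (\<Sum>k<m. (cmod (complex_of_real (s k) * cinner x (v k)))\<^sup>2)"
      by (rule norm_sum_suborthonormal_le) (use suborthonormal_subset[OF w] in auto)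
    also have "\<dots> \<le> (\<Sum>k<m. (s n)\<^sup>2 * (cmod (cinner x (v k)))\<^sup>2)"
    proof (rule sum_mono)
      fix k
      show "(cmod (complex_of_real (s k) * cinner x (v k)))\<^sup>2 \<le> (s n)\<^sup>2 * (cmod (cinner x (v k)))\<^sup>2"
        using assms[of k] power_mono[OF s_antimono[of n k] s_nonneg, of 2]
        by (cases "k < n") (simp_all add: norm_mult power_mult_distrib mult_right_mono)
    qed
    also have "\<dots> \<le> (s n)\<^sup>2 * (norm x)\<^sup>2"
      unfolding sum_distrib_left[symmetric]
      by (intro mult_left_mono Bessel_inequality) (use suborthonormal_subset[OF v] in auto)
    finally show "(norm (\<Sum>k<m. (complex_of_real (s k) * cinner x (v k)) *\<^sub>C w k))\<^sup>2 \<le> (s n * norm x)\<^sup>2"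
      by (simp add: power_mult_distrib)
  qed (simp add: s_nonneg)
  then show "\<forall>\<^sub>F m in sequentially. norm (\<Sum>k<m. (complex_of_real (s k) * cinner x (v k)) *\<^sub>C w k) \<le> s n * norm x"
    by (intro always_eventually allI)
qed simp

lemma
  shows series_operator_apply: "blinfun_apply series_operator x = (\<Sum>k. (complex_of_real (s k) * cinner x (v k)) *\<^sub>C w k)"
    and series_operator_bounded: "series_operator \<in> bounded_operators"
proof -
  define f where "f x = (\<Sum>k. (complex_of_real (s k) * cinner x (v k)) *\<^sub>C w k)" for x
  have "f (x + y) = f x + f y" for x y
    by (simp add: f_def cinner_add_left distrib_left scaleC_add_left suminf_add[OF summable_series summable_series])
  moreover have "f (c *\<^sub>C x) = c *\<^sub>C f x" for c x
  proof -
    have "(\<lambda>k. c *\<^sub>C ((complex_of_real (s k) * cinner x (v k)) *\<^sub>C w k)) sums (c *\<^sub>C f x)"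
      unfolding sums_def f_def complex_vector.scale_sum_right[symmetric]
      by (intro tendsto_scaleC summable_LIMSEQ summable_series)
    then show ?thesis
      by (simp add: f_def cinner_scaleC_left scaleC_scaleC mult.left_commute sums_unique[symmetric])
  qed
  moreover have "norm (f x) \<le> norm x * s 0" for x
    using norm_series_le[of 0 x] by (simp add: f_def mult.commute)
  ultimately show "blinfun_apply series_operator x = (\<Sum>k. (complex_of_real (s k) * cinner x (v k)) *\<^sub>C w k)"
    "series_operator \<in> bounded_operators"
    unfolding series_operator_def f_def[symmetric] by (blast intro: complex_linear_Blinfun)+
qed

lemma series_operator_sums:
  "(\<lambda>k. (complex_of_real (s k) * cinner x (v k)) *\<^sub>C w k) sums blinfun_apply series_operator x"
  unfolding series_operator_apply by (rule summable_sums[OF summable_series])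

lemma cinner_series_operator_sums:
  "(\<lambda>k. complex_of_real (s k) * cinner x (v k) * cinner (w k) y) sums cinner (blinfun_apply series_operator x) y"
  using bounded_linear.sums[OF bounded_bilinear.bounded_linear_left[OF bounded_bilinear_cinner, of y]
      series_operator_sums[of x]]
  by (simp add: cinner_scaleC_left)

lemma gelfand_number_series_le: "gelfand_number n series_operator \<le> s n"
proof (rule gelfand_number_le)
  have "card (v ` {..<n}) \<le> n"
    using card_image_le[of "{..<n}" v] by simp
  then show "gelfand_bound n series_operator (s n)"
    unfolding gelfand_bound_def
    by (auto simp: s_nonneg series_operator_apply intro!: exI[of _ "v ` {..<n}"] norm_series_le)
qed

lemma gelfand_number_series:
  assumes "orthonormal UNIV v" "orthonormal UNIV w"
  shows "gelfand_number n series_operator = s n"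
proof (rule antisym[OF gelfand_number_series_le])
  have eq: "blinfun_apply series_operator (v i) = complex_of_real (s i) *\<^sub>C w i" for i
  proof -
    have "(\<lambda>k. if k = i then complex_of_real (s i) *\<^sub>C w i else 0) =
        (\<lambda>k. (complex_of_real (s k) * cinner (v i) (v k)) *\<^sub>C w k)"
      using assms(1) by (auto simp: orthonormal_def fun_eq_iff)
    then show ?thesis
      using series_operator_sums[of "v i"] sums_single[of i "\<lambda>_. complex_of_real (s i) *\<^sub>C w i"]
        sums_unique2 by fastforce
  qed
  show "s n \<le> gelfand_number n series_operator"
  proof (rule gelfand_number_ge_orthonormal[OF series_operator_bounded orthonormal_subset[OF assms(1)]])
    show "s n \<le> norm (blinfun_apply series_operator (v i))" if "i \<le> n" for i
      using s_antimono[OF that] s_nonneg orthonormal_norm[OF assms(2)]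
      by (simp add: eq norm_scaleC)
  qed (use assms(2) s_nonneg in \<open>auto simp: eq cinner_scaleC_left cinner_scaleC_right orthonormal_def\<close>)
qed

lemma positive_series_operator:
  assumes "w = v"
  shows "positive_operator series_operator"
  unfolding positive_operator_def
proof (intro conjI allI series_operator_bounded)
  fix x
  have "(\<lambda>k. complex_of_real (s k * (cmod (cinner x (v k)))\<^sup>2)) sums cinner (blinfun_apply series_operator x) x"
  proof -
    have "complex_of_real (s k * (cmod (cinner x (v k)))\<^sup>2) = complex_of_real (s k) * cinner x (v k) * cinner (w k) x" for k
      using cinner_commute[of "v k" x] by (simp add: assms complex_norm_square mult.assoc del: of_real_power)
    then show ?thesis
      using cinner_series_operator_sums[of x x] by (simp only:)
  qed
  then have re: "(\<lambda>k. s k * (cmod (cinner x (v k)))\<^sup>2) sums Re (cinner (blinfun_apply series_operator x) x)"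
    and im: "(\<lambda>k. 0) sums Im (cinner (blinfun_apply series_operator x) x)"
    by (auto dest: sums_Re sums_Im)
  have "0 \<le> Re (cinner (blinfun_apply series_operator x) x)"
    using sums_le[OF _ sums_zero re] s_nonneg by simp
  moreover have "Im (cinner (blinfun_apply series_operator x) x) = 0"
    using sums_unique2[OF im sums_zero] .
  ultimately show "cinner (blinfun_apply series_operator x) x \<in> \<real>\<^sub>\<ge>\<^sub>0"
    by (simp add: complex_nonneg_Reals_iff)
qed

end

text \<open>The left singular vector \<open>e k\<close> is zero when \<open>gelfand_number k T = 0\<close>, which is why
  this family is only suborthonormal.\<close>

theorem Schmidt_decomposition:
  fixes T :: "'a::complex_hilbert \<Rightarrow>\<^sub>L 'a"
  assumes T: "T \<in> bounded_operators" and lim: "(\<lambda>n. gelfand_number n T) \<longlonglongrightarrow> 0"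
    and inf: "infinite_dimensional TYPE('a)"
  obtains g e :: "nat \<Rightarrow> 'a" where "suborthonormal UNIV g" "suborthonormal UNIV e"
    "T = schmidt_series.series_operator (\<lambda>k. gelfand_number k T) g e"
proof -
  from Schmidt_vectors[OF assms] obtain g :: "nat \<Rightarrow> 'a" where g: "orthonormal UNIV g"
    "\<And>k. norm (blinfun_apply T (g k)) = gelfand_number k T"
    "\<And>k x. (\<And>i. i < k \<Longrightarrow> cinner x (g i) = 0) \<Longrightarrow> norm (blinfun_apply T x) \<le> gelfand_number k T * norm x"
    "\<And>k h. cinner h (g k) = 0 \<Longrightarrow> cinner (blinfun_apply T h) (blinfun_apply T (g k)) = 0"
    by blast
  define e where "e k = normalize_vector (blinfun_apply T (g k))" for k
  have e: "suborthonormal UNIV e"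
  proof -
    have "norm (e k) \<le> 1" for k
      using norm_normalize_vector[of "blinfun_apply T (g k)"]
      by (cases "blinfun_apply T (g k) = 0") (simp_all add: e_def, simp add: normalize_vector_def)
    moreover have "cinner (e i) (e j) = 0" if "i \<noteq> j" for i j
      using g(4)[of "g i" j] g(1) that
      by (simp add: e_def normalize_vector_def cinner_scaleC_left cinner_scaleC_right orthonormal_def)
    ultimately show ?thesis
      by (simp add: suborthonormal_def)
  qed
  have Tg: "blinfun_apply T (g k) = complex_of_real (gelfand_number k T) *\<^sub>C e k" for k
    by (simp add: e_def scaleC_normalize_vector flip: g(2))
  interpret schmidt_series "\<lambda>k. gelfand_number k T" g e
    by unfold_locales
      (use gelfand_number_nonneg gelfand_number_antimono e orthonormal_imp_suborthonormal[OF g(1)] in auto)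
  have "T = series_operator"
  proof (rule blinfun_eqI)
    fix x
    define S where "S n = (\<Sum>k<n. (complex_of_real (gelfand_number k T) * cinner x (g k)) *\<^sub>C e k)" for n
    have on: "orthonormal {..<n} g" for n
      by (rule orthonormal_subset[OF g(1)]) simp
    have S: "S n = blinfun_apply T (expansion {..<n} g x)" for n
      by (simp add: S_def expansion_def blinfun.sum_right bounded_operators_scaleC[OF T] Tg scaleC_scaleC mult.commute)
    have "norm (blinfun_apply T x - S n) \<le> gelfand_number n T * norm x" for n
    proof -
      have "norm (blinfun_apply T (x - expansion {..<n} g x)) \<le> gelfand_number n T * norm (x - expansion {..<n} g x)"
        by (rule g(3)) (use orthogonal_diff_expansion[OF _ on] in auto)
      also have "\<dots> \<le> gelfand_number n T * norm x"
        by (intro mult_left_mono norm_diff_expansion_le on gelfand_number_nonneg) simp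
      finally show ?thesis
        by (simp add: S blinfun.diff_right)
    qed
    then have "(\<lambda>n. blinfun_apply T x - S n) \<longlonglongrightarrow> 0"
      by (intro Lim_null_comparison[OF _ tendsto_mult_left_zero[OF lim, of "norm x"]] always_eventually) auto
    from tendsto_diff[OF tendsto_const this, of "blinfun_apply T x"] have "S \<longlonglongrightarrow> blinfun_apply T x"
      by simp
    moreover have "S \<longlonglongrightarrow> blinfun_apply series_operator x"
      using series_operator_sums[of x] by (simp add: sums_def S_def[abs_def])
    ultimately show "blinfun_apply T x = blinfun_apply series_operator x"
      by (rule LIMSEQ_unique)
  qed
  then show ?thesis
    by (rule that[OF orthonormal_imp_suborthonormal[OF g(1)] e])
qed

text \<open>Polarization of the Schmidt series: for \<open>\<bar>\<zeta>\<bar> = 1\<close> this is one quarter of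
  \<open>\<Sum>k. s k *\<^sub>R \<langle>\<cdot>, u k\<rangle> u k\<close> with \<open>u k = e k + \<zeta> g k\<close>.\<close>

lemma positive_polarized_series:
  assumes "schmidt_series s g (e :: nat \<Rightarrow> 'a::complex_hilbert)" "cmod \<zeta> = 1"
  shows "positive_operator (op_scaleC (1 / 4)
    (schmidt_series.series_operator s e e + schmidt_series.series_operator s g g +
     (op_scaleC \<zeta> (schmidt_series.series_operator s e g) + op_scaleC (cnj \<zeta>) (schmidt_series.series_operator s g e))))"
    (is "positive_operator ?B")
  unfolding positive_operator_def
proof (intro conjI allI)
  interpret ge: schmidt_series s g e by fact
  interpret ee: schmidt_series s e e by unfold_locales (use ge.s_nonneg ge.s_antimono ge.w in auto)
  interpret gg: schmidt_series s g g by unfold_locales (use ge.s_nonneg ge.s_antimono ge.v in auto)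
  interpret eg: schmidt_series s e g by unfold_locales (use ge.s_nonneg ge.s_antimono ge.v ge.w in auto)
  show "?B \<in> bounded_operators"
    using ee.series_operator_bounded gg.series_operator_bounded eg.series_operator_bounded ge.series_operator_bounded
    by (simp add: bounded_operators_def op_scaleC_apply blinfun.add_left scaleC_add_right scaleC_scaleC mult.commute)
  fix x
  define a b where "a k = cinner x (e k)" and "b k = cinner x (g k)" for k
  define t where "t k = 1 / 4 * s k * (cmod (a k + cnj \<zeta> * b k))\<^sup>2" for k
  have "(\<lambda>k. 1 / 4 * (complex_of_real (s k) * cinner x (e k) * cinner (e k) x
      + complex_of_real (s k) * cinner x (g k) * cinner (g k) x
      + (\<zeta> * (complex_of_real (s k) * cinner x (e k) * cinner (g k) x)
      + cnj \<zeta> * (complex_of_real (s k) * cinner x (g k) * cinner (e k) x)))) sums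
    (1 / 4 * (cinner (blinfun_apply ee.series_operator x) x + cinner (blinfun_apply gg.series_operator x) x
      + (\<zeta> * cinner (blinfun_apply eg.series_operator x) x + cnj \<zeta> * cinner (blinfun_apply ge.series_operator x) x)))"
    by (intro sums_mult sums_add ee.cinner_series_operator_sums gg.cinner_series_operator_sums
        eg.cinner_series_operator_sums ge.cinner_series_operator_sums)
  also have "(1 / 4 * (cinner (blinfun_apply ee.series_operator x) x + cinner (blinfun_apply gg.series_operator x) x
      + (\<zeta> * cinner (blinfun_apply eg.series_operator x) x + cnj \<zeta> * cinner (blinfun_apply ge.series_operator x) x))) =
    cinner (blinfun_apply ?B x) x"
    by (simp add: op_scaleC_apply blinfun.add_left cinner_add_left cinner_scaleC_left)
  also have "(\<lambda>k. 1 / 4 * (complex_of_real (s k) * cinner x (e k) * cinner (e k) x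
      + complex_of_real (s k) * cinner x (g k) * cinner (g k) x
      + (\<zeta> * (complex_of_real (s k) * cinner x (e k) * cinner (g k) x)
      + cnj \<zeta> * (complex_of_real (s k) * cinner x (g k) * cinner (e k) x)))) = (\<lambda>k. complex_of_real (t k))"
  proof
    fix k
    have "cnj \<zeta> * \<zeta> = 1"
      using complex_norm_square[of \<zeta>] assms(2) by (simp add: mult.commute)
    then have "b k * cnj (b k) = (cnj \<zeta> * b k) * cnj (cnj \<zeta> * b k)"
      by (metis (no_types, opaque_lifting) complex_cnj_cnj complex_cnj_mult mult.assoc mult.commute mult_1)
    then have "(a k + cnj \<zeta> * b k) * cnj (a k + cnj \<zeta> * b k) =
        a k * cnj (a k) + b k * cnj (b k) + (\<zeta> * (a k * cnj (b k)) + cnj \<zeta> * (b k * cnj (a k)))"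
      by (simp add: algebra_simps)
    then have "complex_of_real (t k) = 1 / 4 * complex_of_real (s k) *
        (a k * cnj (a k) + b k * cnj (b k) + (\<zeta> * (a k * cnj (b k)) + cnj \<zeta> * (b k * cnj (a k))))"
      unfolding t_def using complex_norm_square[of "a k + cnj \<zeta> * b k"] by simp
    moreover have "cinner (e k) x = cnj (a k)" "cinner (g k) x = cnj (b k)"
      unfolding a_def b_def by (rule cinner_commute)+
    ultimately show "1 / 4 * (complex_of_real (s k) * cinner x (e k) * cinner (e k) x
      + complex_of_real (s k) * cinner x (g k) * cinner (g k) x
      + (\<zeta> * (complex_of_real (s k) * cinner x (e k) * cinner (g k) x)
      + cnj \<zeta> * (complex_of_real (s k) * cinner x (g k) * cinner (e k) x))) = complex_of_real (t k)"
      by (simp add: a_def[symmetric] b_def[symmetric] algebra_simps)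
  qed
  finally have sums: "(\<lambda>k. complex_of_real (t k)) sums cinner (blinfun_apply ?B x) x" .
  have "0 \<le> Re (cinner (blinfun_apply ?B x) x)"
    using sums_le[OF _ sums_zero sums_Re[OF sums]] ge.s_nonneg by (simp add: t_def)
  moreover have "(\<lambda>k. 0) sums Im (cinner (blinfun_apply ?B x) x)"
    using sums_Im[OF sums] by simp
  then have "Im (cinner (blinfun_apply ?B x) x) = 0"
    using sums_zero sums_unique2 by blast
  ultimately show "cinner (blinfun_apply ?B x) x \<in> \<real>\<^sub>\<ge>\<^sub>0"
    by (simp add: complex_nonneg_Reals_iff)
qed


section \<open>Ky Fan's inequalities\<close>

text \<open>The sum of the \<open>n\<close> largest singular values.\<close>

definition gelfand_sum :: "nat \<Rightarrow> ('a::complex_inner \<Rightarrow>\<^sub>L 'a) \<Rightarrow> real" where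
  "gelfand_sum n T = (\<Sum>k<n. gelfand_number k T)"

lemma gelfand_sum_Suc: "gelfand_sum (Suc n) T = gelfand_sum n T + gelfand_number n T"
  by (simp add: gelfand_sum_def)

lemma gelfand_sum_mono: "m \<le> n \<Longrightarrow> gelfand_sum m T \<le> gelfand_sum n T"
  unfolding gelfand_sum_def by (rule sum_mono2) (auto simp: gelfand_number_nonneg)

lemma gelfand_sum_nonneg: "0 \<le> gelfand_sum n T"
  unfolding gelfand_sum_def by (rule sum_nonneg) (simp add: gelfand_number_nonneg)

lemma quadratic_form_decomposition:
  fixes n :: nat
  assumes pos: "positive_operator T" and g: "orthonormal UNIV g"
    and eig: "\<And>k. blinfun_apply T (g k) = complex_of_real (s k) *\<^sub>C g k"
  shows "Re (cinner (blinfun_apply T x) x) = (\<Sum>k<n. s k * (cmod (cinner x (g k)))\<^sup>2) +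
    Re (cinner (blinfun_apply T (x - expansion {..<n} g x)) (x - expansion {..<n} g x))"
proof -
  have T: "T \<in> bounded_operators"
    using pos by (simp add: positive_operator_def)
  define e r where "e = expansion {..<n} g x" and "r = x - e"
  have on: "orthonormal {..<n} g"
    by (rule orthonormal_subset[OF g]) simp
  have r: "cinner r (g k) = 0" if "k < n" for k
    using orthogonal_diff_expansion[OF finite_lessThan on, of k x] that by (simp add: r_def e_def)
  have Te: "blinfun_apply T e = (\<Sum>k<n. (complex_of_real (s k) * cinner x (g k)) *\<^sub>C g k)"
    by (simp add: e_def expansion_def blinfun.sum_right bounded_operators_scaleC[OF T] eig scaleC_scaleC mult.commute)
  have "cinner (blinfun_apply T e) x = (\<Sum>k<n. complex_of_real (s k * (cmod (cinner x (g k)))\<^sup>2))"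
    unfolding Te cinner_sum_left
  proof (rule sum.cong)
    show "cinner ((complex_of_real (s k) * cinner x (g k)) *\<^sub>C g k) x = complex_of_real (s k * (cmod (cinner x (g k)))\<^sup>2)" for k
      using cinner_commute[of "g k" x]
      by (simp add: cinner_scaleC_left complex_norm_square mult.assoc del: of_real_power)
  qed simp
  then have 1: "Re (cinner (blinfun_apply T e) x) = (\<Sum>k<n. s k * (cmod (cinner x (g k)))\<^sup>2)"
    by simp
  have "cinner (blinfun_apply T r) e = cinner r (blinfun_apply T e)"
    by (rule positive_operator_symmetric[OF pos])
  also have "\<dots> = 0"
    unfolding Te cinner_sum_right by (rule sum.neutral) (simp add: cinner_scaleC_right r)
  finally have 2: "cinner (blinfun_apply T r) e = 0" .
  have "cinner (blinfun_apply T x) x = cinner (blinfun_apply T e) x + cinner (blinfun_apply T r) (r + e)"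
    by (simp add: r_def blinfun.diff_right cinner_diff_left)
  then have "Re (cinner (blinfun_apply T x) x) = Re (cinner (blinfun_apply T e) x) + Re (cinner (blinfun_apply T r) r)"
    by (simp add: cinner_add_right 2)
  then show ?thesis
    using 1 unfolding r_def e_def by simp
qed

text \<open>The trace of the compression of \<open>T\<close> to an \<open>n\<close>-dimensional subspace is at most the sum of the
  \<open>n\<close> largest eigenvalues.\<close>

theorem Ky_Fan_upper:
  fixes T :: "'a::complex_hilbert \<Rightarrow>\<^sub>L 'a"
  assumes pos: "positive_operator T" and lim: "(\<lambda>n. gelfand_number n T) \<longlonglongrightarrow> 0"
    and inf: "infinite_dimensional TYPE('a)"
    and f: "finite I" "orthonormal I f"
  shows "(\<Sum>i\<in>I. Re (cinner (blinfun_apply T (f i)) (f i))) \<le> gelfand_sum (card I) T"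
proof -
  obtain g where g: "orthonormal UNIV g" "\<And>k. blinfun_apply T (g k) = complex_of_real (gelfand_number k T) *\<^sub>C g k"
    "\<And>k x. (\<And>i. i < k \<Longrightarrow> cinner x (g i) = 0) \<Longrightarrow> norm (blinfun_apply T x) \<le> gelfand_number k T * norm x"
    using positive_eigenvectors[OF pos lim inf] by blast
  define n where "n = card I"
  define s where "s k = gelfand_number k T" for k
  \<comment> \<open>The weight of the eigenvector \<open>g k\<close> in the span of the family \<open>f\<close>.\<close>
  define b where "b k = (\<Sum>i\<in>I. (cmod (cinner (f i) (g k)))\<^sup>2)" for k
  have on: "orthonormal {..<n} g"
    by (rule orthonormal_subset[OF g(1)]) simp
  have b1: "b k \<le> 1" for k
  proof -
    have "b k = (\<Sum>i\<in>I. (cmod (cinner (g k) (f i)))\<^sup>2)"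
      unfolding b_def by (rule sum.cong) (simp, metis cinner_commute complex_mod_cnj)
    also have "\<dots> \<le> 1"
      using Bessel_inequality[OF f(1) orthonormal_imp_suborthonormal[OF f(2)], of "g k"]
        orthonormal_norm[OF g(1), of k] by simp
    finally show ?thesis .
  qed
  have form: "Re (cinner (blinfun_apply T (f i)) (f i)) \<le>
    (\<Sum>k<n. (s k - s n) * (cmod (cinner (f i) (g k)))\<^sup>2) + s n" if "i \<in> I" for i
  proof -
    define r where "r = f i - expansion {..<n} g (f i)"
    have fi: "norm (f i) = 1"
      using orthonormal_norm[OF f(2) that] .
    have "Re (cinner (blinfun_apply T r) r) \<le> norm (blinfun_apply T r) * norm r"
      using cinner_Cauchy_Schwarz[of "blinfun_apply T r" r] complex_Re_le_cmod order_trans by blast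
    also have "\<dots> \<le> s n * norm r * norm r"
      unfolding s_def
      by (intro mult_right_mono g(3)) (use orthogonal_diff_expansion[OF _ on] in \<open>auto simp: r_def\<close>)
    also have "\<dots> = s n * (1 - (\<Sum>k<n. (cmod (cinner (f i) (g k)))\<^sup>2))"
      using norm_diff_expansion_orthonormal[OF _ on, of "f i"] fi
      by (simp add: r_def power2_eq_square)
    finally show ?thesis
      using quadratic_form_decomposition[OF pos g(1,2), of "f i" n]
      by (simp add: r_def s_def algebra_simps sum_subtractf sum_distrib_left)
  qed
  have "(\<Sum>i\<in>I. Re (cinner (blinfun_apply T (f i)) (f i))) \<le>
      (\<Sum>i\<in>I. (\<Sum>k<n. (s k - s n) * (cmod (cinner (f i) (g k)))\<^sup>2) + s n)"
    by (rule sum_mono) (rule form)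
  also have "\<dots> = (\<Sum>k<n. (s k - s n) * b k) + n * s n"
    unfolding sum.distrib b_def sum_distrib_left by (subst sum.swap) (simp add: n_def)
  also have "\<dots> \<le> (\<Sum>k<n. (s k - s n) * 1) + n * s n"
    by (intro add_right_mono sum_mono mult_left_mono b1)
      (auto simp: s_def intro: gelfand_number_antimono)
  also have "\<dots> = (\<Sum>k<n. s k)"
    by (simp add: sum_subtractf)
  finally show ?thesis
    by (simp add: gelfand_sum_def s_def n_def)
qed

theorem gelfand_sum_add_le:
  fixes S T :: "'a::complex_hilbert \<Rightarrow>\<^sub>L 'a"
  assumes pos: "positive_operator S" "positive_operator T"
    and lim: "(\<lambda>n. gelfand_number n S) \<longlonglongrightarrow> 0" "(\<lambda>n. gelfand_number n T) \<longlonglongrightarrow> 0"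
      "(\<lambda>n. gelfand_number n (S + T)) \<longlonglongrightarrow> 0"
    and add: "positive_operator (S + T)"
    and inf: "infinite_dimensional TYPE('a)"
  shows "gelfand_sum n (S + T) \<le> gelfand_sum n S + gelfand_sum n T"
proof -
  obtain g where g: "orthonormal UNIV g" "\<And>k. blinfun_apply (S + T) (g k) = complex_of_real (gelfand_number k (S + T)) *\<^sub>C g k"
    "\<And>k x. (\<And>i. i < k \<Longrightarrow> cinner x (g i) = 0) \<Longrightarrow> norm (blinfun_apply (S + T) x) \<le> gelfand_number k (S + T) * norm x"
    using positive_eigenvectors[OF add lim(3) inf] by blast
  have on: "orthonormal {..<n} g"
    by (rule orthonormal_subset[OF g(1)]) simp
  have "gelfand_sum n (S + T) = (\<Sum>k<n. Re (cinner (blinfun_apply (S + T) (g k)) (g k)))"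
    using orthonormal_norm[OF g(1)] by (simp add: gelfand_sum_def g(2) cinner_scaleC_left cinner_norm)
  also have "\<dots> = (\<Sum>k<n. Re (cinner (blinfun_apply S (g k)) (g k))) + (\<Sum>k<n. Re (cinner (blinfun_apply T (g k)) (g k)))"
    by (simp add: blinfun.add_left cinner_add_left sum.distrib)
  also have "\<dots> \<le> gelfand_sum n S + gelfand_sum n T"
    using Ky_Fan_upper[OF pos(1) lim(1) inf _ on] Ky_Fan_upper[OF pos(2) lim(2) inf _ on] by simp
  finally show ?thesis .
qed

text \<open>On every subspace that contains the first \<open>n\<close> eigenvectors, the trace of the compression of
  \<open>T\<close> is at least the sum of the \<open>n\<close> largest eigenvalues.\<close>

lemma Ky_Fan_lower:
  fixes T :: "'a::complex_hilbert \<Rightarrow>\<^sub>L 'a"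
  assumes pos: "positive_operator T" and lim: "(\<lambda>n. gelfand_number n T) \<longlonglongrightarrow> 0"
    and inf: "infinite_dimensional TYPE('a)"
  shows "\<exists>V. finite V \<and> card V \<le> n \<and> (\<forall>F. finite F \<longrightarrow> orthonormal F (\<lambda>x. x) \<longrightarrow> V \<subseteq> complex_vector.span F \<longrightarrow>
    gelfand_sum n T \<le> (\<Sum>f\<in>F. Re (cinner (blinfun_apply T f) f)))"
proof -
  obtain g where g: "orthonormal UNIV g" "\<And>k. blinfun_apply T (g k) = complex_of_real (gelfand_number k T) *\<^sub>C g k"
    "\<And>k x. (\<And>i. i < k \<Longrightarrow> cinner x (g i) = 0) \<Longrightarrow> norm (blinfun_apply T x) \<le> gelfand_number k T * norm x"
    using positive_eigenvectors[OF pos lim inf] by blast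
  have "gelfand_sum n T \<le> (\<Sum>f\<in>F. Re (cinner (blinfun_apply T f) f))"
    if F: "finite F" "orthonormal F (\<lambda>x. x)" "g ` {..<n} \<subseteq> complex_vector.span F" for F
  proof -
    have b: "(\<Sum>f\<in>F. (cmod (cinner f (g k)))\<^sup>2) = 1" if "k < n" for k
    proof -
      have "expansion F (\<lambda>x. x) (g k) = g k"
        by (rule expansion_eq_self[OF F(1,2)]) (use F(3) that in auto)
      then have "(\<Sum>f\<in>F. (cmod (cinner (g k) f))\<^sup>2) = 1"
        using norm_diff_expansion_orthonormal[OF F(1,2), of "g k"] orthonormal_norm[OF g(1), of k] by simp
      moreover have "(\<Sum>f\<in>F. (cmod (cinner f (g k)))\<^sup>2) = (\<Sum>f\<in>F. (cmod (cinner (g k) f))\<^sup>2)"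
        by (rule sum.cong) (simp, metis cinner_commute complex_mod_cnj)
      ultimately show ?thesis by simp
    qed
    have "gelfand_sum n T = (\<Sum>k<n. gelfand_number k T * (\<Sum>f\<in>F. (cmod (cinner f (g k)))\<^sup>2))"
      by (simp add: gelfand_sum_def b)
    also have "\<dots> = (\<Sum>f\<in>F. \<Sum>k<n. gelfand_number k T * (cmod (cinner f (g k)))\<^sup>2)"
      unfolding sum_distrib_left by (rule sum.swap)
    also have "\<dots> \<le> (\<Sum>f\<in>F. Re (cinner (blinfun_apply T f) f))"
    proof (rule sum_mono)
      fix f
      show "(\<Sum>k<n. gelfand_number k T * (cmod (cinner f (g k)))\<^sup>2) \<le> Re (cinner (blinfun_apply T f) f)"
        unfolding quadratic_form_decomposition[OF pos g(1,2), of f n]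
        using positive_operator_Re[OF pos] by simp
    qed
    finally show ?thesis .
  qed
  moreover have "card (g ` {..<n}) \<le> n"
    using card_image_le[of "{..<n}" g] by simp
  ultimately show ?thesis
    by (intro exI[of _ "g ` {..<n}"]) auto
qed

text \<open>The first \<open>n\<close> eigenvectors of \<open>S\<close> and of \<open>T\<close> span a subspace of dimension at most
  \<open>2 * n\<close>.\<close>

theorem gelfand_sum_add_ge:
  fixes S T :: "'a::complex_hilbert \<Rightarrow>\<^sub>L 'a"
  assumes pos: "positive_operator S" "positive_operator T"
    and lim: "(\<lambda>n. gelfand_number n S) \<longlonglongrightarrow> 0" "(\<lambda>n. gelfand_number n T) \<longlonglongrightarrow> 0"
      "(\<lambda>n. gelfand_number n (S + T)) \<longlonglongrightarrow> 0"
    and add: "positive_operator (S + T)"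
    and inf: "infinite_dimensional TYPE('a)"
  shows "gelfand_sum n S + gelfand_sum n T \<le> gelfand_sum (2 * n) (S + T)"
proof -
  obtain V where V: "finite V" "card V \<le> n" "\<forall>F. finite F \<longrightarrow> orthonormal F (\<lambda>x. x) \<longrightarrow>
    V \<subseteq> complex_vector.span F \<longrightarrow> gelfand_sum n S \<le> (\<Sum>f\<in>F. Re (cinner (blinfun_apply S f) f))"
    using Ky_Fan_lower[OF pos(1) lim(1) inf, of n] by (elim exE conjE)
  obtain W where W: "finite W" "card W \<le> n" "\<forall>F. finite F \<longrightarrow> orthonormal F (\<lambda>x. x) \<longrightarrow>
    W \<subseteq> complex_vector.span F \<longrightarrow> gelfand_sum n T \<le> (\<Sum>f\<in>F. Re (cinner (blinfun_apply T f) f))"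
    using Ky_Fan_lower[OF pos(2) lim(2) inf, of n] by (elim exE conjE)
  obtain F where F: "finite F" "card F \<le> card (V \<union> W)" "orthonormal F (\<lambda>x. x)" "V \<union> W \<subseteq> complex_vector.span F"
    using finite_orthonormalization[of "V \<union> W"] V(1) W(1) by auto
  have "gelfand_sum n S + gelfand_sum n T \<le>
      (\<Sum>f\<in>F. Re (cinner (blinfun_apply S f) f)) + (\<Sum>f\<in>F. Re (cinner (blinfun_apply T f) f))"
    by (intro add_mono V(3)[rule_format] W(3)[rule_format]) (use F in auto)
  also have "\<dots> = (\<Sum>f\<in>F. Re (cinner (blinfun_apply (S + T) f) f))"
    by (simp add: blinfun.add_left cinner_add_left sum.distrib)
  also have "\<dots> \<le> gelfand_sum (card F) (S + T)"
    by (rule Ky_Fan_upper[OF add lim(3) inf F(1,3)])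
  also have "\<dots> \<le> gelfand_sum (2 * n) (S + T)"
    by (rule gelfand_sum_mono) (use F(2) V(2) W(2) card_Un_le[of V W] in linarith)
  finally show ?thesis .
qed

section \<open>Generalized limits\<close>

lemma borel_measurable_imp_lebesgue_on:
  "(f :: real \<Rightarrow> real) \<in> borel_measurable borel \<Longrightarrow> f \<in> borel_measurable (lebesgue_on {0<..})"
  by (intro measurable_restrict_space1 measurable_completion) simp

lemma Linfty_bounded:
  assumes "x \<in> borel_measurable (lebesgue_on {0<..})" "\<And>t. 0 < t \<Longrightarrow> \<bar>x t\<bar> \<le> C"
  shows "x \<in> Linfty"
  using assms by (auto simp: Linfty_def space_restrict_space intro!: exI[of _ C] AE_I2)

lemma Linfty_add: "x \<in> Linfty \<Longrightarrow> y \<in> Linfty \<Longrightarrow> (\<lambda>t. x t + y t) \<in> Linfty"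
proof -
  assume x: "x \<in> Linfty" and y: "y \<in> Linfty"
  then obtain C D where "AE t in lebesgue_on {0<..}. \<bar>x t\<bar> \<le> C" "AE t in lebesgue_on {0<..}. \<bar>y t\<bar> \<le> D"
    by (auto simp: Linfty_def)
  then have "AE t in lebesgue_on {0<..}. \<bar>x t + y t\<bar> \<le> C + D"
    by eventually_elim simp
  then show ?thesis
    using x y by (auto simp: Linfty_def)
qed

lemma Linfty_mult_left: "x \<in> Linfty \<Longrightarrow> (\<lambda>t. c * x t) \<in> Linfty"
proof -
  assume x: "x \<in> Linfty"
  then obtain C where "AE t in lebesgue_on {0<..}. \<bar>x t\<bar> \<le> C"
    by (auto simp: Linfty_def)
  then have "AE t in lebesgue_on {0<..}. \<bar>c * x t\<bar> \<le> \<bar>c\<bar> * C"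
    by eventually_elim (simp add: abs_mult mult_left_mono)
  then show ?thesis
    using x by (auto simp: Linfty_def)
qed

lemma Linfty_const: "(\<lambda>t. c) \<in> Linfty"
  by (rule Linfty_bounded[of _ "\<bar>c\<bar>"]) auto

lemma Linfty_diff: "x \<in> Linfty \<Longrightarrow> y \<in> Linfty \<Longrightarrow> (\<lambda>t. x t - y t) \<in> Linfty"
  using Linfty_add[OF _ Linfty_mult_left[of y "-1"], of x] by simp

lemma Linfty_max_0: "x \<in> Linfty \<Longrightarrow> (\<lambda>t. max 0 (x t)) \<in> Linfty"
proof -
  assume x: "x \<in> Linfty"
  then obtain C where "AE t in lebesgue_on {0<..}. \<bar>x t\<bar> \<le> C"
    by (auto simp: Linfty_def)
  then have "AE t in lebesgue_on {0<..}. \<bar>max 0 (x t)\<bar> \<le> C"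
    by eventually_elim (simp, arith)
  then show ?thesis
    using x by (auto simp: Linfty_def)
qed

lemma Linfty_sum: "finite I \<Longrightarrow> (\<And>i. i \<in> I \<Longrightarrow> x i \<in> Linfty) \<Longrightarrow> (\<lambda>t. \<Sum>i\<in>I. x i t) \<in> Linfty"
  by (induction I rule: finite_induct) (auto intro: Linfty_add Linfty_const)

lemma generalized_limit_add:
  "generalized_limit \<omega> \<Longrightarrow> x \<in> Linfty \<Longrightarrow> y \<in> Linfty \<Longrightarrow> \<omega> (\<lambda>t. x t + y t) = \<omega> x + \<omega> y"
  by (auto simp: generalized_limit_def)

lemma generalized_limit_mult:
  "generalized_limit \<omega> \<Longrightarrow> x \<in> Linfty \<Longrightarrow> \<omega> (\<lambda>t. c * x t) = c * \<omega> x"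
  by (auto simp: generalized_limit_def)

lemma generalized_limit_eq_limit:
  "generalized_limit \<omega> \<Longrightarrow> x \<in> Linfty \<Longrightarrow> (x \<longlongrightarrow> l) at_top \<Longrightarrow> \<omega> x = l"
  by (auto simp: generalized_limit_def)

lemma generalized_limit_nonneg:
  "generalized_limit \<omega> \<Longrightarrow> x \<in> Linfty \<Longrightarrow> AE t in lebesgue_on {0<..}. 0 \<le> x t \<Longrightarrow> 0 \<le> \<omega> x"
  unfolding generalized_limit_def by blast

lemma generalized_limit_diff:
  "generalized_limit \<omega> \<Longrightarrow> x \<in> Linfty \<Longrightarrow> y \<in> Linfty \<Longrightarrow> \<omega> (\<lambda>t. x t - y t) = \<omega> x - \<omega> y"
  using generalized_limit_add[OF _ _ Linfty_mult_left[of y "-1"], of \<omega> x] generalized_limit_mult[of \<omega> y "-1"]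
  by simp

lemma generalized_limit_sum:
  assumes "generalized_limit \<omega>" "finite I" "\<And>i. i \<in> I \<Longrightarrow> x i \<in> Linfty"
  shows "\<omega> (\<lambda>t. \<Sum>i\<in>I. x i t) = (\<Sum>i\<in>I. \<omega> (x i))"
  using assms(2,3)
proof (induction I rule: finite_induct)
  case empty
  show ?case
    using generalized_limit_eq_limit[OF assms(1) Linfty_const tendsto_const] by simp
next
  case (insert i I)
  then show ?case
    using generalized_limit_add[OF assms(1), of "x i" "\<lambda>t. \<Sum>i\<in>I. x i t"] Linfty_sum[of I x] by simp
qed

text \<open>A generalized limit is monotone with respect to asymptotic inequality.\<close>

lemma generalized_limit_mono:
  assumes \<omega>: "generalized_limit \<omega>" and x: "x \<in> Linfty" and y: "y \<in> Linfty"
    and le: "\<And>\<epsilon>. 0 < \<epsilon> \<Longrightarrow> \<forall>\<^sub>F t in at_top. x t \<le> y t + \<epsilon>"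
  shows "\<omega> x \<le> \<omega> y"
proof -
  define w where "w t = max 0 (x t - y t)" for t
  have w: "w \<in> Linfty"
    unfolding w_def using Linfty_max_0[OF Linfty_diff[OF x y]] by simp
  have "(w \<longlongrightarrow> 0) at_top"
  proof (rule tendstoI)
    fix e :: real assume "0 < e"
    with le[of "e / 2"] show "\<forall>\<^sub>F t in at_top. dist (w t) 0 < e"
      by (auto elim!: eventually_mono simp: w_def)
  qed
  then have w0: "\<omega> w = 0"
    by (rule generalized_limit_eq_limit[OF \<omega> w])
  have yw: "(\<lambda>t. y t + w t) \<in> Linfty"
    by (rule Linfty_add[OF y w])
  have "AE t in lebesgue_on {0<..}. 0 \<le> (y t + w t) - x t"
    by (rule AE_I2) (simp add: w_def max_def)
  then have "0 \<le> \<omega> (\<lambda>t. (y t + w t) - x t)"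
    by (rule generalized_limit_nonneg[OF \<omega> Linfty_diff[OF yw x]])
  then show ?thesis
    using generalized_limit_diff[OF \<omega> yw x] generalized_limit_add[OF \<omega> y w] w0 by simp
qed

lemma generalized_limit_cong:
  assumes "generalized_limit \<omega>" "x \<in> Linfty" "y \<in> Linfty" "((\<lambda>t. x t - y t) \<longlongrightarrow> 0) at_top"
  shows "\<omega> x = \<omega> y"
  using generalized_limit_diff[OF assms(1-3)]
    generalized_limit_eq_limit[OF assms(1) Linfty_diff[OF assms(2,3)] assms(4)] by simp


section \<open>The Dixmier ideal\<close>

text \<open>A Hilbert space as in the theorem; the parameter only carries the type.\<close>

locale infinite_separable_hilbert =
  fixes H :: "'a::complex_hilbert itself"
  assumes separable: "separable_space (euclidean :: 'a topology)"
    and infinite: "infinite_dimensional TYPE('a)"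
begin

text \<open>The numerator of \<^const>\<open>log_mean\<close>.\<close>

abbreviation sv_integral :: "('a \<Rightarrow>\<^sub>L 'a) \<Rightarrow> real \<Rightarrow> real" where
  "sv_integral T t \<equiv> integral {0..t} (\<lambda>s. singular_value s T)"

lemma singular_value_eq: "0 \<le> s \<Longrightarrow> singular_value s (T :: 'a \<Rightarrow>\<^sub>L 'a) = gelfand_number (nat \<lfloor>s\<rfloor>) T"
  by (rule singular_value_eq_gelfand_number[OF separable])

lemma singular_value_nonneg: "0 \<le> s \<Longrightarrow> 0 \<le> singular_value s (T :: 'a \<Rightarrow>\<^sub>L 'a)"
  by (simp add: singular_value_eq gelfand_number_nonneg)

lemma singular_value_integrable:
  assumes "0 \<le> a"
  shows "(\<lambda>s. singular_value s (T :: 'a \<Rightarrow>\<^sub>L 'a)) integrable_on {a..b}"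
proof -
  have "mono_on {a..b} (\<lambda>s. - singular_value s T)"
    by (rule mono_onI) (use assms in \<open>auto simp: singular_value_eq intro!: gelfand_number_antimono nat_mono floor_mono\<close>)
  then show ?thesis
    using integrable_on_mono_on integrable_neg by fastforce
qed

lemma sv_integral_mono: "0 \<le> a \<Longrightarrow> a \<le> b \<Longrightarrow> sv_integral T a \<le> sv_integral T b"
  by (rule integral_subset_le) (auto intro: singular_value_integrable singular_value_nonneg)

lemma sv_integral_nonneg: "0 \<le> sv_integral T t"
  by (rule integral_nonneg) (auto intro: singular_value_integrable singular_value_nonneg)

lemma sv_integral_of_nat: "sv_integral T (real n) = gelfand_sum n T"
proof (induction n)
  case 0
  show ?case by (simp add: gelfand_sum_def)
next
  case (Suc n)
  have "integral {real n..real (Suc n)} (\<lambda>s. singular_value s T) =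
      integral {real n..real (Suc n)} (\<lambda>s. gelfand_number n T)"
  proof (rule integral_spike[of "{real (Suc n)}"])
    fix s assume "s \<in> {real n..real (Suc n)} - {real (Suc n)}"
    then have "0 \<le> s" "\<lfloor>s\<rfloor> = int n" by (auto simp: floor_eq_iff)
    then show "gelfand_number n T = singular_value s T"
      by (simp add: singular_value_eq)
  qed simp
  also have "\<dots> = gelfand_number n T"
    by simp
  finally show ?case
    using Henstock_Kurzweil_Integration.integral_combine[of 0 "real n" "real (Suc n)" "\<lambda>s. singular_value s T"]
      Suc singular_value_integrable[of 0 T] by (simp add: gelfand_sum_Suc)
qed

lemma
  assumes "0 \<le> t"
  shows sv_integral_ge: "gelfand_sum (nat \<lfloor>t\<rfloor>) T \<le> sv_integral T t"
    and sv_integral_le: "sv_integral T t \<le> gelfand_sum (Suc (nat \<lfloor>t\<rfloor>)) T"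
proof -
  have "real (nat \<lfloor>t\<rfloor>) \<le> t" "t \<le> real (Suc (nat \<lfloor>t\<rfloor>))"
    using assms by linarith+
  then show "gelfand_sum (nat \<lfloor>t\<rfloor>) T \<le> sv_integral T t" "sv_integral T t \<le> gelfand_sum (Suc (nat \<lfloor>t\<rfloor>)) T"
    using sv_integral_mono[of "real (nat \<lfloor>t\<rfloor>)" t T] sv_integral_mono[of t "real (Suc (nat \<lfloor>t\<rfloor>))" T] assms
    by (simp_all only: sv_integral_of_nat of_nat_0_le_iff)
qed

lemma log_mean_eq: "log_mean T t = sv_integral T t / ln (1 + t)"
  by (simp add: log_mean_def)

lemma log_mean_nonneg: "0 < t \<Longrightarrow> 0 \<le> log_mean (T :: 'a \<Rightarrow>\<^sub>L 'a) t"
  by (simp add: log_mean_eq sv_integral_nonneg)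

text \<open>Membership in the ideal in terms of the partial sums of the singular values. Near zero the
  logarithmic mean is bounded because it behaves like the constant \<open>gelfand_number 0 T\<close>.\<close>

lemma dixmier_ideal_iff:
  "(T :: 'a \<Rightarrow>\<^sub>L 'a) \<in> dixmier_ideal \<longleftrightarrow>
     T \<in> bounded_operators \<and> (\<exists>C. \<forall>n. gelfand_sum n T \<le> C * ln (1 + real n))"
proof (intro iffI conjI)
  assume "T \<in> dixmier_ideal"
  then show "T \<in> bounded_operators" by (simp add: dixmier_ideal_def)
  from \<open>T \<in> dixmier_ideal\<close> obtain C where C: "\<And>t. 0 < t \<Longrightarrow> log_mean T t \<le> C"
    by (auto simp: dixmier_ideal_def bdd_above_def)
  have "gelfand_sum n T \<le> C * ln (1 + real n)" for n
  proof (cases "n = 0")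
    case False
    then show ?thesis
      using C[of "real n"] by (simp add: log_mean_eq sv_integral_of_nat divide_le_eq)
  qed (simp add: gelfand_sum_def)
  then show "\<exists>C. \<forall>n. gelfand_sum n T \<le> C * ln (1 + real n)" by blast
next
  assume "T \<in> bounded_operators \<and> (\<exists>C. \<forall>n. gelfand_sum n T \<le> C * ln (1 + real n))"
  then obtain C where T: "T \<in> bounded_operators" and C: "\<And>n. gelfand_sum n T \<le> C * ln (1 + real n)"
    by blast
  have "0 \<le> C * ln (1 + real 1)"
    using C[of 1] gelfand_sum_nonneg[of 1 T] by linarith
  then have C0: "0 \<le> C" by (simp add: zero_le_mult_iff)
  have "log_mean T t \<le> 2 * C" if "0 < t" for t
  proof -
    have ln_pos: "0 < ln (1 + t)" using that by simp
    have "sv_integral T t \<le> 2 * C * ln (1 + t)"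
    proof (cases "t < 1")
      case True
      have "sv_integral T t \<le> integral {0..t} (\<lambda>s. gelfand_number 0 T)"
        by (rule integral_le)
          (auto intro: singular_value_integrable simp: singular_value_eq gelfand_number_antimono)
      also have "\<dots> = t * gelfand_number 0 T"
        using that by simp
      also have "\<dots> \<le> t * C"
      proof -
        have "C * ln 2 \<le> C * 1"
          using C0 ln_2_less_1 by (intro mult_left_mono) auto
        then have "gelfand_number 0 T \<le> C"
          using C[of 1] by (simp add: gelfand_sum_def)
        then show ?thesis
          using that by (intro mult_left_mono) auto
      qed
      also have "\<dots> \<le> (2 * ln (1 + t)) * C"
      proof (rule mult_right_mono[OF _ C0])
        have "t / 2 \<le> t / (1 + t)"
          using that True by (intro divide_left_mono) auto
        also have "\<dots> \<le> ln (1 + t)"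
          using ln_ge_iff[of "1 + t"] that ln_le_minus_one[of "1 / (1 + t)"]
          by (simp add: ln_div field_simps)
        finally show "t \<le> 2 * ln (1 + t)" by simp
      qed
      finally show ?thesis by (simp add: mult_ac)
    next
      case False
      have "sv_integral T t \<le> C * ln (1 + real (Suc (nat \<lfloor>t\<rfloor>)))"
        using sv_integral_le[of t T] C[of "Suc (nat \<lfloor>t\<rfloor>)"] that by simp
      also have "\<dots> \<le> C * (2 * ln (1 + t))"
      proof (rule mult_left_mono[OF _ C0])
        have "real (Suc (nat \<lfloor>t\<rfloor>)) \<le> 1 + t"
          using that by linarith
        moreover have "t * 1 \<le> t * t"
          using False by (intro mult_left_mono) auto
        ultimately have "1 + real (Suc (nat \<lfloor>t\<rfloor>)) \<le> (1 + t)\<^sup>2"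
          using False unfolding power2_eq_square ring_distribs by linarith
        then have "ln (1 + real (Suc (nat \<lfloor>t\<rfloor>))) \<le> ln ((1 + t)\<^sup>2)"
          by (intro ln_mono) (auto simp: add_pos_nonneg)
        also have "\<dots> = 2 * ln (1 + t)"
          using that by (simp add: ln_realpow)
        finally show "ln (1 + real (Suc (nat \<lfloor>t\<rfloor>))) \<le> 2 * ln (1 + t)" .
      qed
      finally show ?thesis by (simp add: mult_ac)
    qed
    then show ?thesis
      using ln_pos by (simp add: log_mean_eq divide_le_eq)
  qed
  then have "bdd_above (log_mean T ` {0<..})"
    by (intro bdd_aboveI[of _ "2 * C"]) auto
  then show "T \<in> dixmier_ideal"
    using T by (simp add: dixmier_ideal_def)
qed

lemma dixmier_ideal_bounded_operators: "T \<in> dixmier_ideal \<Longrightarrow> T \<in> bounded_operators"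
  by (simp add: dixmier_ideal_def)

lemma log_mean_bounded:
  assumes "(T :: 'a \<Rightarrow>\<^sub>L 'a) \<in> dixmier_ideal"
  shows "\<exists>C\<ge>0. \<forall>t>0. log_mean T t \<le> C"
proof -
  from assms obtain C where C: "\<And>t. 0 < t \<Longrightarrow> log_mean T t \<le> C"
    by (auto simp: dixmier_ideal_def bdd_above_def)
  moreover have "0 \<le> C"
    using C[of 1] log_mean_nonneg[of 1 T] by simp
  ultimately show ?thesis by blast
qed

lemma gelfand_number_tendsto_0:
  assumes "(T :: 'a \<Rightarrow>\<^sub>L 'a) \<in> dixmier_ideal"
  shows "(\<lambda>n. gelfand_number n T) \<longlonglongrightarrow> 0"
proof -
  from assms obtain C where C: "\<And>n. gelfand_sum n T \<le> C * ln (1 + real n)"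
    by (auto simp: dixmier_ideal_iff)
  have "gelfand_number n T \<le> C * ln (1 + real n) / real n" if "n > 0" for n
  proof -
    have "real n * gelfand_number n T = (\<Sum>k<n. gelfand_number n T)" by simp
    also have "\<dots> \<le> gelfand_sum n T"
      unfolding gelfand_sum_def by (rule sum_mono) (simp add: gelfand_number_antimono)
    finally show ?thesis
      using C[of n] that by (simp add: le_divide_eq mult.commute)
  qed
  then have "\<forall>\<^sub>F n in sequentially. gelfand_number n T \<le> C * ln (1 + real n) / real n"
    by (intro eventually_sequentiallyI[of 1]) auto
  moreover have "(\<lambda>n. C * ln (1 + real n) / real n) \<longlonglongrightarrow> 0"
    by real_asymp
  ultimately show ?thesis
    by (rule tendsto_sandwich[OF always_eventually[OF allI[OF gelfand_number_nonneg]] _ tendsto_const])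
qed

lemma dixmier_ideal_add:
  assumes "(S :: 'a \<Rightarrow>\<^sub>L 'a) \<in> dixmier_ideal" "T \<in> dixmier_ideal"
  shows "S + T \<in> dixmier_ideal"
proof -
  from assms obtain C D where C: "\<And>n. gelfand_sum n S \<le> C * ln (1 + real n)"
    and D: "\<And>n. gelfand_sum n T \<le> D * ln (1 + real n)"
    by (auto simp: dixmier_ideal_iff)
  have double: "(\<Sum>k<2 * n. a (k div 2)) = 2 * (\<Sum>k<n. a k)" for a :: "nat \<Rightarrow> real" and n
    by (induction n) auto
  have "gelfand_sum n (S + T) \<le> (2 * C + 2 * D) * ln (1 + real n)" for n
  proof -
    have "gelfand_sum n (S + T) \<le> (\<Sum>k<n. gelfand_number (k div 2) S + gelfand_number (k div 2) T)"
      unfolding gelfand_sum_def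
    proof (rule sum_mono)
      fix k
      have "gelfand_number k (S + T) \<le> gelfand_number (k div 2 + k div 2) (S + T)"
        by (rule gelfand_number_antimono) simp
      also have "\<dots> \<le> gelfand_number (k div 2) S + gelfand_number (k div 2) T"
        by (rule gelfand_number_add)
      finally show "gelfand_number k (S + T) \<le> gelfand_number (k div 2) S + gelfand_number (k div 2) T" .
    qed
    also have "\<dots> \<le> (\<Sum>k<2 * n. gelfand_number (k div 2) S + gelfand_number (k div 2) T)"
      by (rule sum_mono2) (auto simp: gelfand_number_nonneg)
    also have "\<dots> = 2 * gelfand_sum n S + 2 * gelfand_sum n T"
      using double[of "\<lambda>k. gelfand_number k S" n] double[of "\<lambda>k. gelfand_number k T" n]
      by (simp add: sum.distrib gelfand_sum_def)
    finally show ?thesis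
      using C[of n] D[of n] by (simp add: algebra_simps)
  qed
  then show ?thesis
    using assms by (auto simp: dixmier_ideal_iff bounded_operators_def blinfun.add_left scaleC_add_right)
qed

lemma gelfand_sum_scaleC: "gelfand_sum n (op_scaleC c T) = cmod c * gelfand_sum n T"
  by (simp add: gelfand_sum_def gelfand_number_scaleC sum_distrib_left)

lemma dixmier_ideal_scaleC:
  assumes "(T :: 'a \<Rightarrow>\<^sub>L 'a) \<in> dixmier_ideal"
  shows "op_scaleC c T \<in> dixmier_ideal"
proof -
  from assms obtain C where "\<And>n. gelfand_sum n T \<le> C * ln (1 + real n)"
    by (auto simp: dixmier_ideal_iff)
  then have "gelfand_sum n (op_scaleC c T) \<le> (cmod c * C) * ln (1 + real n)" for n
    by (simp add: gelfand_sum_scaleC mult.assoc mult_left_mono)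
  then show ?thesis
    using assms by (auto simp: dixmier_ideal_iff bounded_operators_def op_scaleC_apply scaleC_scaleC mult.commute)
qed

lemma log_mean_scaleC:
  assumes "0 \<le> r" "0 < t"
  shows "log_mean (op_scaleC (complex_of_real r) T) t = r * log_mean (T :: 'a \<Rightarrow>\<^sub>L 'a) t"
proof -
  have "sv_integral (op_scaleC (complex_of_real r) T) t = integral {0..t} (\<lambda>s. r * singular_value s T)"
    by (rule integral_cong) (use assms in \<open>simp add: singular_value_eq gelfand_number_scaleC\<close>)
  then show ?thesis by (simp add: log_mean_eq)
qed

lemma log_mean_dilation_Linfty:
  assumes "(T :: 'a \<Rightarrow>\<^sub>L 'a) \<in> dixmier_ideal" "0 < \<beta>"
  shows "(\<lambda>t. log_mean T (\<beta> * t)) \<in> Linfty"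
proof -
  define f where "f t = sv_integral T (max 0 (\<beta> * t)) / ln (1 + \<beta> * t)" for t
  have "mono (\<lambda>t. sv_integral T (max 0 (\<beta> * t)))"
    by (intro monoI sv_integral_mono max.mono mult_left_mono) (use assms(2) in auto)
  then have "(\<lambda>t. sv_integral T (max 0 (\<beta> * t))) \<in> borel_measurable borel"
    by (rule borel_measurable_mono)
  then have "f \<in> borel_measurable borel"
    unfolding f_def by measurable
  then have "f \<in> borel_measurable (lebesgue_on {0<..})"
    by (rule borel_measurable_imp_lebesgue_on)
  then have "(\<lambda>t. log_mean T (\<beta> * t)) \<in> borel_measurable (lebesgue_on {0<..})"
    by (rule measurable_cong[THEN iffD1, rotated])
      (use assms(2) in \<open>auto simp: space_restrict_space f_def log_mean_eq max_def\<close>)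
  moreover obtain C where "\<And>t. 0 < t \<Longrightarrow> log_mean T t \<le> C"
    using log_mean_bounded[OF assms(1)] by blast
  then have "\<bar>log_mean T (\<beta> * t)\<bar> \<le> C" if "0 < t" for t
    using that assms(2) log_mean_nonneg[of "\<beta> * t" T] by simp
  ultimately show ?thesis
    by (rule Linfty_bounded)
qed

lemma log_mean_Linfty: "(T :: 'a \<Rightarrow>\<^sub>L 'a) \<in> dixmier_ideal \<Longrightarrow> log_mean T \<in> Linfty"
  using log_mean_dilation_Linfty[of T 1] by simp


section \<open>Additivity of the trace on the positive cone\<close>

text \<open>The positive operators in the ideal.\<close>

definition positive_cone :: "('a \<Rightarrow>\<^sub>L 'a) set" where
  "positive_cone = {T \<in> dixmier_ideal. positive_operator T}"

lemma positive_operator_add: "positive_operator S \<Longrightarrow> positive_operator T \<Longrightarrow> positive_operator (S + T)"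
  by (simp add: positive_operator_def bounded_operators_def blinfun.add_left scaleC_add_right
      cinner_add_left nonneg_Reals_add_I)

lemma positive_operator_scaleC: "positive_operator T \<Longrightarrow> 0 \<le> r \<Longrightarrow> positive_operator (op_scaleC (complex_of_real r) T)"
  by (simp add: positive_operator_def bounded_operators_def op_scaleC_apply scaleC_scaleC mult.commute
      cinner_scaleC_left nonneg_Reals_mult_I)

lemma positive_cone_add: "S \<in> positive_cone \<Longrightarrow> T \<in> positive_cone \<Longrightarrow> S + T \<in> positive_cone"
  by (simp add: positive_cone_def dixmier_ideal_add positive_operator_add)

lemma positive_cone_scaleC: "T \<in> positive_cone \<Longrightarrow> 0 \<le> r \<Longrightarrow> op_scaleC (complex_of_real r) T \<in> positive_cone"
  by (simp add: positive_cone_def dixmier_ideal_scaleC positive_operator_scaleC)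

text \<open>Ky Fan's inequalities for the integrals; the constant accounts for rounding \<open>t\<close> to an integer.\<close>

lemma sv_integral_add:
  assumes S: "S \<in> positive_cone" and T: "T \<in> positive_cone" and t: "0 \<le> t"
  defines "c \<equiv> gelfand_number 0 S + gelfand_number 0 T + 2 * gelfand_number 0 (S + T)"
  shows "sv_integral (S + T) t \<le> sv_integral S t + sv_integral T t + c"
    and "sv_integral S t + sv_integral T t \<le> sv_integral (S + T) (2 * t) + c"
proof -
  note pos = S T positive_cone_add[OF S T]
  have pos': "positive_operator S" "positive_operator T" "positive_operator (S + T)"
    and lim: "(\<lambda>n. gelfand_number n S) \<longlonglongrightarrow> 0" "(\<lambda>n. gelfand_number n T) \<longlonglongrightarrow> 0"
      "(\<lambda>n. gelfand_number n (S + T)) \<longlonglongrightarrow> 0"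
    using pos gelfand_number_tendsto_0 by (auto simp: positive_cone_def)
  define n where "n = nat \<lfloor>t\<rfloor>"
  have Suc_le: "gelfand_sum (Suc n) A \<le> gelfand_sum n A + gelfand_number 0 A" for A :: "'a \<Rightarrow>\<^sub>L 'a" and n
    by (simp add: gelfand_sum_Suc gelfand_number_antimono)
  note bounds = sv_integral_ge[OF t, folded n_def] sv_integral_le[OF t, folded n_def]
  have nn: "0 \<le> gelfand_number 0 A" for A :: "'a \<Rightarrow>\<^sub>L 'a"
    by (rule gelfand_number_nonneg)
  have "sv_integral (S + T) t \<le> gelfand_sum (Suc n) S + gelfand_sum (Suc n) T"
    using bounds(2)[of "S + T"] gelfand_sum_add_le[OF pos'(1,2) lim pos'(3) infinite, of "Suc n"] by simp
  then show "sv_integral (S + T) t \<le> sv_integral S t + sv_integral T t + c"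
    using Suc_le[of n S] Suc_le[of n T] bounds(1)[of S] bounds(1)[of T] nn[of "S + T"] by (simp add: c_def)
  have "2 * n \<le> nat \<lfloor>2 * t\<rfloor>"
    unfolding n_def using t by linarith
  then have "gelfand_sum (2 * n) (S + T) \<le> sv_integral (S + T) (2 * t)"
    using gelfand_sum_mono[of "2 * n" "nat \<lfloor>2 * t\<rfloor>" "S + T"] sv_integral_ge[of "2 * t" "S + T"] t by simp
  moreover have "gelfand_sum (2 * Suc n) (S + T) \<le> gelfand_sum (2 * n) (S + T) + 2 * gelfand_number 0 (S + T)"
    using Suc_le[of "2 * n" "S + T"] Suc_le[of "Suc (2 * n)" "S + T"] by simp
  ultimately show "sv_integral S t + sv_integral T t \<le> sv_integral (S + T) (2 * t) + c"
    using bounds(2)[of S] bounds(2)[of T] gelfand_sum_add_ge[OF pos'(1,2) lim pos'(3) infinite, of "Suc n"]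
      nn[of S] nn[of T] by (simp add: c_def)
qed

text \<open>Subadditivity holds for every generalized limit. Superadditivity needs dilation invariance,
  because only \<open>F\<^sub>S t + F\<^sub>T t \<le> F\<^sub>S\<^sub>+\<^sub>T (2 * t) + c\<close> is available for the integrals \<open>F\<close> of the singular
  values.\<close>

theorem log_mean_additive:
  assumes \<omega>: "generalized_limit \<omega>" "dilation_invariant \<omega>"
    and S: "S \<in> positive_cone" and T: "T \<in> positive_cone"
  shows "\<omega> (log_mean (S + T)) = \<omega> (log_mean S) + \<omega> (log_mean T)"
proof -
  have Lin: "log_mean S \<in> Linfty" "log_mean T \<in> Linfty" "log_mean (S + T) \<in> Linfty"
    using S T positive_cone_add[OF S T] log_mean_Linfty by (auto simp: positive_cone_def)
  define c where "c = gelfand_number 0 S + gelfand_number 0 T + 2 * gelfand_number 0 (S + T)"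
  obtain C where C: "0 \<le> C" "\<And>t. 0 < t \<Longrightarrow> log_mean (S + T) t \<le> C"
    using log_mean_bounded positive_cone_add[OF S T] by (auto simp: positive_cone_def)
  have ST: "(\<lambda>t. log_mean S t + log_mean T t) \<in> Linfty"
    by (rule Linfty_add[OF Lin(1,2)])
  have "\<omega> (log_mean (S + T)) \<le> \<omega> (\<lambda>t. log_mean S t + log_mean T t)"
  proof (rule generalized_limit_mono[OF \<omega>(1) Lin(3) ST])
    fix \<epsilon> :: real assume "0 < \<epsilon>"
    have "((\<lambda>t. c / ln (1 + t)) \<longlongrightarrow> 0) at_top" by real_asymp
    from order_tendstoD(2)[OF this \<open>0 < \<epsilon>\<close>] eventually_gt_at_top[of 0]
    show "\<forall>\<^sub>F t in at_top. log_mean (S + T) t \<le> log_mean S t + log_mean T t + \<epsilon>"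
    proof eventually_elim
      case (elim t)
      have "log_mean (S + T) t \<le> (sv_integral S t + sv_integral T t + c) / ln (1 + t)"
        unfolding log_mean_eq using elim(2) sv_integral_add(1)[OF S T, of t, folded c_def]
        by (intro divide_right_mono) auto
      then show ?case
        using elim(1) by (simp add: log_mean_eq add_divide_distrib)
    qed
  qed
  moreover have "\<omega> (\<lambda>t. log_mean S t + log_mean T t) \<le> \<omega> (\<lambda>t. log_mean (S + T) (2 * t))"
  proof (rule generalized_limit_mono[OF \<omega>(1) ST])
    show "(\<lambda>t. log_mean (S + T) (2 * t)) \<in> Linfty"
      using positive_cone_add[OF S T] by (intro log_mean_dilation_Linfty) (auto simp: positive_cone_def)
    fix \<epsilon> :: real assume "0 < \<epsilon>"
    have "((\<lambda>t. C * (ln (1 + 2 * t) / ln (1 + t) - 1) + c / ln (1 + t)) \<longlongrightarrow> 0) at_top" by real_asymp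
    from order_tendstoD(2)[OF this \<open>0 < \<epsilon>\<close>] eventually_gt_at_top[of 0]
    show "\<forall>\<^sub>F t in at_top. log_mean S t + log_mean T t \<le> log_mean (S + T) (2 * t) + \<epsilon>"
    proof eventually_elim
      case (elim t)
      define q where "q = ln (1 + 2 * t) / ln (1 + t)"
      have q: "q \<ge> 1"
        using elim(2) by (simp add: q_def)
      have "log_mean S t + log_mean T t \<le> (sv_integral (S + T) (2 * t) + c) / ln (1 + t)"
        unfolding log_mean_eq add_divide_distrib[symmetric]
        using elim(2) sv_integral_add(2)[OF S T, of t, folded c_def]
        by (intro divide_right_mono) auto
      also have "\<dots> = log_mean (S + T) (2 * t) * q + c / ln (1 + t)"
        using elim(2) by (simp add: log_mean_eq q_def add_divide_distrib)
      also have "\<dots> = log_mean (S + T) (2 * t) + log_mean (S + T) (2 * t) * (q - 1) + c / ln (1 + t)"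
        by (simp add: algebra_simps)
      also have "log_mean (S + T) (2 * t) * (q - 1) \<le> C * (q - 1)"
        using C(2)[of "2 * t"] q elim(2) by (intro mult_right_mono) auto
      finally show ?case
        using elim(1) by (simp add: q_def)
    qed
  qed
  moreover have "\<omega> (\<lambda>t. log_mean (S + T) (2 * t)) = \<omega> (log_mean (S + T))"
    using \<omega>(2) Lin(3) by (simp add: dilation_invariant_def)
  ultimately show ?thesis
    using generalized_limit_add[OF \<omega>(1) Lin(1,2)] by simp
qed

lemma generalized_limit_log_mean_scaleC:
  assumes "generalized_limit \<omega>" "T \<in> positive_cone" "0 \<le> r"
  shows "\<omega> (log_mean (op_scaleC (complex_of_real r) T)) = r * \<omega> (log_mean T)"
proof -
  have "log_mean T \<in> Linfty" "log_mean (op_scaleC (complex_of_real r) T) \<in> Linfty"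
    using assms(2) dixmier_ideal_scaleC log_mean_Linfty by (auto simp: positive_cone_def)
  moreover have "\<forall>\<^sub>F t in at_top. log_mean (op_scaleC (complex_of_real r) T) t - r * log_mean T t = 0"
    using eventually_gt_at_top[of 0] by eventually_elim (simp add: log_mean_scaleC assms(3))
  ultimately have "\<omega> (log_mean (op_scaleC (complex_of_real r) T)) = \<omega> (\<lambda>t. r * log_mean T t)"
    by (intro generalized_limit_cong[OF assms(1)] Linfty_mult_left tendsto_eventually)
  then show ?thesis
    using generalized_limit_mult[OF assms(1) \<open>log_mean T \<in> Linfty\<close>] by simp
qed


section \<open>The linear extension\<close>

text \<open>A representation \<open>T = A - B + \<i> (C - D)\<close> with positive operators from the ideal.\<close>

definition positive_decomposition :: "('a \<Rightarrow>\<^sub>L 'a) \<Rightarrow> ('a \<Rightarrow>\<^sub>L 'a) \<Rightarrow> ('a \<Rightarrow>\<^sub>L 'a) \<Rightarrow> ('a \<Rightarrow>\<^sub>L 'a) \<Rightarrow> ('a \<Rightarrow>\<^sub>L 'a) \<Rightarrow> bool" where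
  "positive_decomposition T A B C D \<longleftrightarrow>
     A \<in> positive_cone \<and> B \<in> positive_cone \<and> C \<in> positive_cone \<and> D \<in> positive_cone \<and>
     T + (B + op_scaleC \<i> D) = A + op_scaleC \<i> C"

lemma op_scaleC_add_right: "op_scaleC c (S + T) = op_scaleC c S + op_scaleC c T"
  by (rule blinfun_eqI) (simp add: op_scaleC_apply blinfun.add_left scaleC_add_right)

lemma op_scaleC_add_left: "op_scaleC (c + d) T = op_scaleC c T + op_scaleC d T"
  by (rule blinfun_eqI) (simp add: op_scaleC_apply blinfun.add_left scaleC_add_left)

lemma series_operator_dixmier_ideal:
  assumes "schmidt_series s v (w :: nat \<Rightarrow> 'a)" "\<And>n. (\<Sum>k<n. s k) \<le> C * ln (1 + real n)"
  shows "schmidt_series.series_operator s v w \<in> dixmier_ideal"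
proof -
  interpret schmidt_series s v w by fact
  have "gelfand_sum n series_operator \<le> C * ln (1 + real n)" for n
    unfolding gelfand_sum_def
    using sum_mono[of "{..<n}" "\<lambda>k. gelfand_number k series_operator" s] gelfand_number_series_le assms(2)[of n]
    by (meson order_trans)
  then show ?thesis
    using series_operator_bounded by (auto simp: dixmier_ideal_iff)
qed

text \<open>With the Schmidt series \<open>T = \<Sum>k. s k * \<langle>\<cdot>, g k\<rangle> e k\<close>, the four operators are the polarized series
  for \<open>\<zeta> = 1, - 1, \<i>, - \<i>\<close>.\<close>

theorem exists_positive_decomposition:
  assumes T: "T \<in> dixmier_ideal"
  shows "\<exists>A B C D. positive_decomposition T A B C D"
proof -
  from T obtain K where K: "\<And>n. (\<Sum>k<n. gelfand_number k T) \<le> K * ln (1 + real n)"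
    by (auto simp: dixmier_ideal_iff gelfand_sum_def)
  define s where "s k = gelfand_number k T" for k
  from Schmidt_decomposition[OF dixmier_ideal_bounded_operators[OF T] gelfand_number_tendsto_0[OF T] infinite]
  obtain g e :: "nat \<Rightarrow> 'a" where g: "suborthonormal UNIV g" and e: "suborthonormal UNIV e"
    and T_eq: "T = schmidt_series.series_operator s g e"
    unfolding s_def by blast
  have series: "schmidt_series s v w" if "suborthonormal UNIV v" "suborthonormal UNIV w" for v w :: "nat \<Rightarrow> 'a"
    by unfold_locales (use that in \<open>auto simp: s_def gelfand_number_nonneg gelfand_number_antimono\<close>)
  define EE GG EG where "EE = schmidt_series.series_operator s e e"
    and "GG = schmidt_series.series_operator s g g" and "EG = schmidt_series.series_operator s e g"
  have mem: "EE \<in> dixmier_ideal" "GG \<in> dixmier_ideal" "EG \<in> dixmier_ideal"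
    unfolding EE_def GG_def EG_def
    using g e K by (auto intro!: series_operator_dixmier_ideal series simp: s_def)
  define B where "B \<zeta> = op_scaleC (1 / 4) (EE + GG + (op_scaleC \<zeta> EG + op_scaleC (cnj \<zeta>) T))" for \<zeta>
  have B: "B \<zeta> \<in> positive_cone" if "cmod \<zeta> = 1" for \<zeta>
  proof -
    have "B \<zeta> \<in> dixmier_ideal"
      unfolding B_def using mem T by (intro dixmier_ideal_add dixmier_ideal_scaleC)
    moreover have "positive_operator (B \<zeta>)"
      using positive_polarized_series[OF series[OF g e] that]
      by (simp only: B_def EE_def GG_def EG_def T_eq[symmetric])
    ultimately show ?thesis by (simp add: positive_cone_def)
  qed
  have "T + (B (- 1) + op_scaleC \<i> (B (- \<i>))) = B 1 + op_scaleC \<i> (B \<i>)"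
  proof (rule blinfun_eqI, rule cinner_ext)
    fix x z
    show "cinner (blinfun_apply (T + (B (- 1) + op_scaleC \<i> (B (- \<i>)))) x) z =
        cinner (blinfun_apply (B 1 + op_scaleC \<i> (B \<i>)) x) z"
      by (simp add: B_def blinfun.add_left op_scaleC_apply cinner_add_left cinner_diff_left cinner_minus_left
          cinner_scaleC_left algebra_simps)
  qed
  then have "positive_decomposition T (B 1) (B (- 1)) (B \<i>) (B (- \<i>))"
    unfolding positive_decomposition_def by (simp add: B)
  then show ?thesis by blast
qed

text \<open>The real and imaginary parts of a decomposition are unique.\<close>

lemma positive_decomposition_unique:
  assumes 1: "positive_decomposition T A B C D" and 2: "positive_decomposition T A' B' C' D'"
  shows "A + B' = A' + B" "C + D' = C' + D"
proof -
  have pos: "positive_operator A" "positive_operator B" "positive_operator C" "positive_operator D"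
    "positive_operator A'" "positive_operator B'" "positive_operator C'" "positive_operator D'"
    using 1 2 by (auto simp: positive_decomposition_def positive_cone_def)
  define X where "X = (A + B') - (A' + B)"
  define Y where "Y = (C + D') - (C' + D)"
  have "T = A + op_scaleC \<i> C - (B + op_scaleC \<i> D)" "T = A' + op_scaleC \<i> C' - (B' + op_scaleC \<i> D')"
    using 1 2 unfolding positive_decomposition_def by (auto simp: algebra_simps)
  then have "A + op_scaleC \<i> C - (B + op_scaleC \<i> D) = A' + op_scaleC \<i> C' - (B' + op_scaleC \<i> D')"
    by simp
  then have eq: "cinner (blinfun_apply X x) y + \<i> * cinner (blinfun_apply Y x) y = 0" for x y
    using arg_cong[of _ _ "\<lambda>T. cinner (blinfun_apply T x) y"]
    by (fastforce simp: X_def Y_def blinfun.add_left blinfun.diff_left op_scaleC_apply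
        cinner_add_left cinner_diff_left cinner_scaleC_left algebra_simps)
  have im: "Im (cinner (blinfun_apply P x) x) = 0" if "positive_operator P" for P x
    using that by (auto simp: positive_operator_def complex_nonneg_Reals_iff)
  have diag: "cinner (blinfun_apply X x) x = 0" "cinner (blinfun_apply Y x) x = 0" for x
  proof -
    have "Im (cinner (blinfun_apply X x) x) = 0" "Im (cinner (blinfun_apply Y x) x) = 0"
      by (simp_all add: X_def Y_def blinfun.add_left blinfun.diff_left cinner_add_left cinner_diff_left im pos)
    then show "cinner (blinfun_apply X x) x = 0" "cinner (blinfun_apply Y x) x = 0"
      using eq[of x x] by (auto simp: complex_eq_iff)
  qed
  have zero: "Z = 0" if "Z \<in> bounded_operators" "\<And>x. cinner (blinfun_apply Z x) x = 0" for Z :: "'a \<Rightarrow>\<^sub>L 'a"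
  proof (rule blinfun_eqI, rule cinner_ext)
    fix x y
    show "cinner (blinfun_apply Z x) y = cinner (blinfun_apply 0 x) y"
      using sesquilinear_eq_0[of "\<lambda>x y. cinner (blinfun_apply Z x) y" x y] that
      by (simp add: blinfun.add_right cinner_add_left cinner_add_right cinner_scaleC_left
          cinner_scaleC_right bounded_operators_scaleC)
  qed
  have "X \<in> bounded_operators" "Y \<in> bounded_operators"
    using pos by (simp_all add: X_def Y_def positive_operator_def bounded_operators_def blinfun.add_left
        blinfun.diff_left scaleC_add_right complex_vector.scale_right_diff_distrib)
  then have "X = 0" "Y = 0"
    using zero diag by blast+
  then show "A + B' = A' + B" "C + D' = C' + D"
    by (simp_all add: X_def Y_def)
qed

lemma positive_decomposition_add:
  assumes "positive_decomposition S A B C D" "positive_decomposition T A' B' C' D'"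
  shows "positive_decomposition (S + T) (A + A') (B + B') (C + C') (D + D')"
proof -
  have "(S + (B + op_scaleC \<i> D)) + (T + (B' + op_scaleC \<i> D')) = (A + op_scaleC \<i> C) + (A' + op_scaleC \<i> C')"
    using assms by (simp add: positive_decomposition_def)
  then show ?thesis
    using assms by (simp add: positive_decomposition_def positive_cone_add op_scaleC_add_right add_ac)
qed

lemma positive_decomposition_scale:
  assumes "positive_decomposition T A B C D" "0 \<le> r"
  defines "m \<equiv> op_scaleC (complex_of_real r)"
  shows "positive_decomposition (m T) (m A) (m B) (m C) (m D)"
proof -
  have "m (T + (B + op_scaleC \<i> D)) = m (A + op_scaleC \<i> C)"
    using assms by (simp add: positive_decomposition_def)
  then show ?thesis
    using assms(1,2) unfolding m_def
    by (simp add: positive_decomposition_def positive_cone_scaleC op_scaleC_add_right op_scaleC_op_scaleC mult.commute)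
qed

lemma positive_decomposition_minus:
  assumes "positive_decomposition T A B C D"
  shows "positive_decomposition (op_scaleC (- 1) T) B A D C"
proof -
  have "op_scaleC (- 1) T = - T"
    by (rule blinfun_eqI) (simp add: op_scaleC_apply blinfun.minus_left)
  then show ?thesis
    using assms by (simp add: positive_decomposition_def algebra_simps)
qed

lemma positive_decomposition_ii:
  assumes "positive_decomposition T A B C D"
  shows "positive_decomposition (op_scaleC \<i> T) D C A B"
proof -
  have "op_scaleC \<i> (T + (B + op_scaleC \<i> D)) = op_scaleC \<i> (A + op_scaleC \<i> C)"
    using assms by (simp add: positive_decomposition_def)
  moreover have "op_scaleC (- 1) Z = - Z" for Z :: "'a \<Rightarrow>\<^sub>L 'a"
    by (rule blinfun_eqI) (simp add: op_scaleC_apply blinfun.minus_left)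
  ultimately have "op_scaleC \<i> T + (op_scaleC \<i> B - D) = op_scaleC \<i> A - C"
    by (simp add: op_scaleC_add_right op_scaleC_op_scaleC)
  then show ?thesis
    using assms by (simp add: positive_decomposition_def algebra_simps)
qed

text \<open>The trace extends linearly from the positive cone, so the description that defines
  \<^const>\<open>Tr_lim\<close> is met by exactly one functional.\<close>

theorem Tr_lim_positive_cone:
  assumes \<omega>: "generalized_limit \<omega>" "dilation_invariant \<omega>" and P: "P \<in> positive_cone"
  shows "Tr_lim \<omega> P = complex_of_real (\<omega> (log_mean P))"
proof -
  define f where "f T = complex_of_real (\<omega> (log_mean T))" for T :: "'a \<Rightarrow>\<^sub>L 'a"
  have f_add: "f (S + T) = f S + f T" if "S \<in> positive_cone" "T \<in> positive_cone" for S T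
    using log_mean_additive[OF \<omega> that] by (simp add: f_def)
  have f_scale: "f (op_scaleC (complex_of_real r) T) = r * f T" if "T \<in> positive_cone" "0 \<le> r" for T r
    using generalized_limit_log_mean_scaleC[OF \<omega>(1) that] by (simp add: f_def)
  \<comment> \<open>The extension as a relation; it is total, single-valued and linear.\<close>
  define R where "R T z \<longleftrightarrow> (\<exists>A B C D. positive_decomposition T A B C D \<and> z = f A - f B + \<i> * (f C - f D))" for T z
  have ex: "\<exists>z. R T z" if "T \<in> dixmier_ideal" for T
    using exists_positive_decomposition[OF that] by (auto simp: R_def)
  have unique: "z = z'" if "R T z" "R T z'" for T z z'
  proof -
    from that obtain A B C D A' B' C' D' where 1: "positive_decomposition T A B C D"
      and 2: "positive_decomposition T A' B' C' D'"
      and z: "z = f A - f B + \<i> * (f C - f D)" "z' = f A' - f B' + \<i> * (f C' - f D')"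
      by (auto simp: R_def)
    have cone: "A \<in> positive_cone" "B \<in> positive_cone" "C \<in> positive_cone" "D \<in> positive_cone"
      "A' \<in> positive_cone" "B' \<in> positive_cone" "C' \<in> positive_cone" "D' \<in> positive_cone"
      using 1 2 by (auto simp: positive_decomposition_def)
    have "f A + f B' = f A' + f B" "f C + f D' = f C' + f D"
      using positive_decomposition_unique[OF 1 2] by (simp_all add: cone flip: f_add)
    then have "f A - f B = f A' - f B'" "f C - f D = f C' - f D'"
      by (simp_all add: algebra_simps)
    then show ?thesis by (simp add: z)
  qed
  have R_add: "R (S + T) (z + w)" if "R S z" "R T w" for S T z w
  proof -
    from that obtain A B C D A' B' C' D' where 1: "positive_decomposition S A B C D"
      and 2: "positive_decomposition T A' B' C' D'"
      and z: "z = f A - f B + \<i> * (f C - f D)" "w = f A' - f B' + \<i> * (f C' - f D')"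
      by (auto simp: R_def)
    have "z + w = f (A + A') - f (B + B') + \<i> * (f (C + C') - f (D + D'))"
      using 1 2 unfolding z positive_decomposition_def by (simp add: f_add algebra_simps)
    then show ?thesis
      using positive_decomposition_add[OF 1 2] unfolding R_def by blast
  qed
  have R_minus: "R (op_scaleC (- 1) T) (- z)" if "R T z" for T z
  proof -
    from that obtain A B C D where 1: "positive_decomposition T A B C D" and z: "z = f A - f B + \<i> * (f C - f D)"
      by (auto simp: R_def)
    have "- z = f B - f A + \<i> * (f D - f C)"
      by (simp add: z algebra_simps)
    then show ?thesis
      using positive_decomposition_minus[OF 1] unfolding R_def by blast
  qed
  have R_ii: "R (op_scaleC \<i> T) (\<i> * z)" if "R T z" for T z
  proof -
    from that obtain A B C D where 1: "positive_decomposition T A B C D" and z: "z = f A - f B + \<i> * (f C - f D)"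
      by (auto simp: R_def)
    have "\<i> * z = f D - f C + \<i> * (f A - f B)"
      by (simp add: z algebra_simps)
    then show ?thesis
      using positive_decomposition_ii[OF 1] unfolding R_def by blast
  qed
  have R_nonneg: "R (op_scaleC (complex_of_real r) T) (r * z)" if "R T z" "0 \<le> r" for T and z :: complex and r :: real
  proof -
    from that(1) obtain A B C D where 1: "positive_decomposition T A B C D" and z: "z = f A - f B + \<i> * (f C - f D)"
      by (auto simp: R_def)
    let ?m = "op_scaleC (complex_of_real r)"
    have "r * z = f (?m A) - f (?m B) + \<i> * (f (?m C) - f (?m D))"
      using 1 that(2) by (simp add: z positive_decomposition_def f_scale algebra_simps)
    then show ?thesis
      using positive_decomposition_scale[OF 1 that(2)] unfolding R_def by blast
  qed
  have R_real: "R (op_scaleC (complex_of_real r) T) (r * z)" if "R T z" for T and z :: complex and r :: real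
  proof (cases "0 \<le> r")
    case False
    then show ?thesis
      using R_minus[OF R_nonneg[OF that, of "- r"]] by (simp add: op_scaleC_op_scaleC)
  qed (rule R_nonneg[OF that])
  have R_scale: "R (op_scaleC c T) (c * z)" if "R T z" for T z c
  proof -
    have c: "c = complex_of_real (Re c) + \<i> * complex_of_real (Im c)"
      by (simp add: complex_eq_iff)
    have "op_scaleC c T = op_scaleC (complex_of_real (Re c)) T + op_scaleC \<i> (op_scaleC (complex_of_real (Im c)) T)"
      by (subst c) (simp only: op_scaleC_add_left op_scaleC_op_scaleC)
    moreover have "c * z = complex_of_real (Re c) * z + \<i> * (complex_of_real (Im c) * z)"
      by (subst c) (simp only: distrib_right mult.assoc)
    ultimately show ?thesis
      using R_add[OF R_real[OF that, of "Re c"] R_ii[OF R_real[OF that, of "Im c"]]] by simp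
  qed
  have zero_cone: "0 \<in> positive_cone"
    using positive_cone_scaleC[OF P, of 0]
    by (metis blinfun_eqI complex_vector.scale_zero_left of_real_0 op_scaleC_apply order_refl zero_blinfun.rep_eq)
  have R_cone: "R T (f T)" if "T \<in> positive_cone" for T
  proof -
    have "op_scaleC \<i> 0 = (0 :: 'a \<Rightarrow>\<^sub>L 'a)"
      by (rule blinfun_eqI) (simp add: op_scaleC_apply)
    then have "positive_decomposition T T 0 0 0"
      using that zero_cone by (simp add: positive_decomposition_def)
    moreover have "f 0 = 0"
      using f_add[OF zero_cone zero_cone] by simp
    ultimately show ?thesis
      unfolding R_def by (intro exI[of _ T] exI[of _ 0]) simp
  qed
  define \<phi> where "\<phi> = (\<lambda>T\<in>dixmier_ideal. SOME z. R T z)"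
  have \<phi>: "\<phi> T = z" if "T \<in> dixmier_ideal" "R T z" for T z
    using that unique someI_ex[OF ex[OF that(1)]] by (auto simp: \<phi>_def)
  define Q where "Q \<psi> \<longleftrightarrow> linear_functional_on_ideal \<psi> \<and>
     (\<forall>T\<in>dixmier_ideal. positive_operator T \<longrightarrow> \<psi> T = complex_of_real (\<omega> (log_mean T)))"
    for \<psi> :: "('a \<Rightarrow>\<^sub>L 'a) \<Rightarrow> complex"
  have Q: "Q \<phi>"
    unfolding Q_def linear_functional_on_ideal_def
  proof (intro conjI ballI allI impI)
    show "\<phi> \<in> extensional dixmier_ideal" by (simp add: \<phi>_def)
    fix S T :: "'a \<Rightarrow>\<^sub>L 'a" and c
    assume T: "T \<in> dixmier_ideal"
    from ex[OF T] obtain z where z: "R T z" by blast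
    show "\<phi> (op_scaleC c T) = c * \<phi> T"
      using \<phi>[OF T z] \<phi>[OF dixmier_ideal_scaleC[OF T] R_scale[OF z]] by simp
    show "\<phi> T = complex_of_real (\<omega> (log_mean T))" if "positive_operator T"
      using \<phi>[OF T R_cone] that T by (simp add: positive_cone_def f_def)
    assume S: "S \<in> dixmier_ideal"
    from ex[OF S] obtain w where w: "R S w" by blast
    show "\<phi> (S + T) = \<phi> S + \<phi> T"
      using \<phi>[OF T z] \<phi>[OF S w] \<phi>[OF dixmier_ideal_add[OF S T] R_add[OF w z]] by simp
  qed
  have eq: "\<psi> = \<phi>" if "Q \<psi>" for \<psi>
  proof
    fix T :: "'a \<Rightarrow>\<^sub>L 'a"
    have lin: "\<psi> (A + B) = \<psi> A + \<psi> B" "\<psi> (op_scaleC c A) = c * \<psi> A"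
      if "A \<in> dixmier_ideal" "B \<in> dixmier_ideal" for A B c
      using \<open>Q \<psi>\<close> that by (auto simp: Q_def linear_functional_on_ideal_def)
    show "\<psi> T = \<phi> T"
    proof (cases "T \<in> dixmier_ideal")
      case True
      from exists_positive_decomposition[OF True] obtain A B C D where dec: "positive_decomposition T A B C D"
        by blast
      then have mem: "A \<in> dixmier_ideal" "B \<in> dixmier_ideal" "C \<in> dixmier_ideal" "D \<in> dixmier_ideal"
        and pos: "positive_operator A" "positive_operator B" "positive_operator C" "positive_operator D"
        and T_eq: "T + (B + op_scaleC \<i> D) = A + op_scaleC \<i> C"
        by (auto simp: positive_decomposition_def positive_cone_def)
      have f: "\<psi> A = f A" "\<psi> B = f B" "\<psi> C = f C" "\<psi> D = f D"
        using \<open>Q \<psi>\<close> mem pos by (auto simp: Q_def f_def)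
      have "\<psi> T + (f B + \<i> * f D) = \<psi> (T + (B + op_scaleC \<i> D))"
        using True mem by (simp add: lin dixmier_ideal_add dixmier_ideal_scaleC f)
      also have "\<dots> = f A + \<i> * f C"
        unfolding T_eq using mem by (simp add: lin dixmier_ideal_scaleC f)
      finally have "\<psi> T = f A - f B + \<i> * (f C - f D)"
        by (simp add: algebra_simps)
      moreover have "\<phi> T = f A - f B + \<i> * (f C - f D)"
        by (rule \<phi>[OF True]) (use dec in \<open>auto simp: R_def\<close>)
      ultimately show ?thesis by simp
    next
      case False
      then show ?thesis
        using \<open>Q \<psi>\<close> by (simp add: Q_def linear_functional_on_ideal_def \<phi>_def extensional_def)
    qed
  qed
  have "Tr_lim \<omega> = \<phi>"
    unfolding Tr_lim_def Q_def[symmetric] using Q eq by (rule the_equality)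
  then show ?thesis
    using Q P by (simp add: Q_def positive_cone_def)
qed

end

section \<open>Logarithmic averages\<close>

text \<open>The integral of \<open>x\<close> with respect to the dilation invariant measure \<open>ds / s\<close>.\<close>

definition log_integral :: "(real \<Rightarrow> real) \<Rightarrow> real \<Rightarrow> real \<Rightarrow> real" where
  "log_integral x a b = integral {a..b} (\<lambda>s. x s / s)"

text \<open>The mean of \<open>x\<close> over \<open>[t, t\<^sup>2]\<close> with respect to \<open>ds / s\<close>. The substitution \<open>s = t powr w\<close>
  turns it into the mean of \<open>x (t powr w)\<close> over \<open>w \<in> [1, 2]\<close>.\<close>

definition log_average :: "(real \<Rightarrow> real) \<Rightarrow> real \<Rightarrow> real" where
  "log_average x t = (if 1 < t then log_integral x t (t\<^sup>2) / ln t else 0)"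

lemma AE_lebesgue_on_imp_negligible:
  assumes "AE t in lebesgue_on {0<..}. P t"
  shows "\<exists>N :: real set. negligible N \<and> (\<forall>t>0. t \<notin> N \<longrightarrow> P t)"
proof -
  have "AE t in lebesgue. t \<in> {0<..} \<longrightarrow> P t"
    using assms by (subst (asm) AE_restrict_space_iff) auto
  then obtain N where N: "N \<in> null_sets lebesgue" "{t \<in> space lebesgue. \<not> (t \<in> {0<..} \<longrightarrow> P t)} \<subseteq> N"
    unfolding eventually_ae_filter by blast
  then show ?thesis
    by (intro exI[of _ N]) (auto simp: negligible_iff_null_sets)
qed

lemma Linfty_essential_bound:
  assumes "x \<in> Linfty"
  obtains C N where "0 \<le> C" "negligible N" "\<And>t. 0 < t \<Longrightarrow> t \<notin> N \<Longrightarrow> \<bar>x t\<bar> \<le> C"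
proof -
  from assms obtain C where "AE t in lebesgue_on {0<..}. \<bar>x t\<bar> \<le> C"
    by (auto simp: Linfty_def)
  then obtain N where "negligible N" "\<forall>t>0. t \<notin> N \<longrightarrow> \<bar>x t\<bar> \<le> C"
    using AE_lebesgue_on_imp_negligible by blast
  then show ?thesis
    by (intro that[of "max 0 C" N]) auto
qed

lemma log_integrable:
  assumes "x \<in> Linfty" "0 < a"
  shows "(\<lambda>s. x s / s) integrable_on {a..b}"
proof -
  obtain C N where C: "0 \<le> C" "negligible N" "\<And>t. 0 < t \<Longrightarrow> t \<notin> N \<Longrightarrow> \<bar>x t\<bar> \<le> C"
    using Linfty_essential_bound[OF assms(1)] by blast
  \<comment> \<open>Truncation gives a representative that is bounded everywhere.\<close>
  define z where "z s = max (- C) (min C (x s))" for s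
  have x: "x \<in> borel_measurable (lebesgue_on {0<..})"
    using assms(1) by (simp add: Linfty_def)
  have "x \<in> borel_measurable (lebesgue_on {a..b})"
    by (rule measurable_restrict_mono[OF x]) (use assms(2) in auto)
  moreover have "(\<lambda>s :: real. s) \<in> borel_measurable (lebesgue_on {a..b})"
    by (intro measurable_restrict_space1 measurable_completion) simp
  ultimately have "(\<lambda>s. z s / s) \<in> borel_measurable (lebesgue_on {a..b})"
    unfolding z_def by (intro borel_measurable_divide borel_measurable_max borel_measurable_min) auto
  then have "(\<lambda>s. z s / s) integrable_on {a..b}"
  proof (rule measurable_bounded_by_integrable_imp_integrable[where g = "\<lambda>s. C / a"])
    fix s assume s: "s \<in> {a..b}"
    have "\<bar>z s\<bar> \<le> C"
      using C(1) by (simp add: z_def abs_le_iff)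
    then show "norm (z s / s) \<le> C / a"
      using s assms(2) C(1) by (simp add: frac_le)
  qed auto
  then show ?thesis
  proof (rule integrable_spike[OF _ C(2)])
    fix s assume "s \<in> {a..b} - N"
    then have "\<bar>x s\<bar> \<le> C"
      using C(3) assms(2) by auto
    then show "x s / s = z s / s"
      by (simp add: z_def max_def min_def abs_le_iff)
  qed
qed

lemma log_integral_mono:
  assumes "x \<in> Linfty" "y \<in> Linfty" "0 < a" "negligible N"
    and "\<And>s. a \<le> s \<Longrightarrow> s \<le> b \<Longrightarrow> s \<notin> N \<Longrightarrow> x s \<le> y s"
  shows "log_integral x a b \<le> log_integral y a b"
proof -
  define x' where "x' s = (if s \<in> N then y s / s else x s / s)" for s
  have "x' integrable_on {a..b}"
    by (rule integrable_spike[OF log_integrable[OF assms(1,3)] assms(4)]) (simp add: x'_def)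
  moreover have "log_integral x a b = integral {a..b} x'"
    unfolding log_integral_def by (rule integral_spike[OF assms(4)]) (simp add: x'_def)
  moreover have "x' s \<le> y s / s" if "s \<in> {a..b}" for s
    using assms(3,5) that by (auto simp: x'_def intro!: divide_right_mono)
  ultimately show ?thesis
    unfolding log_integral_def by (simp only:) (rule integral_le[OF _ log_integrable[OF assms(2,3)]])
qed

lemma log_integral_const:
  assumes "0 < a" "a \<le> b"
  shows "log_integral (\<lambda>_. c) a b = c * (ln b - ln a)"
proof -
  have "((\<lambda>s. c / s) has_integral (c * ln b - c * ln a)) {a..b}"
    by (rule fundamental_theorem_of_calculus[OF assms(2)])
      (use assms(1) in \<open>auto intro!: derivative_eq_intros simp flip: has_real_derivative_iff_has_vector_derivative\<close>)
  then show ?thesis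
    by (simp add: log_integral_def integral_unique right_diff_distrib)
qed

lemma log_integral_add: "x \<in> Linfty \<Longrightarrow> y \<in> Linfty \<Longrightarrow> 0 < a \<Longrightarrow>
    log_integral (\<lambda>t. x t + y t) a b = log_integral x a b + log_integral y a b"
  by (simp add: log_integral_def add_divide_distrib integral_add log_integrable)

lemma log_integral_mult: "log_integral (\<lambda>t. c * x t) a b = c * log_integral x a b"
  by (simp add: log_integral_def flip: times_divide_eq_right)

lemma log_integral_combine:
  assumes "x \<in> Linfty" "0 < a" "a \<le> c" "c \<le> b"
  shows "log_integral x a c + log_integral x c b = log_integral x a b"
  unfolding log_integral_def
  by (rule Henstock_Kurzweil_Integration.integral_combine[OF assms(3,4) log_integrable[OF assms(1,2)]])

lemma log_integral_bound:
  assumes "x \<in> Linfty"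
  shows "\<exists>C\<ge>0. \<forall>a b. 0 < a \<longrightarrow> a \<le> b \<longrightarrow> \<bar>log_integral x a b\<bar> \<le> C * (ln b - ln a)"
proof -
  obtain C N where C: "0 \<le> C" "negligible N" "\<And>t. 0 < t \<Longrightarrow> t \<notin> N \<Longrightarrow> \<bar>x t\<bar> \<le> C"
    using Linfty_essential_bound[OF assms(1)] by blast
  have "\<bar>log_integral x a b\<bar> \<le> C * (ln b - ln a)" if "0 < a" "a \<le> b" for a b
  proof -
    have "log_integral x a b \<le> log_integral (\<lambda>_. C) a b"
      by (rule log_integral_mono[OF assms Linfty_const that(1) C(2)]) (use abs_le_D1[OF C(3)] minus_le_iff[of "C"] abs_le_D2[OF C(3)] that in auto)
    moreover have "log_integral (\<lambda>_. - C) a b \<le> log_integral x a b"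
      by (rule log_integral_mono[OF Linfty_const assms that(1) C(2)]) (use abs_le_D1[OF C(3)] minus_le_iff[of "C"] abs_le_D2[OF C(3)] that in auto)
    ultimately show ?thesis
      by (simp add: log_integral_const[OF that] abs_le_iff)
  qed
  with C(1) show ?thesis by blast
qed

lemma log_integral_dilation:
  assumes "0 < \<beta>" "x \<in> Linfty" "0 < a"
  shows "log_integral (\<lambda>s. x (\<beta> * s)) a b = log_integral x (\<beta> * a) (\<beta> * b)"
proof -
  have "((\<lambda>s. x s / s) has_integral log_integral x (\<beta> * a) (\<beta> * b)) {\<beta> * a..\<beta> * b}"
    unfolding log_integral_def
    using log_integrable[OF assms(2), of "\<beta> * a" "\<beta> * b"] assms(1,3) by (simp add: integrable_integral)
  from has_integral_stretch_real[OF this, of \<beta>] assms(1)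
  have "((\<lambda>s. x (\<beta> * s) / (\<beta> * s)) has_integral (1 / \<beta>) * log_integral x (\<beta> * a) (\<beta> * b)) {a..b}"
    by (simp add: image_divide_atLeastAtMost)
  from has_integral_mult_right[OF this, of \<beta>] assms(1)
  have "((\<lambda>s. x (\<beta> * s) / s) has_integral log_integral x (\<beta> * a) (\<beta> * b)) {a..b}"
    by simp
  then show ?thesis
    unfolding log_integral_def by (rule integral_unique)
qed

text \<open>Logarithmic averages are Borel measurable and bounded everywhere, not only almost everywhere.
  On such functions the evaluation at a point makes sense.\<close>

definition bounded_borel :: "(real \<Rightarrow> real) set" where
  "bounded_borel = {x \<in> borel_measurable borel. \<exists>C. \<forall>t. \<bar>x t\<bar> \<le> C}"

lemma bounded_borel_Linfty: "x \<in> bounded_borel \<Longrightarrow> x \<in> Linfty"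
  unfolding bounded_borel_def using Linfty_bounded[OF borel_measurable_imp_lebesgue_on] by blast

lemma bounded_borel_add:
  assumes "x \<in> bounded_borel" "y \<in> bounded_borel"
  shows "(\<lambda>t. x t + y t) \<in> bounded_borel"
proof -
  from assms obtain C D where "\<And>t. \<bar>x t\<bar> \<le> C" "\<And>t. \<bar>y t\<bar> \<le> D"
    by (auto simp: bounded_borel_def)
  then have "\<bar>x t + y t\<bar> \<le> C + D" for t
    by (meson abs_triangle_ineq add_mono order_trans)
  then show ?thesis
    using assms by (auto simp: bounded_borel_def)
qed

lemma bounded_borel_mult:
  assumes "x \<in> bounded_borel"
  shows "(\<lambda>t. c * x t) \<in> bounded_borel"
proof -
  from assms obtain C where "\<And>t. \<bar>x t\<bar> \<le> C"
    by (auto simp: bounded_borel_def)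
  then have "\<bar>c * x t\<bar> \<le> \<bar>c\<bar> * C" for t
    by (simp add: abs_mult mult_left_mono)
  then show ?thesis
    using assms by (auto simp: bounded_borel_def)
qed

lemma bounded_borel_diff: "x \<in> bounded_borel \<Longrightarrow> y \<in> bounded_borel \<Longrightarrow> (\<lambda>t. x t - y t) \<in> bounded_borel"
  using bounded_borel_add[OF _ bounded_borel_mult[of y "-1"], of x] by simp

lemma log_average_dilation_eq:
  "0 < \<beta> \<Longrightarrow> x \<in> Linfty \<Longrightarrow> 1 < t \<Longrightarrow>
    log_average (\<lambda>s. x (\<beta> * s)) t = log_integral x (\<beta> * t) (\<beta> * t\<^sup>2) / ln t"
  by (simp add: log_average_def log_integral_dilation)

text \<open>After the substitution only integrals of \<open>x\<close> itself occur, so it does not matter whether the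
  dilated function is Lebesgue measurable.\<close>

lemma log_average_dilation_bounded_borel:
  assumes "0 < \<beta>" "x \<in> Linfty"
  shows "log_average (\<lambda>s. x (\<beta> * s)) \<in> bounded_borel"
proof -
  obtain C where C: "0 \<le> C" "\<And>a b. 0 < a \<Longrightarrow> a \<le> b \<Longrightarrow> \<bar>log_integral x a b\<bar> \<le> C * (ln b - ln a)"
    using log_integral_bound[OF assms(2)] by blast
  have sq: "t \<le> t\<^sup>2" if "1 < t" for t :: real
    using that self_le_power[of t 2] by simp
  have "\<bar>log_average (\<lambda>s. x (\<beta> * s)) t\<bar> \<le> C" for t
  proof (cases "1 < t")
    case True
    have "\<bar>log_integral x (\<beta> * t) (\<beta> * t\<^sup>2)\<bar> \<le> C * (ln (\<beta> * t\<^sup>2) - ln (\<beta> * t))"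
      by (rule C(2)) (use True assms(1) sq[OF True] in auto)
    also have "\<dots> = C * ln t"
      using True assms(1) by (simp add: ln_mult ln_realpow)
    finally show ?thesis
      using True by (simp add: log_average_dilation_eq[OF assms True] divide_le_eq)
  qed (use C(1) in \<open>simp add: log_average_def\<close>)
  moreover have "log_average (\<lambda>s. x (\<beta> * s)) \<in> borel_measurable borel"
  proof -
    define a where "a = min 1 \<beta>"
    have a: "0 < a" "a \<le> \<beta>" using assms(1) by (auto simp: a_def)
    define G where "G u = log_integral x a u" for u
    have "continuous_on (\<Union>b\<in>UNIV. {a<..<b}) G"
    proof (rule continuous_on_open_UN)
      fix b
      have "continuous_on {a..b} G"
        unfolding G_def log_integral_def
        by (rule indefinite_integral_continuous_1[OF log_integrable[OF assms(2) a(1)]])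
      then show "continuous_on {a<..<b} G"
        by (rule continuous_on_subset) auto
    qed auto
    also have "(\<Union>b\<in>UNIV. {a<..<b}) = {a<..}"
      using gt_ex by auto
    finally have G: "continuous_on {a<..} G" .
    have gt: "a < \<beta> * t" "a < \<beta> * t\<^sup>2" if "1 < t" for t
    proof -
      have "\<beta> * 1 < \<beta> * t" "\<beta> * 1 < \<beta> * t\<^sup>2"
        using that assms(1) sq[OF that] by (intro mult_strict_left_mono; simp)+
      then show "a < \<beta> * t" "a < \<beta> * t\<^sup>2" using a(2) by simp_all
    qed
    have "continuous_on {1<..} (\<lambda>t. (G (\<beta> * t\<^sup>2) - G (\<beta> * t)) / ln t)"
      by (intro continuous_intros continuous_on_compose2[OF G]) (use gt in auto)
    then have "(\<lambda>t. if t \<in> {1<..} then (G (\<beta> * t\<^sup>2) - G (\<beta> * t)) / ln t else 0) \<in> borel_measurable borel"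
      by (intro borel_measurable_continuous_on_if) auto
    also have "(\<lambda>t. if t \<in> {1<..} then (G (\<beta> * t\<^sup>2) - G (\<beta> * t)) / ln t else 0) = log_average (\<lambda>s. x (\<beta> * s))"
    proof
      fix t
      show "(if t \<in> {1<..} then (G (\<beta> * t\<^sup>2) - G (\<beta> * t)) / ln t else 0) = log_average (\<lambda>s. x (\<beta> * s)) t"
      proof (cases "1 < t")
        case True
        have "G (\<beta> * t) + log_integral x (\<beta> * t) (\<beta> * t\<^sup>2) = G (\<beta> * t\<^sup>2)"
          unfolding G_def
          by (rule log_integral_combine[OF assms(2) a(1)])
            (use gt[OF True] sq[OF True] assms(1) in auto)
        then show ?thesis
          using True by (simp add: log_average_dilation_eq[OF assms True])
      qed (simp add: log_average_def)
    qed
    finally show ?thesis .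
  qed
  ultimately show ?thesis by (auto simp: bounded_borel_def)
qed

lemma log_average_bounded_borel: "x \<in> Linfty \<Longrightarrow> log_average x \<in> bounded_borel"
  using log_average_dilation_bounded_borel[of 1 x] by simp

lemma log_average_add:
  "x \<in> Linfty \<Longrightarrow> y \<in> Linfty \<Longrightarrow> log_average (\<lambda>t. x t + y t) = (\<lambda>t. log_average x t + log_average y t)"
  by (auto simp: fun_eq_iff log_average_def log_integral_add add_divide_distrib)

lemma log_average_mult: "log_average (\<lambda>t. c * x t) = (\<lambda>t. c * log_average x t)"
  by (auto simp: fun_eq_iff log_average_def log_integral_mult)

lemma log_average_diff:
  "x \<in> Linfty \<Longrightarrow> y \<in> Linfty \<Longrightarrow> log_average (\<lambda>t. x t - y t) = (\<lambda>t. log_average x t - log_average y t)"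
  using log_average_add[OF _ Linfty_mult_left[of y "-1"], of x] log_average_mult[of "-1" y] by simp

lemma log_average_nonneg:
  assumes "x \<in> Linfty" "AE t in lebesgue_on {0<..}. 0 \<le> x t"
  shows "0 \<le> log_average x t"
proof (cases "1 < t")
  case True
  obtain N where N: "negligible N" "\<forall>t>0. t \<notin> N \<longrightarrow> 0 \<le> x t"
    using AE_lebesgue_on_imp_negligible[OF assms(2)] by blast
  have "log_integral (\<lambda>_. 0) t (t\<^sup>2) \<le> log_integral x t (t\<^sup>2)"
    by (rule log_integral_mono[OF Linfty_const assms(1) _ N(1)]) (use True N(2) in auto)
  then show ?thesis
    using True by (simp add: log_average_def log_integral_def)
qed (simp add: log_average_def)

lemma log_average_tendsto:
  assumes "x \<in> Linfty" "(x \<longlongrightarrow> l) at_top"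
  shows "(log_average x \<longlongrightarrow> l) at_top"
proof (rule tendstoI)
  fix e :: real assume "0 < e"
  then have "\<forall>\<^sub>F t in at_top. dist (x t) l < e / 2"
    using tendstoD[OF assms(2), of "e / 2"] by simp
  then obtain t0 where t0: "\<And>t. t \<ge> t0 \<Longrightarrow> dist (x t) l < e / 2"
    by (auto simp: eventually_at_top_linorder)
  have t0_le: "x s \<le> l + e / 2" "l - e / 2 \<le> x s" if "t0 \<le> s" for s
    using t0[OF that] \<open>0 < e\<close> unfolding dist_real_def by linarith+
  have "dist (log_average x t) l < e" if t: "max t0 2 \<le> t" for t
  proof -
    have t1: "1 < t" "0 < t" "t0 \<le> t" using t by auto
    have le: "t \<le> t\<^sup>2" using t1 self_le_power[of t 2] by simp
    have "log_integral x t (t\<^sup>2) \<le> log_integral (\<lambda>_. l + e / 2) t (t\<^sup>2)"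
      by (rule log_integral_mono[OF assms(1) Linfty_const t1(2) negligible_empty])
        (use t0_le t1 in auto)
    moreover have "log_integral (\<lambda>_. l - e / 2) t (t\<^sup>2) \<le> log_integral x t (t\<^sup>2)"
      by (rule log_integral_mono[OF Linfty_const assms(1) t1(2) negligible_empty])
        (use t0_le t1 in auto)
    moreover have "ln (t\<^sup>2) - ln t = ln t" "0 < ln t"
      using t1 by (simp_all add: ln_realpow)
    ultimately have "log_average x t \<le> l + e / 2" "l - e / 2 \<le> log_average x t"
      using t1 by (simp_all add: log_average_def log_integral_const[OF t1(2) le] divide_le_eq le_divide_eq)
    then show ?thesis
      using \<open>0 < e\<close> by (simp add: dist_real_def abs_less_iff)
  qed
  then show "\<forall>\<^sub>F t in at_top. dist (log_average x t) l < e"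
    unfolding eventually_at_top_linorder by blast
qed

text \<open>Dilating \<open>x\<close> shifts the window of the average by a bounded amount on the logarithmic scale,
  which is negligible compared with its length \<open>ln t\<close>.\<close>

lemma log_average_dilation_tendsto:
  assumes "0 < \<beta>" "x \<in> Linfty"
  shows "((\<lambda>t. log_average (\<lambda>s. x (\<beta> * s)) t - log_average x t) \<longlongrightarrow> 0) at_top"
proof -
  obtain C where C: "0 \<le> C" "\<And>a b. 0 < a \<Longrightarrow> a \<le> b \<Longrightarrow> \<bar>log_integral x a b\<bar> \<le> C * (ln b - ln a)"
    using log_integral_bound[OF assms(2)] by blast
  define a where "a = min 1 \<beta>"
  have a: "0 < a" "a \<le> \<beta>" "a \<le> 1" using assms(1) by (auto simp: a_def)
  define G where "G u = log_integral x a u" for u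
  have G: "log_integral x u v = G v - G u" if "a \<le> u" "u \<le> v" for u v
    using log_integral_combine[OF assms(2) a(1) that] by (simp add: G_def)
  have lip: "\<bar>G v - G u\<bar> \<le> C * \<bar>ln v - ln u\<bar>" if "a \<le> u" "a \<le> v" for u v
  proof (cases "u \<le> v")
    case True
    have "\<bar>log_integral x u v\<bar> \<le> C * (ln v - ln u)"
      by (rule C(2)) (use a True that in auto)
    moreover have "ln u \<le> ln v"
      using a True that by (intro ln_mono) auto
    ultimately show ?thesis
      using G[OF that(1) True] by simp
  next
    case False
    have "\<bar>log_integral x v u\<bar> \<le> C * (ln u - ln v)"
      by (rule C(2)) (use a False that in auto)
    moreover have "ln v \<le> ln u"
      using a False that by (intro ln_mono) auto
    ultimately show ?thesis
      using G[OF that(2), of u] False by simp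
  qed
  have "\<bar>log_average (\<lambda>s. x (\<beta> * s)) t - log_average x t\<bar> \<le> 2 * C * \<bar>ln \<beta>\<bar> / ln t" if "1 < t" for t
  proof -
    have sq: "t \<le> t\<^sup>2" "1 < t\<^sup>2" using that self_le_power[of t 2] by simp_all
    have ge: "a \<le> \<beta> * t" "a \<le> \<beta> * t\<^sup>2" "a \<le> t" "a \<le> t\<^sup>2"
    proof -
      have "a * 1 \<le> \<beta> * t" "a * 1 \<le> \<beta> * t\<^sup>2"
        using that a(1,2) assms(1) sq by (intro mult_mono; simp)+
      then show "a \<le> \<beta> * t" "a \<le> \<beta> * t\<^sup>2" by simp_all
    qed (use a sq that in auto)
    have "\<bar>(G (\<beta> * t\<^sup>2) - G (\<beta> * t)) - (G (t\<^sup>2) - G t)\<bar> \<le> \<bar>G (\<beta> * t\<^sup>2) - G (t\<^sup>2)\<bar> + \<bar>G (\<beta> * t) - G t\<bar>"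
      by linarith
    also have "\<dots> \<le> C * \<bar>ln (\<beta> * t\<^sup>2) - ln (t\<^sup>2)\<bar> + C * \<bar>ln (\<beta> * t) - ln t\<bar>"
      by (intro add_mono lip ge)
    also have "\<dots> = 2 * C * \<bar>ln \<beta>\<bar>"
      using assms(1) that by (simp add: ln_mult)
    finally have *: "\<bar>(G (\<beta> * t\<^sup>2) - G (\<beta> * t)) - (G (t\<^sup>2) - G t)\<bar> \<le> 2 * C * \<bar>ln \<beta>\<bar>" .
    have "log_average (\<lambda>s. x (\<beta> * s)) t - log_average x t = ((G (\<beta> * t\<^sup>2) - G (\<beta> * t)) - (G (t\<^sup>2) - G t)) / ln t"
      unfolding log_average_dilation_eq[OF assms that]
      using that G[OF ge(1), of "\<beta> * t\<^sup>2"] G[OF ge(3) sq(1)] assms(1) sq(1)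
      by (simp add: log_average_def diff_divide_distrib)
    then show ?thesis
      using that * by (simp add: abs_divide divide_right_mono)
  qed
  then have "\<forall>\<^sub>F t in at_top. norm (log_average (\<lambda>s. x (\<beta> * s)) t - log_average x t) \<le> 2 * C * \<bar>ln \<beta>\<bar> / ln t"
    by (intro eventually_mono[OF eventually_gt_at_top[of 1]]) simp
  moreover have "((\<lambda>t. 2 * C * \<bar>ln \<beta>\<bar> / ln t) \<longlongrightarrow> 0) at_top"
    by real_asymp
  ultimately show ?thesis
    by (rule Lim_null_comparison)
qed

text \<open>A generalized limit for functions that are defined and bounded everywhere, where positivity is
  required for pointwise inequality only. Logarithmic averaging turns it into a dilation invariant
  generalized limit on \<^const>\<open>Linfty\<close>.\<close>

definition borel_limit :: "((real \<Rightarrow> real) \<Rightarrow> real) \<Rightarrow> bool" where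
  "borel_limit \<Phi> \<longleftrightarrow>
     (\<forall>x\<in>bounded_borel. \<forall>y\<in>bounded_borel. \<Phi> (\<lambda>t. x t + y t) = \<Phi> x + \<Phi> y) \<and>
     (\<forall>c. \<forall>x\<in>bounded_borel. \<Phi> (\<lambda>t. c * x t) = c * \<Phi> x) \<and>
     (\<forall>x\<in>bounded_borel. (\<forall>t. 0 \<le> x t) \<longrightarrow> 0 \<le> \<Phi> x) \<and>
     (\<forall>x\<in>bounded_borel. \<forall>l. (x \<longlongrightarrow> l) at_top \<longrightarrow> \<Phi> x = l)"

lemma generalized_limit_imp_borel_limit:
  assumes \<omega>: "generalized_limit \<omega>"
  shows "borel_limit \<omega>"
  unfolding borel_limit_def
proof (intro conjI ballI allI impI)
  fix x y assume "x \<in> bounded_borel" "y \<in> bounded_borel"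
  then show "\<omega> (\<lambda>t. x t + y t) = \<omega> x + \<omega> y"
    by (rule generalized_limit_add[OF \<omega> bounded_borel_Linfty bounded_borel_Linfty])
next
  fix c x assume "x \<in> bounded_borel"
  then show "\<omega> (\<lambda>t. c * x t) = c * \<omega> x"
    by (rule generalized_limit_mult[OF \<omega> bounded_borel_Linfty])
next
  fix x assume x: "x \<in> bounded_borel" "\<forall>t. 0 \<le> x t"
  show "0 \<le> \<omega> x"
    by (rule generalized_limit_nonneg[OF \<omega> bounded_borel_Linfty[OF x(1)] AE_I2]) (simp add: x(2))
next
  fix x l assume "x \<in> bounded_borel" "(x \<longlongrightarrow> l) at_top"
  then show "\<omega> x = l"
    by (rule generalized_limit_eq_limit[OF \<omega> bounded_borel_Linfty])
qed

theorem log_average_generalized_limit: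
  assumes \<Phi>: "borel_limit \<Phi>"
  shows "generalized_limit (\<lambda>x. \<Phi> (log_average x))" "dilation_invariant (\<lambda>x. \<Phi> (log_average x))"
proof -
  have add: "\<Phi> (\<lambda>t. x t + y t) = \<Phi> x + \<Phi> y" if "x \<in> bounded_borel" "y \<in> bounded_borel" for x y
    using \<Phi> that by (simp add: borel_limit_def)
  have mult: "\<Phi> (\<lambda>t. c * x t) = c * \<Phi> x" if "x \<in> bounded_borel" for c x
    using \<Phi> that by (simp add: borel_limit_def)
  have nonneg: "0 \<le> \<Phi> x" if "x \<in> bounded_borel" "\<And>t. 0 \<le> x t" for x
    using \<Phi> that by (simp add: borel_limit_def)
  have lim: "\<Phi> x = l" if "x \<in> bounded_borel" "(x \<longlongrightarrow> l) at_top" for x l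
    using \<Phi> that by (simp add: borel_limit_def)
  show "generalized_limit (\<lambda>x. \<Phi> (log_average x))"
    unfolding generalized_limit_def
  proof (intro conjI ballI allI impI)
    fix x y assume x: "x \<in> Linfty" and y: "y \<in> Linfty"
    show "\<Phi> (log_average (\<lambda>t. x t + y t)) = \<Phi> (log_average x) + \<Phi> (log_average y)"
      by (simp add: log_average_add x y add log_average_bounded_borel)
  next
    fix c x assume x: "x \<in> Linfty"
    show "\<Phi> (log_average (\<lambda>t. c * x t)) = c * \<Phi> (log_average x)"
      by (simp add: log_average_mult x mult log_average_bounded_borel)
  next
    fix x assume "x \<in> Linfty" "AE t in lebesgue_on {0<..}. 0 \<le> x t"
    then show "0 \<le> \<Phi> (log_average x)"
      by (intro nonneg log_average_bounded_borel log_average_nonneg)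
  next
    show "\<Phi> (log_average (\<lambda>t. 1)) = 1"
      by (intro lim log_average_bounded_borel log_average_tendsto Linfty_const tendsto_const)
  next
    fix x l assume "x \<in> Linfty" "(x \<longlongrightarrow> l) at_top"
    then show "\<Phi> (log_average x) = l"
      by (intro lim log_average_bounded_borel log_average_tendsto)
  qed
  show "dilation_invariant (\<lambda>x. \<Phi> (log_average x))"
    unfolding dilation_invariant_def
  proof (intro ballI allI impI)
    fix x and \<beta> :: real assume x: "x \<in> Linfty" and \<beta>: "0 < \<beta>"
    define d where "d t = log_average (\<lambda>s. x (\<beta> * s)) t - log_average x t" for t
    have d: "d \<in> bounded_borel"
      unfolding d_def by (intro bounded_borel_diff log_average_dilation_bounded_borel \<beta> x log_average_bounded_borel)
    have "\<Phi> d = 0"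
      by (rule lim[OF d]) (unfold d_def, rule log_average_dilation_tendsto[OF \<beta> x])
    then show "\<Phi> (log_average (\<lambda>t. x (\<beta> * t))) = \<Phi> (log_average x)"
      using add[OF log_average_bounded_borel[OF x] d] by (simp add: d_def)
  qed
qed


section \<open>Existence of limits along a sequence\<close>

lemma cluster_point_mem_closed:
  assumes "closed S" "eventually (\<lambda>y. y \<in> S) F" "inf (nhds x) F \<noteq> bot"
  shows "x \<in> S"
proof (rule ccontr)
  assume "x \<notin> S"
  then have "eventually (\<lambda>y. y \<in> - S) (nhds x)"
    using assms(1) by (intro eventually_nhds_in_open) auto
  then have "eventually (\<lambda>y. y \<in> - S \<and> y \<in> S) (inf (nhds x) F)"
    using assms(2) by (auto simp: eventually_inf)
  with assms(3) show False
    by (simp add: eventually_False)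
qed

text \<open>The functional is a cluster point, in the product topology, of the evaluations at the points
  of the sequence.\<close>

theorem exists_borel_limit:
  assumes t: "filterlim t at_top sequentially"
  shows "\<exists>\<Phi>. borel_limit \<Phi> \<and> (\<forall>x\<in>bounded_borel. \<forall>l. (\<lambda>n. x (t n)) \<longlonglongrightarrow> l \<longrightarrow> \<Phi> x = l)"
proof -
  define ev :: "nat \<Rightarrow> (real \<Rightarrow> real) \<Rightarrow> real" where "ev n x = (if x \<in> bounded_borel then x (t n) else 0)" for n x
  have "\<forall>x. \<exists>C\<ge>0. x \<in> bounded_borel \<longrightarrow> (\<forall>t. \<bar>x t\<bar> \<le> C)"
  proof
    fix x
    show "\<exists>C\<ge>0. x \<in> bounded_borel \<longrightarrow> (\<forall>t. \<bar>x t\<bar> \<le> C)"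
    proof (cases "x \<in> bounded_borel")
      case True
      then obtain C where "\<forall>t. \<bar>x t\<bar> \<le> C" by (auto simp: bounded_borel_def)
      moreover have "0 \<le> C" using calculation[rule_format, of 0] by linarith
      ultimately show ?thesis by blast
    qed auto
  qed
  then obtain C where C: "\<And>x. 0 \<le> C x" "\<And>x t. x \<in> bounded_borel \<Longrightarrow> \<bar>x t\<bar> \<le> C x"
    by metis
  define K where "K = PiE UNIV (\<lambda>x :: real \<Rightarrow> real. {- C x..C x})"
  have "compactin (product_topology (\<lambda>_. euclidean) UNIV) K"
    unfolding K_def compactin_PiE by (simp add: compact_Icc)
  then have "compact K"
    by (simp add: euclidean_product_topology)
  moreover have "ev n \<in> K" for n
    using C abs_le_D2[OF C(2)] by (auto simp: K_def PiE_def ev_def abs_le_iff minus_le_iff[of "C _"])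
  ultimately obtain \<Phi> where \<Phi>: "inf (nhds \<Phi>) (filtermap ev sequentially) \<noteq> bot"
    unfolding compact_filter by (metis (no_types, lifting) always_eventually eventually_filtermap
        filtermap_bot_iff trivial_limit_sequentially)
  have closed: "\<Phi> \<in> S" if "closed S" "\<forall>\<^sub>F n in sequentially. ev n \<in> S" for S
    by (rule cluster_point_mem_closed[OF that(1) _ \<Phi>]) (use that(2) in \<open>simp add: eventually_filtermap\<close>)
  have seq: "\<Phi> x = l" if x: "x \<in> bounded_borel" and l: "(\<lambda>n. x (t n)) \<longlonglongrightarrow> l" for x l
  proof -
    have "dist (\<Phi> x) l \<le> e" if "0 < e" for e
    proof -
      have "\<Phi> \<in> {\<phi>. dist (\<phi> x) l \<le> e}"
      proof (rule closed)
        show "closed {\<phi> :: (real \<Rightarrow> real) \<Rightarrow> real. dist (\<phi> x) l \<le> e}"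
          by (intro closed_Collect_le continuous_on_dist continuous_on_product_coordinates continuous_on_const)
        show "\<forall>\<^sub>F n in sequentially. ev n \<in> {\<phi>. dist (\<phi> x) l \<le> e}"
          using tendstoD[OF l that] by eventually_elim (simp add: ev_def x)
      qed
      then show ?thesis by simp
    qed
    then show ?thesis
      using dense_ge[of 0 "dist (\<Phi> x) l"] by simp
  qed
  moreover have "borel_limit \<Phi>"
    unfolding borel_limit_def
  proof (intro conjI ballI allI impI)
    fix x y assume xy: "x \<in> bounded_borel" "y \<in> bounded_borel"
    have "\<Phi> \<in> {\<phi>. \<phi> (\<lambda>t. x t + y t) = \<phi> x + \<phi> y}"
    proof (rule closed)
      show "closed {\<phi> :: (real \<Rightarrow> real) \<Rightarrow> real. \<phi> (\<lambda>t. x t + y t) = \<phi> x + \<phi> y}"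
        by (intro closed_Collect_eq continuous_on_add continuous_on_product_coordinates)
    qed (simp add: ev_def xy bounded_borel_add)
    then show "\<Phi> (\<lambda>t. x t + y t) = \<Phi> x + \<Phi> y" by simp
  next
    fix c x assume x: "x \<in> bounded_borel"
    have "\<Phi> \<in> {\<phi>. \<phi> (\<lambda>t. c * x t) = c * \<phi> x}"
    proof (rule closed)
      show "closed {\<phi> :: (real \<Rightarrow> real) \<Rightarrow> real. \<phi> (\<lambda>t. c * x t) = c * \<phi> x}"
        by (intro closed_Collect_eq continuous_on_mult continuous_on_const continuous_on_product_coordinates)
    qed (simp add: ev_def x bounded_borel_mult)
    then show "\<Phi> (\<lambda>t. c * x t) = c * \<Phi> x" by simp
  next
    fix x assume x: "x \<in> bounded_borel" "\<forall>t. 0 \<le> x t"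
    have "\<Phi> \<in> {\<phi>. 0 \<le> \<phi> x}"
    proof (rule closed)
      show "closed {\<phi> :: (real \<Rightarrow> real) \<Rightarrow> real. 0 \<le> \<phi> x}"
        by (intro closed_Collect_le continuous_on_const continuous_on_product_coordinates)
    qed (simp add: ev_def x)
    then show "0 \<le> \<Phi> x" by simp
  next
    fix x l assume "x \<in> bounded_borel" "(x \<longlongrightarrow> l) at_top"
    then show "\<Phi> x = l"
      using filterlim_compose[OF _ t] by (intro seq) auto
  qed
  ultimately show ?thesis by blast
qed


section \<open>Exponentiation invariant limits of logarithmic means\<close>

lemma powr_bounded_borel: "x \<in> bounded_borel \<Longrightarrow> (\<lambda>t. x (t powr a)) \<in> bounded_borel"
proof -
  assume x: "x \<in> bounded_borel"
  then have "x \<in> borel_measurable borel" by (simp add: bounded_borel_def)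
  then have "(\<lambda>t. x (t powr a)) \<in> borel_measurable borel"
    by (rule measurable_compose[rotated]) measurable
  then show ?thesis
    using x by (auto simp: bounded_borel_def)
qed

text \<open>If \<open>y t = F t / ln t\<close> with \<open>F\<close> increasing, then on \<open>[t powr v, t powr w]\<close> the function \<open>y\<close>
  lies between its values at the end points up to the factor \<open>w / v\<close>. Dividing \<open>[t, t\<^sup>2]\<close> into \<open>n\<close>
  such pieces compares the average of \<open>y\<close> with the mean of \<open>n\<close> of its exponentiations.\<close>

lemma log_average_powr_bounds:
  fixes F :: "real \<Rightarrow> real" and n :: nat
  assumes F: "\<And>s t. 2 \<le> s \<Longrightarrow> s \<le> t \<Longrightarrow> F s \<le> F t" and F0: "\<And>t. 0 \<le> F t"
    and y: "y \<in> Linfty" and y_eq: "\<And>t. 2 \<le> t \<Longrightarrow> y t = F t / ln t"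
    and n: "0 < n" and t: "2 \<le> t"
  shows "log_average y t \<le> (1 + 1 / n) * ((1 / n) * (\<Sum>i<n. y (t powr (1 + Suc i / n))))"
    and "(1 / n) * (\<Sum>i<n. y (t powr (1 + i / n))) \<le> (1 + 1 / n) * log_average y t"
proof -
  define v :: "nat \<Rightarrow> real" where "v i = 1 + i / n" for i
  define p where "p i = t powr v i" for i
  have v1: "1 \<le> v i" for i using n by (simp add: v_def)
  have vS: "v (Suc i) = v i + 1 / n" for i by (simp add: v_def add_divide_distrib)
  have p2: "2 \<le> p i" for i
    using powr_mono[OF v1[of i], of t] t by (simp add: p_def)
  have p_less: "p i \<le> p (Suc i)" for i
    unfolding p_def vS using t by (intro powr_mono) auto
  have ln_p: "ln (p i) = v i * ln t" for i
    using t by (simp add: p_def ln_powr)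
  have ln_t: "0 < ln t" using t by simp
  have ratio: "v (Suc i) \<le> (1 + 1 / n) * v i" for i
    using mult_left_mono[OF v1[of i], of "1 / n"] by (simp add: vS algebra_simps)
  have v_pos: "0 < v i" for i using v1[of i] by linarith
  have len: "ln (p (Suc i)) - ln (p i) = ln t / n" for i
    by (simp add: ln_p vS algebra_simps)
  have upper: "log_integral y (p i) (p (Suc i)) \<le> (1 + 1 / n) * y (p (Suc i)) * (ln t / n)" for i
  proof -
    have "log_integral y (p i) (p (Suc i)) \<le> log_integral (\<lambda>_. (1 + 1 / n) * y (p (Suc i))) (p i) (p (Suc i))"
    proof (rule log_integral_mono[OF y Linfty_const _ negligible_empty])
      show "0 < p i" using p2[of i] by linarith
      fix s assume s: "p i \<le> s" "s \<le> p (Suc i)"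
      have s2: "2 \<le> s" using p2[of i] s by linarith
      have "ln (p i) \<le> ln s" using s p2[of i] by (intro ln_mono) auto
      then have "y s \<le> F (p (Suc i)) / (v i * ln t)"
        unfolding y_eq[OF s2] using F[OF s2 s(2)] F0 v_pos ln_t s2
        by (intro frac_le) (auto simp: ln_p)
      also have "\<dots> = y (p (Suc i)) * (v (Suc i) / v i)"
        using v_pos[of i] v_pos[of "Suc i"] ln_t by (simp add: y_eq[OF p2] ln_p)
      also have "\<dots> \<le> y (p (Suc i)) * (1 + 1 / n)"
        using ratio[of i] v_pos[of i] F0 ln_t v_pos[of "Suc i"]
        by (intro mult_left_mono) (auto simp: y_eq[OF p2] ln_p divide_le_eq)
      finally show "y s \<le> (1 + 1 / n) * y (p (Suc i))" by (simp add: mult.commute)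
    qed
    also have "\<dots> = (1 + 1 / n) * y (p (Suc i)) * (ln t / n)"
      by (subst log_integral_const) (use p2[of i] p_less in \<open>auto simp: len\<close>)
    finally show ?thesis .
  qed
  have lower: "y (p i) * (ln t / n) \<le> (1 + 1 / n) * log_integral y (p i) (p (Suc i))" for i
  proof -
    have "y (p i) * (ln t / n) = log_integral (\<lambda>_. y (p i)) (p i) (p (Suc i))"
      by (subst log_integral_const) (use p2[of i] p_less in \<open>auto simp: len\<close>)
    also have "\<dots> \<le> log_integral (\<lambda>s. (1 + 1 / n) * y s) (p i) (p (Suc i))"
    proof (rule log_integral_mono[OF Linfty_const Linfty_mult_left[OF y] _ negligible_empty])
      show "0 < p i" using p2[of i] by linarith
      fix s assume s: "p i \<le> s" "s \<le> p (Suc i)"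
      have s2: "2 \<le> s" using p2[of i] s by linarith
      have ls: "0 < ln s" "ln s \<le> v (Suc i) * ln t"
        unfolding ln_p[symmetric] using s s2 by (auto intro: ln_mono)
      have "y (p i) = F (p i) / (v i * ln t)" by (simp add: y_eq[OF p2] ln_p)
      also have "\<dots> = (1 + 1 / n) * (F (p i) / ((1 + 1 / n) * v i * ln t))"
      proof -
        have "1 + 1 / real n \<noteq> 0"
          using n by (simp add: add_nonneg_eq_0_iff)
        then show ?thesis by (simp add: mult.assoc)
      qed
      also have "\<dots> \<le> (1 + 1 / n) * (F s / ln s)"
      proof (intro mult_left_mono frac_le F0 F p2 s ls(1))
        have "v (Suc i) * ln t \<le> (1 + 1 / n) * v i * ln t"
          using ratio[of i] ln_t by (intro mult_right_mono) auto
        then show "ln s \<le> (1 + 1 / n) * v i * ln t" using ls(2) by linarith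
      qed auto
      finally show "y (p i) \<le> (1 + 1 / n) * y s" by (simp add: y_eq[OF s2])
    qed
    also have "\<dots> = (1 + 1 / n) * log_integral y (p i) (p (Suc i))"
      by (rule log_integral_mult)
    finally show ?thesis .
  qed
  have sum: "(\<Sum>i<m. log_integral y (p i) (p (Suc i))) = log_integral y (p 0) (p m)" for m
  proof (induction m)
    case (Suc m)
    have "p 0 \<le> p m" by (rule lift_Suc_mono_le[of p]) (auto simp: p_less)
    then show ?case
      using Suc log_integral_combine[OF y, of "p 0" "p m" "p (Suc m)"] p2[of 0] p_less[of m] by simp
  qed (simp add: log_integral_def)
  have avg: "log_average y t * ln t = (\<Sum>i<n. log_integral y (p i) (p (Suc i)))"
    unfolding sum using t n by (simp add: log_average_def p_def v_def)
  have "log_average y t * ln t \<le> (\<Sum>i<n. (1 + 1 / n) * y (p (Suc i)) * (ln t / n))"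
    unfolding avg by (rule sum_mono) (rule upper)
  also have "\<dots> = (1 + 1 / n) * ((1 / n) * (\<Sum>i<n. y (p (Suc i)))) * ln t"
    by (simp add: sum_distrib_left sum_distrib_right mult_ac)
  finally show "log_average y t \<le> (1 + 1 / n) * ((1 / n) * (\<Sum>i<n. y (t powr (1 + Suc i / n))))"
    using ln_t unfolding p_def v_def by (simp only: mult_le_cancel_right_pos)
  have "(1 / n) * (\<Sum>i<n. y (p i)) * ln t = (\<Sum>i<n. y (p i) * (ln t / n))"
    by (simp add: sum_distrib_left sum_distrib_right mult_ac)
  also have "\<dots> \<le> (\<Sum>i<n. (1 + 1 / n) * log_integral y (p i) (p (Suc i)))"
    by (rule sum_mono) (rule lower)
  also have "\<dots> = (1 + 1 / n) * log_average y t * ln t"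
    by (simp only: avg mult.assoc flip: sum_distrib_left)
  finally show "(1 / n) * (\<Sum>i<n. y (t powr (1 + i / n))) \<le> (1 + 1 / n) * log_average y t"
    using ln_t unfolding p_def v_def by (simp only: mult_le_cancel_right_pos)
qed

text \<open>Every exponentiation \<open>t \<mapsto> y (t powr v)\<close> has the same limit as \<open>y\<close>, so the bounds above become
  equalities as \<open>n\<close> grows.\<close>

lemma exponentiation_invariant_log_average:
  assumes \<omega>: "generalized_limit \<omega>" "exponentiation_invariant \<omega>"
    and F: "\<And>s t. 2 \<le> s \<Longrightarrow> s \<le> t \<Longrightarrow> F s \<le> F t" and F0: "\<And>t. 0 \<le> F t"
    and y: "y \<in> bounded_borel" and y_eq: "\<And>t. 2 \<le> t \<Longrightarrow> y t = F t / ln t"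
  shows "\<omega> (log_average y) = \<omega> y"
proof -
  have yL: "y \<in> Linfty" "log_average y \<in> Linfty" "(\<lambda>t. y (t powr a)) \<in> Linfty" for a
    using y powr_bounded_borel log_average_bounded_borel by (auto intro!: bounded_borel_Linfty)
  have inv: "\<omega> (\<lambda>t. y (t powr a)) = \<omega> y" if "0 < a" for a
    using \<omega>(2) yL(1) that by (simp add: exponentiation_invariant_def)
  have mean: "\<omega> (\<lambda>t. (1 / n) * (\<Sum>i<n. y (t powr a i))) = \<omega> y"
    "(\<lambda>t. (1 / n) * (\<Sum>i<n. y (t powr a i))) \<in> Linfty"
    if "0 < n" "\<And>i. 0 < a i" for n :: nat and a :: "nat \<Rightarrow> real"
  proof -
    have sum: "(\<lambda>t. \<Sum>i<n. y (t powr a i)) \<in> Linfty"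
      by (rule Linfty_sum) (auto intro: yL)
    then show "(\<lambda>t. (1 / n) * (\<Sum>i<n. y (t powr a i))) \<in> Linfty"
      by (rule Linfty_mult_left)
    have "\<omega> (\<lambda>t. \<Sum>i<n. y (t powr a i)) = (\<Sum>i<n. \<omega> y)"
      by (subst generalized_limit_sum[OF \<omega>(1)]) (auto intro: yL simp: inv that(2))
    then show "\<omega> (\<lambda>t. (1 / n) * (\<Sum>i<n. y (t powr a i))) = \<omega> y"
      using that(1) generalized_limit_mult[OF \<omega>(1) sum, of "1 / n"] by simp
  qed
  have upper: "\<omega> (log_average y) \<le> (1 + 1 / real (Suc n)) * \<omega> y" for n
  proof -
    let ?m = "\<lambda>t. (1 / real (Suc n)) * (\<Sum>i<Suc n. y (t powr (1 + Suc i / real (Suc n))))"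
    have m: "\<omega> ?m = \<omega> y" "?m \<in> Linfty"
      by (rule mean; simp add: add_pos_nonneg)+
    have "\<omega> (log_average y) \<le> \<omega> (\<lambda>t. (1 + 1 / real (Suc n)) * ?m t)"
    proof (rule generalized_limit_mono[OF \<omega>(1) yL(2) Linfty_mult_left[OF m(2)]])
      fix \<epsilon> :: real assume "0 < \<epsilon>"
      show "\<forall>\<^sub>F t in at_top. log_average y t \<le> (1 + 1 / real (Suc n)) * ?m t + \<epsilon>"
        using eventually_ge_at_top[of 2]
      proof eventually_elim
        case (elim t)
        show ?case
          using log_average_powr_bounds(1)[OF F F0 yL(1) y_eq _ elim, of "Suc n"] \<open>0 < \<epsilon>\<close> by linarith
      qed
    qed
    then show ?thesis
      by (simp only: generalized_limit_mult[OF \<omega>(1) m(2)] m(1))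
  qed
  have lower: "\<omega> y \<le> (1 + 1 / real (Suc n)) * \<omega> (log_average y)" for n
  proof -
    let ?m = "\<lambda>t. (1 / real (Suc n)) * (\<Sum>i<Suc n. y (t powr (1 + i / real (Suc n))))"
    have m: "\<omega> ?m = \<omega> y" "?m \<in> Linfty"
      by (rule mean; simp add: add_pos_nonneg)+
    have "\<omega> ?m \<le> \<omega> (\<lambda>t. (1 + 1 / real (Suc n)) * log_average y t)"
    proof (rule generalized_limit_mono[OF \<omega>(1) m(2) Linfty_mult_left[OF yL(2)]])
      fix \<epsilon> :: real assume "0 < \<epsilon>"
      show "\<forall>\<^sub>F t in at_top. ?m t \<le> (1 + 1 / real (Suc n)) * log_average y t + \<epsilon>"
        using eventually_ge_at_top[of 2]
      proof eventually_elim
        case (elim t)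
        show ?case
          using log_average_powr_bounds(2)[OF F F0 yL(1) y_eq _ elim, of "Suc n"] \<open>0 < \<epsilon>\<close> by linarith
      qed
    qed
    then show ?thesis
      by (simp only: generalized_limit_mult[OF \<omega>(1) yL(2)] m(1))
  qed
  have lim: "(\<lambda>n. (1 + 1 / real (Suc n)) * c) \<longlonglongrightarrow> c" for c
    by real_asymp
  show ?thesis
    using LIMSEQ_le_const[OF lim] upper lower by (intro antisym) blast+
qed

context infinite_separable_hilbert
begin

text \<open>The logarithmic mean has the denominator \<open>ln (1 + t)\<close> instead of \<open>ln t\<close>; the difference tends to
  zero.\<close>

lemma exponentiation_invariant_log_mean:
  assumes \<omega>: "generalized_limit \<omega>" "exponentiation_invariant \<omega>" and T: "(T :: 'a \<Rightarrow>\<^sub>L 'a) \<in> dixmier_ideal"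
  shows "\<omega> (log_average (log_mean T)) = \<omega> (log_mean T)"
proof -
  obtain C where C: "0 \<le> C" "\<And>t. 0 < t \<Longrightarrow> log_mean T t \<le> C"
    using log_mean_bounded[OF T] by blast
  define F where "F t = sv_integral T (max 0 t)" for t
  define y where "y t = (if t \<in> {2..} then F t / ln t else 0)" for t
  have F_mono: "F s \<le> F t" if "s \<le> t" for s t
    unfolding F_def by (rule sv_integral_mono) (use that in auto)
  have F0: "0 \<le> F t" for t
    unfolding F_def by (rule sv_integral_nonneg)
  have y_eq: "y t = log_mean T t * (ln (1 + t) / ln t)" if "2 \<le> t" for t
    using that by (simp add: y_def F_def log_mean_eq max_def)
  have y: "y \<in> bounded_borel"
  proof -
    have "F \<in> borel_measurable borel"
      by (rule borel_measurable_mono) (simp add: mono_def F_mono)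
    then have "y \<in> borel_measurable borel"
      unfolding y_def by measurable
    moreover have "\<bar>y t\<bar> \<le> 2 * C" for t
    proof (cases "2 \<le> t")
      case True
      have "t * 2 \<le> t * t"
        using True by (intro mult_left_mono) auto
      then have "1 + t \<le> t\<^sup>2"
        unfolding power2_eq_square using True by linarith
      then have "ln (1 + t) \<le> ln (t\<^sup>2)"
        using True by (intro ln_mono) auto
      then have "ln (1 + t) / ln t \<le> 2"
        using True by (simp add: ln_realpow divide_le_eq)
      then have "log_mean T t * (ln (1 + t) / ln t) \<le> C * 2"
        using C True by (intro mult_mono) auto
      moreover have "0 \<le> log_mean T t * (ln (1 + t) / ln t)"
        using log_mean_nonneg[of t T] True by simp
      ultimately show ?thesis
        by (simp add: y_eq[OF True])
    qed (use C(1) in \<open>simp add: y_def\<close>)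
    ultimately show ?thesis by (auto simp: bounded_borel_def)
  qed
  have yL: "y \<in> Linfty" and xL: "log_mean T \<in> Linfty"
    using y bounded_borel_Linfty log_mean_Linfty[OF T] by auto
  have diff: "((\<lambda>t. log_mean T t - y t) \<longlongrightarrow> 0) at_top"
  proof (rule Lim_null_comparison)
    show "\<forall>\<^sub>F t in at_top. norm (log_mean T t - y t) \<le> C * (ln (1 + t) / ln t - 1)"
      using eventually_ge_at_top[of 2]
    proof eventually_elim
      case (elim t)
      have "log_mean T t - y t = - (log_mean T t * (ln (1 + t) / ln t - 1))"
        by (simp add: y_eq[OF elim] right_diff_distrib)
      moreover have "0 \<le> ln (1 + t) / ln t - 1"
        using elim by (simp add: le_divide_eq)
      moreover have "0 \<le> log_mean T t" "log_mean T t \<le> C"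
        using log_mean_nonneg C(2) elim by auto
      ultimately show ?case
        by (simp add: abs_mult mult_right_mono)
    qed
    show "((\<lambda>t. C * (ln (1 + t) / ln t - 1)) \<longlongrightarrow> 0) at_top"
      by real_asymp
  qed
  have "((\<lambda>t. log_average (log_mean T) t - log_average y t) \<longlongrightarrow> 0) at_top"
    using log_average_tendsto[OF Linfty_diff[OF xL yL] diff] by (simp add: log_average_diff[OF xL yL])
  then have "\<omega> (log_average (log_mean T)) = \<omega> (log_average y)"
    by (intro generalized_limit_cong[OF \<omega>(1)] bounded_borel_Linfty log_average_bounded_borel xL yL)
  also have "\<dots> = \<omega> y"
    by (rule exponentiation_invariant_log_average[OF \<omega> F_mono F0 y]) (auto simp: y_def)
  also have "\<dots> = \<omega> (log_mean T)"
    by (rule generalized_limit_cong[OF \<omega>(1) xL yL diff, symmetric])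
  finally show ?thesis .
qed

text \<open>The two limits have the same values at logarithmic means, so the two traces have the same
  description, whether or not it determines a functional.\<close>

lemma Tr_lim_log_average:
  assumes "generalized_limit \<omega>" "exponentiation_invariant \<omega>"
  shows "(Tr_lim (\<lambda>x. \<omega> (log_average x)) :: ('a \<Rightarrow>\<^sub>L 'a) \<Rightarrow> complex) = Tr_lim \<omega>"
proof -
  have "(\<forall>T\<in>dixmier_ideal. positive_operator T \<longrightarrow> \<phi> T = complex_of_real (\<omega> (log_average (log_mean T)))) \<longleftrightarrow>
      (\<forall>T\<in>dixmier_ideal. positive_operator T \<longrightarrow> \<phi> T = complex_of_real (\<omega> (log_mean T)))"
    for \<phi> :: "('a \<Rightarrow>\<^sub>L 'a) \<Rightarrow> complex"
    by (simp add: exponentiation_invariant_log_mean[OF assms])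
  then show ?thesis
    by (simp only: Tr_lim_def)
qed

theorem exponentiation_dixmier_traces_subset:
  "(exponentiation_dixmier_traces :: (('a \<Rightarrow>\<^sub>L 'a) \<Rightarrow> complex) set) \<subseteq> dixmier_traces"
proof
  fix \<phi> :: "('a \<Rightarrow>\<^sub>L 'a) \<Rightarrow> complex"
  assume "\<phi> \<in> exponentiation_dixmier_traces"
  then obtain \<omega> where \<omega>: "generalized_limit \<omega>" "exponentiation_invariant \<omega>" "\<phi> = Tr_lim \<omega>"
    by (auto simp: exponentiation_dixmier_traces_def)
  note avg = log_average_generalized_limit[OF generalized_limit_imp_borel_limit[OF \<omega>(1)]]
  have "\<phi> = Tr_lim (\<lambda>x. \<omega> (log_average x))"
    using Tr_lim_log_average[OF \<omega>(1,2)] \<omega>(3) by simp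
  with avg show "\<phi> \<in> dixmier_traces"
    unfolding dixmier_traces_def by blast
qed

end

section \<open>An oscillating logarithmic mean\<close>

text \<open>The oscillation has period \<open>2 * pi\<close> on the scale \<open>ln (ln t)\<close>, on which exponentiation acts by
  translation. The amplitude is small enough for \<open>ln t * oscillation t\<close> to be increasing and concave
  for \<open>t \<ge> 3\<close>.\<close>

definition oscillation :: "real \<Rightarrow> real" where
  "oscillation t = 1 + sin (ln (ln t)) / 4"

definition oscillating_sum :: "real \<Rightarrow> real" where
  "oscillating_sum t = ln t * oscillation t"

text \<open>The derivative of \<open>oscillating_sum\<close>.\<close>

definition oscillating_density :: "real \<Rightarrow> real" where
  "oscillating_density t = (1 + (sin (ln (ln t)) + cos (ln (ln t))) / 4) / t"

lemma oscillation_bounds: "0 \<le> oscillation t" "oscillation t \<le> 2"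
  using sin_ge_minus_one[of "ln (ln t)"] sin_le_one[of "ln (ln t)"]
  unfolding oscillation_def by linarith+

lemma oscillation_bounded_borel: "oscillation \<in> bounded_borel"
proof -
  have "oscillation \<in> borel_measurable borel"
    unfolding oscillation_def[abs_def] by measurable
  moreover have "\<bar>oscillation t\<bar> \<le> 2" for t
    using oscillation_bounds[of t] by simp
  ultimately show ?thesis by (auto simp: bounded_borel_def)
qed

lemma DERIV_oscillating_sum:
  assumes "1 < t"
  shows "(oscillating_sum has_real_derivative oscillating_density t) (at t)"
proof -
  have "0 < ln t" using assms by simp
  then show ?thesis
    unfolding oscillating_sum_def[abs_def] oscillation_def oscillating_density_def
    using assms by (auto intro!: derivative_eq_intros simp: field_simps)
qed

lemma oscillating_density_bounds:
  assumes "0 < t"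
  shows "0 \<le> oscillating_density t" "oscillating_density t \<le> 3 / 2 / t"
proof -
  define k where "k = 1 + (sin (ln (ln t)) + cos (ln (ln t))) / 4"
  have "0 \<le> k" "k \<le> 3 / 2"
    using sin_ge_minus_one[of "ln (ln t)"] sin_le_one[of "ln (ln t)"]
      cos_ge_minus_one[of "ln (ln t)"] cos_le_one[of "ln (ln t)"] unfolding k_def add_divide_distrib by linarith+
  then show "0 \<le> oscillating_density t" "oscillating_density t \<le> 3 / 2 / t"
    unfolding oscillating_density_def k_def[symmetric] using assms
    by (intro divide_nonneg_nonneg divide_right_mono; simp)+
qed

lemma one_le_ln: "3 \<le> t \<Longrightarrow> 1 \<le> ln (t :: real)"
  using exp_le ln_ge_iff[of t 1] by linarith

lemma oscillating_density_antimono: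
  assumes "3 \<le> a" "a \<le> b"
  shows "oscillating_density b \<le> oscillating_density a"
proof (rule DERIV_nonpos_imp_nonincreasing[OF assms(2)])
  fix t assume "a \<le> t" "t \<le> b"
  then have t: "3 \<le> t" using assms(1) by simp
  define l where "l = ln t"
  have l: "1 \<le> l" using one_le_ln[OF t] by (simp add: l_def)
  define k where "k = 1 + (sin (ln l) + cos (ln l)) / 4"
  have deriv: "(oscillating_density has_real_derivative ((cos (ln l) - sin (ln l)) / (4 * l) - k) / t\<^sup>2) (at t)"
    unfolding oscillating_density_def[abs_def]
    using t l by (auto intro!: derivative_eq_intros simp: field_simps power2_eq_square k_def l_def)
  moreover have "(cos (ln l) - sin (ln l)) / (4 * l) \<le> 1 / 2"
  proof -
    have "cos (ln l) - sin (ln l) \<le> 2"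
      using sin_ge_minus_one[of "ln l"] cos_le_one[of "ln l"] by linarith
    then show ?thesis using l by (simp add: divide_le_eq)
  qed
  moreover have "1 / 2 \<le> k"
    using sin_ge_minus_one[of "ln l"] cos_ge_minus_one[of "ln l"] unfolding k_def add_divide_distrib by linarith
  ultimately have "((cos (ln l) - sin (ln l)) / (4 * l) - k) / t\<^sup>2 \<le> 0"
    by (intro divide_nonpos_nonneg) (linarith, simp)
  with deriv show "\<exists>y. (oscillating_density has_real_derivative y) (at t) \<and> y \<le> 0"
    by blast
qed

lemma oscillating_sum_mono:
  assumes "3 \<le> a" "a \<le> b"
  shows "oscillating_sum a \<le> oscillating_sum b"
proof (rule DERIV_nonneg_imp_nondecreasing[OF assms(2)])
  fix t assume "a \<le> t"
  then have "1 < t" using assms(1) by simp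
  then show "\<exists>y. (oscillating_sum has_real_derivative y) (at t) \<and> 0 \<le> y"
    using DERIV_oscillating_sum oscillating_density_bounds(1)[of t] by auto
qed

lemma oscillating_sum_mean_value:
  assumes "3 \<le> a" "a < b"
  shows "\<exists>z. a < z \<and> z < b \<and> oscillating_sum b - oscillating_sum a = (b - a) * oscillating_density z"
  by (rule MVT2[OF assms(2) DERIV_oscillating_sum]) (use assms(1) in auto)

text \<open>The increments of \<open>oscillating_sum\<close>, so that the partial sums telescope. They start at 3, where
  the sum becomes concave.\<close>

definition oscillating_eigenvalue :: "nat \<Rightarrow> real" where
  "oscillating_eigenvalue k = oscillating_sum (real k + 4) - oscillating_sum (real k + 3)"

lemma oscillating_eigenvalue_nonneg: "0 \<le> oscillating_eigenvalue k"
  using oscillating_sum_mono[of "real k + 3" "real k + 4"] by (simp add: oscillating_eigenvalue_def)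

lemma oscillating_eigenvalue_antimono:
  assumes "m \<le> n"
  shows "oscillating_eigenvalue n \<le> oscillating_eigenvalue m"
proof (rule lift_Suc_antimono_le[OF _ assms])
  fix k
  obtain u where u: "real k + 3 < u" "u < real k + 4"
    "oscillating_eigenvalue k = oscillating_density u"
    using oscillating_sum_mean_value[of "real k + 3" "real k + 4"] by (auto simp: oscillating_eigenvalue_def)
  obtain w where w: "real (Suc k) + 3 < w" "w < real (Suc k) + 4"
    "oscillating_eigenvalue (Suc k) = oscillating_density w"
    using oscillating_sum_mean_value[of "real (Suc k) + 3" "real (Suc k) + 4"] by (auto simp: oscillating_eigenvalue_def)
  have "oscillating_density w \<le> oscillating_density u"
    by (rule oscillating_density_antimono) (use u(1,2) w(1) in linarith)+
  then show "oscillating_eigenvalue (Suc k) \<le> oscillating_eigenvalue k"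
    by (simp add: u(3) w(3))
qed

lemma sum_oscillating_eigenvalue:
  "(\<Sum>k<n. oscillating_eigenvalue k) = oscillating_sum (real n + 3) - oscillating_sum 3"
proof -
  have "oscillating_eigenvalue k = oscillating_sum (real (Suc k) + 3) - oscillating_sum (real k + 3)" for k
    by (simp add: oscillating_eigenvalue_def add_ac)
  then show ?thesis
    using sum_lessThan_telescope[of "\<lambda>k. oscillating_sum (real k + 3)" n] by simp
qed

lemma sum_oscillating_eigenvalue_le:
  "(\<Sum>k<n. oscillating_eigenvalue k) \<le> 4 * ln (1 + real n)"
proof (cases "n = 0")
  case False
  define r where "r = real n"
  have r: "1 \<le> r" using False by (simp add: r_def)
  have "0 \<le> oscillating_sum 3"
    using oscillation_bounds(1)[of 3] by (simp add: oscillating_sum_def)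
  then have "(\<Sum>k<n. oscillating_eigenvalue k) \<le> ln (r + 3) * oscillation (r + 3)"
    unfolding sum_oscillating_eigenvalue by (simp add: oscillating_sum_def r_def)
  also have "\<dots> \<le> ln (r + 3) * 2"
    using r oscillation_bounds(2) by (intro mult_left_mono) auto
  also have "ln (r + 3) \<le> ln ((1 + r)\<^sup>2)"
  proof (rule ln_mono)
    have "r * 1 \<le> r * r" using r by (intro mult_left_mono) auto
    then show "r + 3 \<le> (1 + r)\<^sup>2"
      unfolding power2_eq_square ring_distribs using r by linarith
  qed (use r in auto)
  also have "ln ((1 + r)\<^sup>2) * 2 = 4 * ln (1 + r)"
    using r by (simp add: ln_realpow)
  finally show ?thesis by (simp add: r_def)
qed simp

text \<open>Raising \<open>t\<close> to the power \<open>exp pi\<close> shifts the phase by \<open>pi\<close>, so an exponentiation invariant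
  limit sees only the mean value of the oscillation.\<close>

lemma exponentiation_invariant_oscillation:
  assumes \<omega>: "generalized_limit \<omega>" "exponentiation_invariant \<omega>"
  shows "\<omega> oscillation = 1"
proof -
  define a where "a = exp pi"
  have h: "oscillation \<in> Linfty" "(\<lambda>t. oscillation (t powr a)) \<in> Linfty"
    using oscillation_bounded_borel powr_bounded_borel bounded_borel_Linfty by auto
  have "oscillation t + oscillation (t powr a) = 2" if "1 < t" for t
  proof -
    have "ln (ln (t powr a)) = pi + ln (ln t)"
      using that by (simp add: ln_powr ln_mult a_def)
    then show ?thesis by (simp add: oscillation_def sin_add)
  qed
  then have "\<forall>\<^sub>F t in at_top. oscillation t + oscillation (t powr a) = 2"
    by (intro eventually_mono[OF eventually_gt_at_top[of 1]]) simp
  then have "\<omega> (\<lambda>t. oscillation t + oscillation (t powr a)) = 2"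
    by (intro generalized_limit_eq_limit[OF \<omega>(1)] Linfty_add h tendsto_eventually)
  moreover have "\<omega> (\<lambda>t. oscillation (t powr a)) = \<omega> oscillation"
    using \<omega>(2) h(1) by (simp add: exponentiation_invariant_def a_def)
  ultimately show ?thesis
    using generalized_limit_add[OF \<omega>(1) h] by simp
qed

text \<open>In contrast, the logarithmic average keeps part of the oscillation. The phase
  \<open>pi / 4\<close> makes the contribution of the lower end point of the window vanish.\<close>

lemma log_average_oscillation:
  assumes "ln (ln t) = 2 * pi * real n + pi / 4" "1 < t"
  shows "log_average oscillation t = 1 + sqrt 2 / 4 * sin (ln 2)"
proof -
  \<comment> \<open>An antiderivative of \<open>oscillation s / s\<close>.\<close>
  define Q where "Q s = ln s + ln s * (sin (ln (ln s)) - cos (ln (ln s))) / 8" for s :: real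
  have sq: "t \<le> t\<^sup>2" using assms(2) self_le_power[of t 2] by simp
  have "((\<lambda>s. oscillation s / s) has_integral (Q (t\<^sup>2) - Q t)) {t..t\<^sup>2}"
  proof (rule fundamental_theorem_of_calculus[OF sq])
    fix s assume "s \<in> {t..t\<^sup>2}"
    then have "1 < s" using assms(2) by simp
    then have "0 < ln s" "0 < s" by simp_all
    then have "(Q has_real_derivative oscillation s / s) (at s)"
      unfolding Q_def[abs_def] oscillation_def
      by (auto intro!: derivative_eq_intros simp: field_simps)
    then show "(Q has_vector_derivative oscillation s / s) (at s within {t..t\<^sup>2})"
      by (simp add: has_real_derivative_iff_has_vector_derivative has_vector_derivative_at_within)
  qed
  then have "log_integral oscillation t (t\<^sup>2) = Q (t\<^sup>2) - Q t"
    by (simp add: log_integral_def integral_unique)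
  also have "\<dots> = ln t * (1 + sqrt 2 / 4 * sin (ln 2))"
  proof -
    have u: "0 < ln t" using assms(2) by simp
    have ln_sq: "ln (t\<^sup>2) = 2 * ln t" using assms(2) by (simp add: ln_realpow)
    have sin_t: "sin (ln (ln t)) = sqrt 2 / 2" and cos_t: "cos (ln (ln t)) = sqrt 2 / 2"
    proof -
      have "sin (2 * pi * real n) = 0" "cos (2 * pi * real n) = 1"
        using sin_2npi[of n] cos_2npi[of n] by (simp_all add: mult_ac)
      then show "sin (ln (ln t)) = sqrt 2 / 2" "cos (ln (ln t)) = sqrt 2 / 2"
        unfolding assms(1) by (simp_all add: sin_add cos_add sin_45 cos_45)
    qed
    have "ln (2 * ln t) = ln 2 + ln (ln t)"
      using u by (simp add: ln_mult)
    then have "sin (ln (2 * ln t)) - cos (ln (2 * ln t)) = sqrt 2 * sin (ln 2)"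
      by (simp add: sin_add cos_add sin_t cos_t algebra_simps)
    then have "Q (t\<^sup>2) = 2 * ln t + 2 * ln t * (sqrt 2 * sin (ln 2)) / 8"
      by (simp add: Q_def ln_sq)
    moreover have "Q t = ln t"
      by (simp add: Q_def sin_t cos_t)
    ultimately show ?thesis by (simp add: algebra_simps)
  qed
  finally show ?thesis
    using assms(2) by (simp add: log_average_def)
qed

lemma exists_dilation_invariant_oscillation:
  "\<exists>\<omega>. generalized_limit \<omega> \<and> dilation_invariant \<omega> \<and> 1 < \<omega> oscillation"
proof -
  define t where "t n = exp (exp (2 * pi * real n + pi / 4))" for n
  have "filterlim t at_top sequentially"
    unfolding t_def using pi_gt_zero by real_asymp
  then obtain \<Phi> where \<Phi>: "borel_limit \<Phi>"
    "\<And>x l. x \<in> bounded_borel \<Longrightarrow> (\<lambda>n. x (t n)) \<longlonglongrightarrow> l \<Longrightarrow> \<Phi> x = l"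
    using exists_borel_limit by blast
  have "log_average oscillation (t n) = 1 + sqrt 2 / 4 * sin (ln 2)" for n
    by (rule log_average_oscillation[of _ n]) (simp_all add: t_def)
  then have "\<Phi> (log_average oscillation) = 1 + sqrt 2 / 4 * sin (ln 2)"
    by (intro \<Phi>(2) log_average_bounded_borel bounded_borel_Linfty oscillation_bounded_borel) simp
  moreover have "0 < sin (ln 2 :: real)"
    using ln_2_less_1 pi_gt3 by (intro sin_gt_zero) auto
  ultimately show ?thesis
    using log_average_generalized_limit[OF \<Phi>(1)]
    by (intro exI[of _ "\<lambda>x. \<Phi> (log_average x)"]) simp
qed

context infinite_separable_hilbert
begin

text \<open>The right singular vectors of the zero operator.\<close>

lemma exists_orthonormal_sequence: "\<exists>v :: nat \<Rightarrow> 'a. orthonormal UNIV v"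
proof -
  have "gelfand_number n (0 :: 'a \<Rightarrow>\<^sub>L 'a) = 0" for n
    using gelfand_number_le[OF gelfand_bound_norm, of n "0 :: 'a \<Rightarrow>\<^sub>L 'a"]
      gelfand_number_nonneg[of n "0 :: 'a \<Rightarrow>\<^sub>L 'a"] by simp
  then have "(\<lambda>n. gelfand_number n (0 :: 'a \<Rightarrow>\<^sub>L 'a)) \<longlonglongrightarrow> 0" by simp
  moreover have "(0 :: 'a \<Rightarrow>\<^sub>L 'a) \<in> bounded_operators"
    by (simp add: bounded_operators_def)
  ultimately show ?thesis
    using Schmidt_vectors[OF _ _ infinite] by metis
qed

text \<open>The diagonal operator with the oscillating eigenvalues.\<close>

theorem exists_oscillating_operator:
  "\<exists>T \<in> positive_cone. ((\<lambda>t. log_mean T t - oscillation t) \<longlongrightarrow> 0) at_top"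
proof -
  obtain v :: "nat \<Rightarrow> 'a" where on: "orthonormal UNIV v"
    using exists_orthonormal_sequence by blast
  interpret schmidt_series oscillating_eigenvalue v v
    by unfold_locales (use oscillating_eigenvalue_nonneg oscillating_eigenvalue_antimono
        orthonormal_imp_suborthonormal[OF on] in auto)
  have "series_operator \<in> dixmier_ideal"
    by (rule series_operator_dixmier_ideal[of _ _ _ 4]) (unfold_locales, rule sum_oscillating_eigenvalue_le)
  then have cone: "series_operator \<in> positive_cone"
    using positive_series_operator by (simp add: positive_cone_def)
  have sum: "gelfand_sum n series_operator = oscillating_sum (real n + 3) - oscillating_sum 3" for n
    by (simp add: gelfand_sum_def gelfand_number_series[OF on on] sum_oscillating_eigenvalue)
  define C where "C = 2 + oscillating_sum 3"
  have os3: "0 \<le> oscillating_sum 3"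
    using oscillation_bounds(1)[of 3] by (simp add: oscillating_sum_def)
  have close: "\<bar>sv_integral series_operator t - oscillating_sum t\<bar> \<le> C" if t: "3 \<le> t" for t
  proof -
    define n where "n = nat \<lfloor>t\<rfloor>"
    have n: "real n \<le> t" "t \<le> real n + 1" using t unfolding n_def by linarith+
    have "oscillating_sum t \<le> oscillating_sum (real n + 3)"
      by (rule oscillating_sum_mono) (use t n in auto)
    moreover have "gelfand_sum n series_operator \<le> sv_integral series_operator t"
      unfolding n_def using t by (intro sv_integral_ge) simp
    moreover have "sv_integral series_operator t \<le> gelfand_sum (Suc n) series_operator"
      unfolding n_def using t by (intro sv_integral_le) simp
    moreover have "oscillating_sum (real (Suc n) + 3) \<le> oscillating_sum (t + 4)"
      by (rule oscillating_sum_mono) (use n in auto)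
    moreover have "oscillating_sum (t + 4) \<le> oscillating_sum t + 2"
    proof -
      obtain z where z: "t < z" "oscillating_sum (t + 4) - oscillating_sum t = 4 * oscillating_density z"
        using oscillating_sum_mean_value[of t "t + 4"] t by auto
      have "oscillating_density z \<le> 3 / 2 / z"
        by (rule oscillating_density_bounds(2)) (use z t in linarith)
      also have "\<dots> \<le> 3 / 2 / 3"
        using z t by (intro divide_left_mono) auto
      finally show ?thesis using z(2) by simp
    qed
    ultimately show ?thesis
      using os3 unfolding sum C_def by linarith
  qed
  have "((\<lambda>t. log_mean series_operator t - oscillation t) \<longlongrightarrow> 0) at_top"
  proof (rule Lim_null_comparison)
    show "\<forall>\<^sub>F t in at_top. norm (log_mean series_operator t - oscillation t) \<le>
        C / ln (1 + t) + 2 * (1 - ln t / ln (1 + t))"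
      using eventually_ge_at_top[of 3]
    proof eventually_elim
      case (elim t)
      have pos: "0 < ln (1 + t)" "0 < ln t" "ln t \<le> ln (1 + t)" using elim by auto
      have "log_mean series_operator t - oscillation t =
          (sv_integral series_operator t - oscillating_sum t) / ln (1 + t) - oscillation t * (1 - ln t / ln (1 + t))"
        using pos by (simp add: log_mean_eq oscillating_sum_def field_simps)
      also have "\<bar>\<dots>\<bar> \<le> \<bar>(sv_integral series_operator t - oscillating_sum t) / ln (1 + t)\<bar> +
          \<bar>oscillation t * (1 - ln t / ln (1 + t))\<bar>"
        by (rule abs_triangle_ineq4)
      also have "\<bar>(sv_integral series_operator t - oscillating_sum t) / ln (1 + t)\<bar> \<le> C / ln (1 + t)"
        using close[OF elim] pos by (simp add: abs_divide divide_right_mono)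
      also have "\<bar>oscillation t * (1 - ln t / ln (1 + t))\<bar> \<le> 2 * (1 - ln t / ln (1 + t))"
      proof -
        have "0 \<le> 1 - ln t / ln (1 + t)" using pos by simp
        then have "oscillation t * (1 - ln t / ln (1 + t)) \<le> 2 * (1 - ln t / ln (1 + t))"
          "0 \<le> oscillation t * (1 - ln t / ln (1 + t))"
          using oscillation_bounds[of t] by (intro mult_right_mono mult_nonneg_nonneg; simp)+
        then show ?thesis by simp
      qed
      finally show ?case by simp
    qed
    show "((\<lambda>t. C / ln (1 + t) + 2 * (1 - ln t / ln (1 + t))) \<longlongrightarrow> 0) at_top"
      by real_asymp
  qed
  with cone show ?thesis by blast
qed

theorem exists_dixmier_trace_not_exponentiation:
  "\<exists>\<phi> :: ('a \<Rightarrow>\<^sub>L 'a) \<Rightarrow> complex. \<phi> \<in> dixmier_traces \<and> \<phi> \<notin> exponentiation_dixmier_traces"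
proof -
  obtain \<omega> where \<omega>: "generalized_limit \<omega>" "dilation_invariant \<omega>" "1 < \<omega> oscillation"
    using exists_dilation_invariant_oscillation by blast
  obtain T where T: "T \<in> positive_cone" "((\<lambda>t. log_mean T t - oscillation t) \<longlongrightarrow> 0) at_top"
    using exists_oscillating_operator by blast
  have limit: "\<omega> (log_mean T) = \<omega> oscillation" if "generalized_limit \<omega>" for \<omega>
    using T by (intro generalized_limit_cong[OF that] log_mean_Linfty bounded_borel_Linfty
        oscillation_bounded_borel) (simp_all add: positive_cone_def)
  have "Tr_lim \<omega> \<notin> (exponentiation_dixmier_traces :: (('a \<Rightarrow>\<^sub>L 'a) \<Rightarrow> complex) set)"
  proof
    assume "Tr_lim \<omega> \<in> (exponentiation_dixmier_traces :: (('a \<Rightarrow>\<^sub>L 'a) \<Rightarrow> complex) set)"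
    then obtain \<omega>' where \<omega>': "generalized_limit \<omega>'" "exponentiation_invariant \<omega>'"
      and eq: "(Tr_lim \<omega> :: ('a \<Rightarrow>\<^sub>L 'a) \<Rightarrow> complex) = Tr_lim \<omega>'"
      by (auto simp: exponentiation_dixmier_traces_def)
    note avg = log_average_generalized_limit[OF generalized_limit_imp_borel_limit[OF \<omega>'(1)]]
    have T': "T \<in> dixmier_ideal" using T(1) by (simp add: positive_cone_def)
    have "complex_of_real (\<omega> oscillation) = Tr_lim \<omega> T"
      by (simp add: Tr_lim_positive_cone[OF \<omega>(1,2) T(1)] limit[OF \<omega>(1)])
    also have "\<dots> = Tr_lim (\<lambda>x. \<omega>' (log_average x)) T"
      by (simp add: eq Tr_lim_log_average[OF \<omega>'])
    also have "\<dots> = complex_of_real (\<omega>' (log_average (log_mean T)))"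
      by (rule Tr_lim_positive_cone[OF avg T(1)])
    also have "\<dots> = 1"
      by (simp add: exponentiation_invariant_log_mean[OF \<omega>' T'] limit[OF \<omega>'(1)]
          exponentiation_invariant_oscillation[OF \<omega>'])
    finally show False
      using \<omega>(3) by simp
  qed
  moreover have "Tr_lim \<omega> \<in> (dixmier_traces :: (('a \<Rightarrow>\<^sub>L 'a) \<Rightarrow> complex) set)"
    using \<omega>(1,2) by (auto simp: dixmier_traces_def)
  ultimately show ?thesis by blast
qed

end

theorem corollary9:
  assumes "separable_space (euclidean :: 'h::complex_hilbert topology)"
    and "infinite_dimensional TYPE('h)"
  shows "(exponentiation_dixmier_traces :: (('h \<Rightarrow>\<^sub>L 'h) \<Rightarrow> complex) set) \<subset> dixmier_traces"
proof -
  interpret infinite_separable_hilbert "TYPE('h)"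
    using assms by unfold_locales
  show ?thesis
    using exponentiation_dixmier_traces_subset exists_dixmier_trace_not_exponentiation by blast
qed

end
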